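(* Let $-\pi/2\le\theta_1<\theta_2\le\pi/2$. For every $A\subset W_{\theta_1,\theta_2}$ and every $y\in\mathbb{Z}^2$, the following limit, called the harmonic measure of $A$ from infinity, exists: $$\mathcal{H}^\infty_A(y):=\lim_{\|x\|_2\to\infty}\mathcal{H}_A(x,y).$$
   Context: The discrete wedge is $W_{\theta_1,\theta_2}=\{(x,y)\in\mathbb{Z}^2: \arctan(y/x)\in[\theta_1,\theta_2],\ x\ge 0\}$, with the conventions that $(0,0)$ belongs to all wedges and that $\arctan(y/0)$ equals $\pi/2$ for $y>0$ and $-\pi/2$ for $y<0$. It is considered as a graph, with edges induced from the nearest-neighbour graph $\mathbb{Z}^2$. For $x\in W_{\theta_1,\theta_2}$, $\mathbf{P}^x_{\theta_1,\theta_2}$ is the law of the simple random walk $(S_n)_{n\ge0}$ on the graph $W_{\theta_1,\theta_2}$ started at $x$; $\tau_A=\inf\{n\ge0:S_n\in A\}$ is the first hitting time of $A$; and $\mathcal{H}_A(x,y)=\mathbf{P}^x_{\theta_1,\theta_2}(S_{\tau_A}=y)$. $\|\cdot\|_2$ is the Euclidean norm, and the limit is over starting points $x\in W_{\theta_1,\theta_2}$. *)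

theory Defs
  imports "HOL-Probability.Probability"
begin

text \<open>Only points with \<open>x \<ge> 0\<close> are ever considered. The value returned at the origin is
  irrelevant, because the origin is put into every wedge separately.\<close>

definition slope_angle :: "int \<times> int \<Rightarrow> real" where
  "slope_angle = (\<lambda>(x, y).
     if x = 0 then (if y > 0 then pi / 2 else - pi / 2)
     else arctan (real_of_int y / real_of_int x))"

definition wedge :: "real \<Rightarrow> real \<Rightarrow> (int \<times> int) set" where
  "wedge \<theta>\<^sub>1 \<theta>\<^sub>2 = insert (0, 0) {p. fst p \<ge> 0 \<and> slope_angle p \<in> {\<theta>\<^sub>1..\<theta>\<^sub>2}}"

definition adjacent :: "int \<times> int \<Rightarrow> int \<times> int \<Rightarrow> bool" where
  "adjacent p q \<longleftrightarrow> \<bar>fst p - fst q\<bar> + \<bar>snd p - snd q\<bar> = 1"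

definition wedge_neighbours :: "real \<Rightarrow> real \<Rightarrow> int \<times> int \<Rightarrow> (int \<times> int) set" where
  "wedge_neighbours \<theta>\<^sub>1 \<theta>\<^sub>2 p = {q \<in> wedge \<theta>\<^sub>1 \<theta>\<^sub>2. adjacent p q}"

text \<open>A wedge may contain isolated vertices (the origin, when both angles lie strictly between
  \<open>0\<close> and \<open>pi / 2\<close>, say); there the walk stays put.\<close>

definition srw_step :: "real \<Rightarrow> real \<Rightarrow> int \<times> int \<Rightarrow> (int \<times> int) pmf" where
  "srw_step \<theta>\<^sub>1 \<theta>\<^sub>2 p =
     (if wedge_neighbours \<theta>\<^sub>1 \<theta>\<^sub>2 p = {} then return_pmf p
      else pmf_of_set (wedge_neighbours \<theta>\<^sub>1 \<theta>\<^sub>2 p))"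

text \<open>Conditional law of \<open>S\<^sub>n\<close> given the path \<open>S\<^sub>0, \<dots>, S\<^sub>n\<^sub>-\<^sub>1\<close>, as required by the
  Ionescu-Tulcea construction.\<close>

definition srw_kernel ::
  "real \<Rightarrow> real \<Rightarrow> int \<times> int \<Rightarrow> nat \<Rightarrow> (nat \<Rightarrow> int \<times> int) \<Rightarrow> (int \<times> int) measure" where
  "srw_kernel \<theta>\<^sub>1 \<theta>\<^sub>2 x n \<omega> =
     measure_pmf (if n = 0 then return_pmf x else srw_step \<theta>\<^sub>1 \<theta>\<^sub>2 (\<omega> (n - 1)))"

definition srw_law :: "real \<Rightarrow> real \<Rightarrow> int \<times> int \<Rightarrow> (nat \<Rightarrow> int \<times> int) measure" where
  "srw_law \<theta>\<^sub>1 \<theta>\<^sub>2 x =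
     projective_family.lim UNIV
       (Ionescu_Tulcea.CI (srw_kernel \<theta>\<^sub>1 \<theta>\<^sub>2 x) (\<lambda>_. count_space UNIV))
       (\<lambda>_. count_space UNIV)"

definition hitting_time :: "(int \<times> int) set \<Rightarrow> (nat \<Rightarrow> int \<times> int) \<Rightarrow> enat" where
  "hitting_time A \<omega> = Inf {enat n |n. \<omega> n \<in> A}"

definition hitting_prob ::
  "real \<Rightarrow> real \<Rightarrow> (int \<times> int) set \<Rightarrow> int \<times> int \<Rightarrow> int \<times> int \<Rightarrow> real" where
  "hitting_prob \<theta>\<^sub>1 \<theta>\<^sub>2 A x y =
     measure (srw_law \<theta>\<^sub>1 \<theta>\<^sub>2 x)
       {\<omega>. hitting_time A \<omega> < \<infinity> \<and> \<omega> (the_enat (hitting_time A \<omega>)) = y}"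

definition euclid_norm :: "int \<times> int \<Rightarrow> real" where
  "euclid_norm p = norm (real_of_int (fst p), real_of_int (snd p))"

definition wedge_at_infinity :: "real \<Rightarrow> real \<Rightarrow> (int \<times> int) filter" where
  "wedge_at_infinity \<theta>\<^sub>1 \<theta>\<^sub>2 =
     inf (filtercomap euclid_norm at_top) (principal (wedge \<theta>\<^sub>1 \<theta>\<^sub>2))"

text \<open>\<open>Lim\<close> is a definite description: the value is meaningful only where the limit exists.\<close>

definition harmonic_measure_infinity ::
  "real \<Rightarrow> real \<Rightarrow> (int \<times> int) set \<Rightarrow> int \<times> int \<Rightarrow> real" where
  "harmonic_measure_infinity \<theta>\<^sub>1 \<theta>\<^sub>2 A y =
     Lim (wedge_at_infinity \<theta>\<^sub>1 \<theta>\<^sub>2) (\<lambda>x. hitting_prob \<theta>\<^sub>1 \<theta>\<^sub>2 A x y)"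


lemma euclid_norm_eq: "euclid_norm (a, b) = sqrt ((real_of_int a)\<^sup>2 + (real_of_int b)\<^sup>2)"
  by (simp add: euclid_norm_def norm_prod_def)

lemma finite_wedge_neighbours [simp]: "finite (wedge_neighbours \<theta>\<^sub>1 \<theta>\<^sub>2 p)"
proof (rule finite_subset)
  show "wedge_neighbours \<theta>\<^sub>1 \<theta>\<^sub>2 p \<subseteq> {fst p - 1..fst p + 1} \<times> {snd p - 1..snd p + 1}"
    unfolding wedge_neighbours_def adjacent_def by auto
qed auto

lemma srw_Ionescu_Tulcea:
  "Ionescu_Tulcea (srw_kernel \<theta>\<^sub>1 \<theta>\<^sub>2 x) (\<lambda>_. count_space UNIV)"
proof (rule Ionescu_Tulcea.intro)
  fix i :: nat
  let ?S = "subprob_algebra (count_space UNIV) :: (int \<times> int) measure measure"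
  show "srw_kernel \<theta>\<^sub>1 \<theta>\<^sub>2 x i \<in> (\<Pi>\<^sub>M i\<in>{0..<i}. count_space UNIV) \<rightarrow>\<^sub>M ?S"
  proof (cases "i = 0")
    case True
    then show ?thesis
      by (simp add: srw_kernel_def[abs_def] measure_pmf_in_subprob_algebra)
  next
    case False
    then have "(\<lambda>\<omega>. \<omega> (i - 1)) \<in> (\<Pi>\<^sub>M i\<in>{0..<i}. count_space UNIV) \<rightarrow>\<^sub>M count_space (UNIV :: (int \<times> int) set)"
      by (intro measurable_component_singleton) auto
    moreover have "(\<lambda>p. measure_pmf (srw_step \<theta>\<^sub>1 \<theta>\<^sub>2 p)) \<in> count_space UNIV \<rightarrow>\<^sub>M ?S"
      by (simp add: measure_pmf_in_subprob_algebra)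
    ultimately show ?thesis
      using False by (simp add: srw_kernel_def[abs_def] measurable_compose)
  qed
next
  fix i :: nat and \<omega> :: "nat \<Rightarrow> int \<times> int"
  show "prob_space (srw_kernel \<theta>\<^sub>1 \<theta>\<^sub>2 x i \<omega>)"
    by (simp add: srw_kernel_def measure_pmf.prob_space_axioms)
qed

context
  fixes \<theta>\<^sub>1 \<theta>\<^sub>2 :: real and x :: "int \<times> int"
begin

interpretation IT: Ionescu_Tulcea "srw_kernel \<theta>\<^sub>1 \<theta>\<^sub>2 x" "\<lambda>_. count_space UNIV"
  by (rule srw_Ionescu_Tulcea)

lemma sets_srw_law [measurable_cong]:
  "sets (srw_law \<theta>\<^sub>1 \<theta>\<^sub>2 x) = sets (\<Pi>\<^sub>M i\<in>UNIV. count_space UNIV)"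
  by (simp add: srw_law_def)

lemma space_srw_law [simp]: "space (srw_law \<theta>\<^sub>1 \<theta>\<^sub>2 x) = UNIV"
  using sets_eq_imp_space_eq[OF sets_srw_law] by (simp add: space_PiM)

lemma emeasure_srw_law_cylinder:
  "emeasure (srw_law \<theta>\<^sub>1 \<theta>\<^sub>2 x) {\<omega>. \<forall>i\<le>n. \<omega> i = s i} =
     (if s 0 = x then \<Prod>i<n. ennreal (pmf (srw_step \<theta>\<^sub>1 \<theta>\<^sub>2 (s i)) (s (Suc i))) else 0)"
proof -
  let ?M = "\<lambda>_::nat. count_space (UNIV :: (int \<times> int) set)"
  define X where "X n = {restrict s {0..<n}}" for n
  have X_eq: "X n = (\<Pi>\<^sub>E i\<in>{0..<n}. {s i})" for n
  proof -
    have "(\<Pi>\<^sub>E i\<in>{0..<n}. {s i}) = (\<Pi>\<^sub>E i\<in>{0..<n}. {restrict s {0..<n} i})"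
      by (intro PiE_cong) simp
    also have "\<dots> = {restrict s {0..<n}}"
      by (rule PiE_singleton) (simp add: extensional_def)
    finally show ?thesis
      by (simp add: X_def)
  qed
  have X_sets: "X n \<in> sets (PiM {0..<n} ?M)" for n
    unfolding X_eq by (intro sets_PiM_I_finite) auto
  have X_space: "restrict s {0..<n} \<in> space (PiM {0..<n} ?M)" for n
    by (simp add: space_PiM)
  have C0: "(\<lambda>_. undefined) \<in> space (PiM {0..<0} ?M)"
    by (simp add: space_PiM)
  have sets_C: "sets (IT.C 0 n (\<lambda>_. undefined)) = sets (PiM {0..<n} ?M)" for n
    using IT.sets_C[OF C0, of n] by simp
  define K where "K n = emeasure (IT.C 0 n (\<lambda>_. undefined)) (X n)" for n
  have step: "K (Suc n) = K n * emeasure (srw_kernel \<theta>\<^sub>1 \<theta>\<^sub>2 x n (restrict s {0..<n})) {s n}" for n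
  proof -
    have ms: "emeasure (IT.C 0 (Suc n) (\<lambda>_. undefined)) (X (Suc n)) =
       (\<integral>\<^sup>+ \<omega>. emeasure (IT.eP n \<omega>) (X (Suc n)) \<partial>IT.C 0 n (\<lambda>_. undefined))"
    proof -
      have "IT.eP n \<in> IT.C 0 n (\<lambda>_. undefined) \<rightarrow>\<^sub>M subprob_algebra (PiM {0..<Suc n} ?M)"
        by (subst measurable_cong_sets[OF sets_C refl]) (rule IT.measurable_eP)
      moreover have "space (IT.C 0 n (\<lambda>_. undefined)) \<noteq> {}"
        using IT.space_C[OF C0, of n] X_space[of n] by auto
      ultimately show ?thesis
        using X_sets[of "Suc n"] by (simp add: emeasure_bind)
    qed
    also have "\<dots> = (\<integral>\<^sup>+ \<omega>. emeasure (srw_kernel \<theta>\<^sub>1 \<theta>\<^sub>2 x n (restrict s {0..<n})) {s n} *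
                      indicator (X n) \<omega> \<partial>IT.C 0 n (\<lambda>_. undefined))"
    proof (rule nn_integral_cong)
      fix \<omega> assume "\<omega> \<in> space (IT.C 0 n (\<lambda>_. undefined))"
      then have \<omega>: "\<omega> \<in> space (PiM {0..<n} ?M)"
        using IT.space_C[OF C0, of n] by simp
      then have ext: "\<omega> \<in> extensional {0..<n}"
        by (auto simp: space_PiM PiE_def)
      have "fun_upd \<omega> n -` X (Suc n) = (if \<omega> \<in> X n then {s n} else {})"
      proof -
        have "fun_upd \<omega> n p \<in> X (Suc n) \<longleftrightarrow> p = s n \<and> \<omega> \<in> X n" for p
          using ext by (auto simp: X_eq PiE_iff extensional_def)
        then show ?thesis by auto
      qed
      then show "emeasure (IT.eP n \<omega>) (X (Suc n)) =
          emeasure (srw_kernel \<theta>\<^sub>1 \<theta>\<^sub>2 x n (restrict s {0..<n})) {s n} * indicator (X n) \<omega>"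
        using IT.emeasure_eP[OF \<omega> X_sets] by (auto simp: X_def)
    qed
    also have "\<dots> = emeasure (srw_kernel \<theta>\<^sub>1 \<theta>\<^sub>2 x n (restrict s {0..<n})) {s n} * K n"
      unfolding K_def using X_sets[of n] IT.sets_C[OF C0, of n]
      by (intro nn_integral_cmult_indicator) simp
    finally show ?thesis
      by (simp add: K_def mult.commute)
  qed
  have K0: "K 0 = 1"
    using X_sets[of 0] by (auto simp: K_def X_def restrict_def)
  have K_Suc: "K (Suc n) =
    (if s 0 = x then \<Prod>i<n. ennreal (pmf (srw_step \<theta>\<^sub>1 \<theta>\<^sub>2 (s i)) (s (Suc i))) else 0)" for n
  proof (induction n)
    case 0
    then show ?case
      by (simp add: step K0 srw_kernel_def emeasure_pmf_single)
  next
    case (Suc n)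
    have "K (Suc (Suc n)) =
      K (Suc n) * ennreal (pmf (srw_step \<theta>\<^sub>1 \<theta>\<^sub>2 (s n)) (s (Suc n)))"
      by (subst step) (simp add: srw_kernel_def emeasure_pmf_single)
    then show ?case
      by (simp add: Suc.IH)
  qed
  have cyl: "{\<omega>. \<forall>i\<le>n. \<omega> i = s i} = IT.PF.emb UNIV {0..<Suc n} (X (Suc n))"
    unfolding X_eq by (auto simp: prod_emb_iff PiE_iff less_Suc_eq_le)
  have emb: "IT.PF.emb {0..<Suc n} {0..<Suc n} (X (Suc n)) = X (Suc n)"
    using sets.sets_into_space[OF X_sets] by (intro prod_emb_id) (simp add: space_PiM)
  have "emeasure (srw_law \<theta>\<^sub>1 \<theta>\<^sub>2 x) {\<omega>. \<forall>i\<le>n. \<omega> i = s i} =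
      emeasure (IT.CI {0..<Suc n}) (X (Suc n))"
    unfolding srw_law_def cyl by (rule IT.lim[OF finite_atLeastLessThan X_sets])
  also have "\<dots> = K (Suc n)"
    by (subst IT.emeasure_CI[OF subset_refl X_sets]) (simp only: K_def emb)
  also note K_Suc
  finally show ?thesis .
qed

lemma prob_space_srw_law: "prob_space (srw_law \<theta>\<^sub>1 \<theta>\<^sub>2 x)"
proof
  let ?M = "\<lambda>_::nat. count_space (UNIV :: (int \<times> int) set)"
  let ?X = "space (PiM {} ?M)"
  have "emeasure (srw_law \<theta>\<^sub>1 \<theta>\<^sub>2 x) (IT.PF.emb UNIV {} ?X) = IT.CI {} ?X"
    unfolding srw_law_def by (intro IT.lim) auto
  moreover have "IT.PF.emb UNIV {} ?X = UNIV"
    by (auto simp: prod_emb_def space_PiM)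
  ultimately have "emeasure (srw_law \<theta>\<^sub>1 \<theta>\<^sub>2 x) UNIV = IT.CI {} ?X"
    by simp
  also have "\<dots> = 1"
    using prob_space.emeasure_space_1[OF IT.PF.prob_space_P[of "{}"]] IT.PF.space_P[of "{}"] by simp
  finally show "emeasure (srw_law \<theta>\<^sub>1 \<theta>\<^sub>2 x) (space (srw_law \<theta>\<^sub>1 \<theta>\<^sub>2 x)) = 1"
    by simp
qed

end

lemma hitting_time_less_infinity_iff: "hitting_time A \<omega> < \<infinity> \<longleftrightarrow> (\<exists>n. \<omega> n \<in> A)"
  unfolding hitting_time_def Inf_less_iff by auto

lemma hitting_time_eq_Least:
  assumes "\<omega> n \<in> A"
  shows "hitting_time A \<omega> = enat (LEAST n. \<omega> n \<in> A)"
  unfolding hitting_time_def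
proof (rule Inf_eqI)
  show "enat (LEAST n. \<omega> n \<in> A) \<le> k" if "k \<in> {enat n |n. \<omega> n \<in> A}" for k
    using that by (auto intro: Least_le)
  show "k \<le> enat (LEAST n. \<omega> n \<in> A)" if "\<And>i. i \<in> {enat n |n. \<omega> n \<in> A} \<Longrightarrow> k \<le> i" for k
    using that LeastI[of "\<lambda>n. \<omega> n \<in> A", OF assms] by blast
qed

lemma hitting_event_eq:
  "{\<omega>. hitting_time A \<omega> < \<infinity> \<and> \<omega> (the_enat (hitting_time A \<omega>)) = y} =
   (\<Union>n. {\<omega>. (\<forall>i<n. \<omega> i \<notin> A) \<and> \<omega> n \<in> A \<and> \<omega> n = y})"
proof (intro set_eqI iffI)
  fix \<omega> assume "\<omega> \<in> {\<omega>. hitting_time A \<omega> < \<infinity> \<and> \<omega> (the_enat (hitting_time A \<omega>)) = y}"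
  then obtain n where n: "\<omega> n \<in> A" and y: "\<omega> (the_enat (hitting_time A \<omega>)) = y"
    unfolding mem_Collect_eq hitting_time_less_infinity_iff by blast
  let ?l = "LEAST n. \<omega> n \<in> A"
  have ht: "hitting_time A \<omega> = enat ?l"
    using n by (rule hitting_time_eq_Least)
  have "\<omega> ?l = y"
    using y unfolding ht by simp
  moreover have "\<omega> ?l \<in> A"
    using n by (rule LeastI)
  moreover have "\<forall>i<?l. \<omega> i \<notin> A"
    by (blast dest: not_less_Least)
  ultimately show "\<omega> \<in> (\<Union>n. {\<omega>. (\<forall>i<n. \<omega> i \<notin> A) \<and> \<omega> n \<in> A \<and> \<omega> n = y})"
    unfolding UN_iff mem_Collect_eq by (intro bexI[of _ ?l] conjI UNIV_I)
next
  fix \<omega> :: "nat \<Rightarrow> int \<times> int"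
  assume "\<omega> \<in> (\<Union>n. {\<omega>. (\<forall>i<n. \<omega> i \<notin> A) \<and> \<omega> n \<in> A \<and> \<omega> n = y})"
  then obtain n where n: "\<forall>i<n. \<omega> i \<notin> A" "\<omega> n \<in> A" "\<omega> n = y"
    by auto
  have "(LEAST n. \<omega> n \<in> A) = n"
  proof (rule le_antisym)
    show "(LEAST n. \<omega> n \<in> A) \<le> n"
      using n(2) by (rule Least_le)
    have "\<omega> (LEAST n. \<omega> n \<in> A) \<in> A"
      using n(2) by (rule LeastI)
    then show "n \<le> (LEAST n. \<omega> n \<in> A)"
      using n(1) not_le_imp_less by blast
  qed
  then have "hitting_time A \<omega> = enat n"
    using hitting_time_eq_Least[of \<omega> n A] n(2) by simp
  then show "\<omega> \<in> {\<omega>. hitting_time A \<omega> < \<infinity> \<and> \<omega> (the_enat (hitting_time A \<omega>)) = y}"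
    using n(3) by simp
qed

lemma hitting_event_sets:
  "{\<omega>. hitting_time A \<omega> < \<infinity> \<and> \<omega> (the_enat (hitting_time A \<omega>)) = y} \<in> sets (srw_law \<theta>\<^sub>1 \<theta>\<^sub>2 x)"
proof -
  have "{\<omega>. \<omega> i \<in> B} \<in> sets (srw_law \<theta>\<^sub>1 \<theta>\<^sub>2 x)" for i B
  proof -
    have "(\<lambda>\<omega>. \<omega> i) \<in> (\<Pi>\<^sub>M i\<in>UNIV. count_space UNIV) \<rightarrow>\<^sub>M count_space (UNIV :: (int \<times> int) set)"
      by (rule measurable_component_singleton) simp
    then have "(\<lambda>\<omega>. \<omega> i) -` B \<inter> space (\<Pi>\<^sub>M i\<in>UNIV. count_space (UNIV :: (int \<times> int) set))
        \<in> sets (\<Pi>\<^sub>M i\<in>UNIV. count_space UNIV)"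
      by (rule measurable_sets) simp
    then show ?thesis
      by (simp add: sets_srw_law space_PiM vimage_def)
  qed
  note B = this
  have eq: "{\<omega>. (\<forall>i<n. \<omega> i \<notin> A) \<and> \<omega> n \<in> A \<and> \<omega> n = y} =
      {\<omega>. \<omega> n \<in> A \<inter> {y}} - (\<Union>i<n. {\<omega>. \<omega> i \<in> A})" for n :: nat
    by auto
  show ?thesis
    unfolding hitting_event_eq eq
    by (intro sets.countable_UN image_subsetI sets.Diff sets.finite_UN B) auto
qed

lemma wedge_at_infinity_neq_bot:
  assumes "- pi / 2 \<le> \<theta>\<^sub>1" "\<theta>\<^sub>1 < \<theta>\<^sub>2" "\<theta>\<^sub>2 \<le> pi / 2"
  shows "wedge_at_infinity \<theta>\<^sub>1 \<theta>\<^sub>2 \<noteq> bot"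
proof -
  obtain s where s: "\<theta>\<^sub>1 < s" "s < \<theta>\<^sub>2"
    using dense[OF assms(2)] by blast
  obtain t where t: "s < t" "t < \<theta>\<^sub>2"
    using dense[OF s(2)] by blast
  have "tan s < tan t"
    using assms s t by (intro tan_monotone) auto
  then obtain q where q: "q \<in> \<rat>" "tan s < q" "q < tan t"
    using Rats_dense_in_real[of "tan s" "tan t"] by blast
  have "arctan (tan s) < arctan q" "arctan q < arctan (tan t)"
    using q by (simp_all add: arctan_less_iff)
  then have arc: "\<theta>\<^sub>1 \<le> arctan q" "arctan q \<le> \<theta>\<^sub>2"
    using assms s t by (simp_all add: arctan_tan)
  obtain a b :: int where ab: "b > 0" "q = real_of_int a / real_of_int b"
    using q(1) by (rule Rats_cases') blast
  have wedge: "(int k * b, int k * a) \<in> wedge \<theta>\<^sub>1 \<theta>\<^sub>2" for k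
    using arc ab by (cases "k = 0") (auto simp: wedge_def slope_angle_def)
  have large: "euclid_norm (int k * b, int k * a) \<ge> real k" for k
  proof -
    have "real k * 1 \<le> real k * real_of_int b"
      using ab(1) by (intro mult_left_mono) auto
    also have "\<dots> \<le> euclid_norm (int k * b, int k * a)"
      unfolding euclid_norm_eq by (auto intro: real_le_rsqrt)
    finally show ?thesis by simp
  qed
  have "\<exists>p\<in>wedge \<theta>\<^sub>1 \<theta>\<^sub>2. euclid_norm p \<ge> r" for r
  proof -
    obtain k where "r \<le> real k"
      using real_arch_simple by blast
    then show ?thesis
      using wedge[of k] large[of k] by (intro bexI[of _ "(int k * b, int k * a)"]) linarith+
  qed
  then show ?thesis
    unfolding wedge_at_infinity_def trivial_limit_def eventually_inf_principal
      eventually_filtercomap eventually_at_top_linorder by blast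
qed

end

theory Submission
  imports Defs
begin

text \<open>
  Write \<open>f x\<close> for the probability that the walk from \<open>x\<close> first meets \<open>A\<close> at \<open>y\<close>. This function is
  bounded, it is the indicator of \<open>y\<close> on \<open>A\<close>, and at every other point it is the mean of its values
  at the neighbours. The proof uses these three properties only and is a piece of
  two-dimensional potential theory, based on the Dirichlet energy \<open>\<Sum>\<^sub>e (\<nabla>f e)\<^sup>2\<close>.

  Geometry. A wedge is the cone cut out by two linear inequalities (\<open>wedge_iff\<close>), so the sum of two of
  its points lies in it again. A narrow wedge may fall apart near its apex, but all except
  finitely many points lie in one component \<open>V\<close>, and \<open>V\<close> is mapped into itself by
  translation by its own points. So it suffices to take limits along \<open>V\<close>.

  Recurrence enters as the existence of finitely supported functions that tend to \<open>1\<close> while their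
  energies tend to \<open>0\<close>; radial logarithmic functions do this in every subgraph of the square lattice.
  A Caccioppoli estimate turns them into a bound for the energy of a bounded function that is
  harmonic off a finite set (\<open>energy_bound\<close>), which contains the maximum principle
  (\<open>maximum_principle\<close>), and into Green's formula (\<open>green\<close>).

  Finite \<open>A\<close>. The points of the wedge with \<open>max x \<bar>y\<bar> = r\<close> form a path of length at most \<open>4 r\<close>, and these
  arcs are disjoint. By the Cauchy-Schwarz inequality the squared oscillation of \<open>f\<close> on the arc is at most
  \<open>4 r\<close> times the energy carried by the arc. As the energy is finite and \<open>\<Sum> 1 / r\<close> diverges, the oscillation
  is small on some arcs arbitrarily far out (the Courant-Lebesgue argument), and by the maximum
  principle it is then small in all of the region beyond such an arc. Hence \<open>f\<close> converges (\<open>harmonic_converges\<close>).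

  Infinite \<open>A\<close>. Here the limit is \<open>0\<close>. If \<open>B\<close> is finite with \<open>y \<in> B \<subseteq> A\<close>, then \<open>f\<close> is at most the hitting
  probability of \<open>y\<close> with respect to \<open>B\<close>, whose limit is called \<open>L\<close>. Adding a point \<open>z\<close> to \<open>B\<close> replaces \<open>L\<close> by
  \<open>L - l * hit B z y\<close>, where \<open>l\<close> is the probability that the walk from infinity meets \<open>B \<union> {z}\<close> first in \<open>z\<close>.
  When \<open>z\<close> is far away, \<open>hit B z y\<close> is near \<open>L\<close>, so everything rests on a positive lower bound for \<open>l\<close>; with
  \<open>l \<ge> 1 / 4\<close> each step multiplies the limit by at most \<open>7 / 8\<close> (\<open>hit_limit_decreases\<close>).

  The lower bound is reduced to one fixed point \<open>b\<close> in place of \<open>B\<close>, and comes from effective resistances.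
  For \<open>z = b + w\<close> the probability of meeting \<open>z\<close> before \<open>b\<close> from \<open>x\<close> is
  \<open>1 / 2 + (R(x, b) - R(x, z)) / (2 * R(z, b))\<close>. Translation by \<open>w\<close> embeds \<open>V\<close> into itself, so by Rayleigh
  monotonicity \<open>R(x, z) \<le> R(x - w, b)\<close> (\<open>resistance_translate\<close>). Along \<open>x = b + k * w\<close> the nonnegative numbers
  \<open>R(x, b)\<close> cannot go down by a fixed amount at every step, so the limit of the probability is at
  least \<open>1 / 2\<close> (\<open>potential_limit_ge_half\<close>). A general far point \<open>z\<close> is joined to \<open>z + b\<close> by a path of bounded length,
  and the two are equivalent up to an error that vanishes at infinity.
\<close>


section \<open>Sums over edges as integrals\<close>

text \<open>The quadratic form \<open>\<integral>(s f - t g)\<^sup>2\<close> is nonnegative. With \<open>s = \<integral>g\<^sup>2\<close> and \<open>t = \<integral>f g\<close> this gives the claim unless \<open>s = 0\<close>,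
  and then nonnegativity for all \<open>t\<close> forces the mixed term to vanish.\<close>

lemma Cauchy_Schwarz_integral:
  fixes f g :: "'a \<Rightarrow> real"
  assumes f: "integrable M (\<lambda>x. (f x)\<^sup>2)" and g: "integrable M (\<lambda>x. (g x)\<^sup>2)"
    and fg: "integrable M (\<lambda>x. f x * g x)"
  shows "(\<integral>x. f x * g x \<partial>M)\<^sup>2 \<le> (\<integral>x. (f x)\<^sup>2 \<partial>M) * (\<integral>x. (g x)\<^sup>2 \<partial>M)"
proof -
  define a b c where "a = (\<integral>x. (f x)\<^sup>2 \<partial>M)" and "b = (\<integral>x. f x * g x \<partial>M)" and "c = (\<integral>x. (g x)\<^sup>2 \<partial>M)"
  have quad: "0 \<le> a * s\<^sup>2 - 2 * s * t * b + c * t\<^sup>2" for s t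
  proof -
    have "0 \<le> (\<integral>x. (s * f x - t * g x)\<^sup>2 \<partial>M)"
      by (rule integral_nonneg_AE) simp
    also have "(\<integral>x. (s * f x - t * g x)\<^sup>2 \<partial>M)
        = (\<integral>x. s\<^sup>2 * (f x)\<^sup>2 - 2 * s * t * (f x * g x) + t\<^sup>2 * (g x)\<^sup>2 \<partial>M)"
      by (rule arg_cong[where f = "integral\<^sup>L M"]) (auto simp: fun_eq_iff power2_eq_square algebra_simps)
    also have "\<dots> = s\<^sup>2 * a - 2 * s * t * b + t\<^sup>2 * c"
      using f g fg by (simp add: a_def b_def c_def)
    finally show ?thesis by (simp add: algebra_simps)
  qed
  have "a \<ge> 0" "c \<ge> 0"
    by (auto simp: a_def c_def intro: integral_nonneg_AE)
  have "b\<^sup>2 \<le> a * c"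
  proof (cases "c = 0")
    case True
    have "b = 0"
    proof (rule ccontr)
      assume "b \<noteq> 0"
      have "0 \<le> a - 2 * ((a + 1) / (2 * b)) * b"
        using quad[of 1 "(a + 1) / (2 * b)"] True by simp
      also have "\<dots> = -1"
        using \<open>b \<noteq> 0\<close> by (simp add: field_simps)
      finally show False by simp
    qed
    then show ?thesis using True by simp
  next
    case False
    have "0 \<le> a * c\<^sup>2 - 2 * c * b * b + c * b\<^sup>2"
      using quad[of c b] by simp
    also have "\<dots> = c * (a * c - b\<^sup>2)"
      by (simp add: power2_eq_square algebra_simps)
    finally have "0 \<le> c * (a * c - b\<^sup>2)" .
    then show ?thesis using \<open>c \<ge> 0\<close> False by (simp add: zero_le_mult_iff)
  qed
  then show ?thesis by (simp add: a_def b_def c_def)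
qed

lemma integrable_count_space_finite_support:
  fixes f :: "'a \<Rightarrow> real"
  assumes "finite {a \<in> A. f a \<noteq> 0}"
  shows "integrable (count_space A) f"
proof -
  let ?S = "{a \<in> A. f a \<noteq> 0}"
  have "integrable (count_space A) (\<lambda>a. indicator ?S a *\<^sub>R f a)"
    using assms integrable_count_space[OF assms, of f]
    by (subst integrable_restrict_space[symmetric]) (auto simp: restrict_count_space Int_absorb2)
  also have "?this \<longleftrightarrow> ?thesis"
    by (rule Bochner_Integration.integrable_cong) (auto simp: indicator_def)
  finally show ?thesis .
qed

section \<open>Dirichlet energy and the maximum principle on recurrent graphs\<close>

text \<open>The functions \<open>\<eta> n\<close> witness recurrence: the conductance between a point and infinity is \<open>0\<close> exactly if
  finitely supported functions of arbitrarily small energy approximate the constant \<open>1\<close>. Each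
  edge occurs in \<open>Sigma V nb\<close> in both orientations, so all energies below are twice the usual ones.\<close>

locale recurrent_graph =
  fixes V :: "'a set" and nb :: "'a \<Rightarrow> 'a set" and \<eta> :: "nat \<Rightarrow> 'a \<Rightarrow> real"
  assumes nb_finite: "p \<in> V \<Longrightarrow> finite (nb p)"
    and nb_subset: "p \<in> V \<Longrightarrow> nb p \<subseteq> V"
    and nb_sym: "p \<in> V \<Longrightarrow> q \<in> nb p \<Longrightarrow> p \<in> nb q"
    and connected: "p \<in> V \<Longrightarrow> q \<in> V \<Longrightarrow> (p, q) \<in> (Sigma V nb)\<^sup>*"
    and cutoff_nonneg: "0 \<le> \<eta> n p"
    and cutoff_le_1: "\<eta> n p \<le> 1"
    and cutoff_finite_support: "finite {p \<in> V. \<eta> n p \<noteq> 0}"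
    and cutoff_tendsto_1: "p \<in> V \<Longrightarrow> (\<lambda>n. \<eta> n p) \<longlonglongrightarrow> 1"
    and cutoff_energy_tendsto_0:
      "(\<lambda>n. \<integral>e. (\<eta> n (snd e) - \<eta> n (fst e))\<^sup>2 \<partial>count_space (Sigma V nb)) \<longlonglongrightarrow> 0"
begin

abbreviation edges :: "('a \<times> 'a) set" where "edges \<equiv> Sigma V nb"

definition grad :: "('a \<Rightarrow> real) \<Rightarrow> 'a \<times> 'a \<Rightarrow> real" where
  "grad u e = u (snd e) - u (fst e)"

definition lap :: "('a \<Rightarrow> real) \<Rightarrow> 'a \<Rightarrow> real" where
  "lap u p = (\<Sum>q\<in>nb p. u q - u p)"

definition form :: "('a \<Rightarrow> real) \<Rightarrow> ('a \<Rightarrow> real) \<Rightarrow> real" where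
  "form u v = (\<integral>e. grad u e * grad v e \<partial>count_space edges)"

definition finite_energy :: "('a \<Rightarrow> real) \<Rightarrow> bool" where
  "finite_energy u \<longleftrightarrow> integrable (count_space edges) (\<lambda>e. (grad u e)\<^sup>2)"

lemma nb_in_V: "p \<in> V \<Longrightarrow> q \<in> nb p \<Longrightarrow> q \<in> V"
  using nb_subset by blast

lemma edges_snd: "e \<in> edges \<Longrightarrow> snd e \<in> V"
  by (auto intro: nb_in_V)

lemma form_self: "form u u = (\<integral>e. (grad u e)\<^sup>2 \<partial>count_space edges)"
  by (simp add: form_def power2_eq_square)

lemma form_self_nonneg: "form u u \<ge> 0"
  unfolding form_self by (rule integral_nonneg_AE) simp

lemma form_commute: "form u v = form v u"
  by (simp add: form_def mult.commute)

lemma integrable_grad_mult: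
  assumes "finite_energy u" "finite_energy v"
  shows "integrable (count_space edges) (\<lambda>e. grad u e * grad v e)"
proof (rule Bochner_Integration.integrable_bound)
  show "integrable (count_space edges) (\<lambda>e. (grad u e)\<^sup>2 + (grad v e)\<^sup>2)"
    using assms by (simp add: finite_energy_def)
  have "\<bar>x * y\<bar> \<le> x\<^sup>2 + y\<^sup>2" for x y :: real
  proof -
    have "0 \<le> (\<bar>x\<bar> - \<bar>y\<bar>)\<^sup>2" by simp
    also have "\<dots> = x\<^sup>2 + y\<^sup>2 - 2 * \<bar>x * y\<bar>" by (simp add: power2_diff abs_mult)
    finally show ?thesis using abs_ge_zero[of "x * y"] by linarith
  qed
  then show "AE e in count_space edges. norm (grad u e * grad v e) \<le> norm ((grad u e)\<^sup>2 + (grad v e)\<^sup>2)"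
    by simp
qed simp

lemma grad_lincomb: "grad (\<lambda>p. a * u p - b * v p) e = a * grad u e - b * grad v e"
  by (simp add: grad_def algebra_simps)

lemma finite_energy_lincomb:
  assumes "finite_energy u" "finite_energy v"
  shows "finite_energy (\<lambda>p. a * u p - b * v p)"
proof -
  have "integrable (count_space edges) (\<lambda>e. a\<^sup>2 * (grad u e)\<^sup>2 - 2 * a * b * (grad u e * grad v e) + b\<^sup>2 * (grad v e)\<^sup>2)"
    using assms integrable_grad_mult[OF assms] by (simp add: finite_energy_def)
  then show ?thesis
    unfolding finite_energy_def grad_lincomb by (simp add: power2_eq_square algebra_simps)
qed

lemma form_lincomb_left:
  assumes "finite_energy u" "finite_energy v" "finite_energy w"
  shows "form (\<lambda>p. a * u p - b * v p) w = a * form u w - b * form v w"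
proof -
  have "form (\<lambda>p. a * u p - b * v p) w
      = (\<integral>e. a * (grad u e * grad w e) - b * (grad v e * grad w e) \<partial>count_space edges)"
    unfolding form_def grad_lincomb by (simp add: algebra_simps)
  then show ?thesis
    using integrable_grad_mult[OF assms(1,3)] integrable_grad_mult[OF assms(2,3)]
    by (simp add: form_def)
qed

lemma form_Cauchy_Schwarz:
  assumes "finite_energy u" "finite_energy v"
  shows "(form u v)\<^sup>2 \<le> form u u * form v v"
  using Cauchy_Schwarz_integral[of "count_space edges" "grad u" "grad v"] assms
    integrable_grad_mult[OF assms]
  by (simp add: form_self finite_energy_def form_def[of u v])

lemma lap_lincomb: "p \<in> V \<Longrightarrow> lap (\<lambda>p. a * u p - b * v p) p = a * lap u p - b * lap v p"
  by (simp add: lap_def sum_distrib_left sum_subtractf[symmetric] algebra_simps)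

lemma finite_support_edges:
  assumes "finite {p \<in> V. \<phi> p \<noteq> (0::real)}"
  shows "finite {e \<in> edges. \<phi> (fst e) \<noteq> 0 \<or> \<phi> (snd e) \<noteq> 0}"
proof (rule finite_subset)
  let ?S = "{p \<in> V. \<phi> p \<noteq> 0}"
  show "{e \<in> edges. \<phi> (fst e) \<noteq> 0 \<or> \<phi> (snd e) \<noteq> 0} \<subseteq> Sigma ?S nb \<union> prod.swap ` Sigma ?S nb"
    using nb_subset nb_sym by (force simp: image_iff)
  show "finite (Sigma ?S nb \<union> prod.swap ` Sigma ?S nb)"
    using assms nb_finite by auto
qed

lemma integrable_finite_support:
  assumes "finite {p \<in> V. \<phi> p \<noteq> (0::real)}"
    and "\<And>e. e \<in> edges \<Longrightarrow> \<phi> (fst e) = 0 \<Longrightarrow> \<phi> (snd e) = 0 \<Longrightarrow> g e = 0"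
  shows "integrable (count_space edges) (g :: 'a \<times> 'a \<Rightarrow> real)"
  by (rule integrable_count_space_finite_support, rule finite_subset[OF _ finite_support_edges[OF assms(1)]])
    (use assms(2) in auto)

lemma finite_energy_finite_support:
  assumes "finite {p \<in> V. \<phi> p \<noteq> 0}"
  shows "finite_energy \<phi>"
  unfolding finite_energy_def by (rule integrable_finite_support[OF assms]) (simp add: grad_def)

lemma bij_swap_edges: "bij_betw prod.swap edges edges"
  by (rule bij_betwI[where g = prod.swap]) (auto intro: nb_in_V nb_sym)

text \<open>Summation by parts: a sum over oriented edges is invariant under reversal, so
  both halves of the gradient of \<open>\<phi>\<close> contribute the same amount.\<close>

lemma green_finite_support:
  assumes fin: "finite {p \<in> V. \<phi> p \<noteq> 0}"
  shows "form u \<phi> = - 2 * (\<Sum>p | p \<in> V \<and> \<phi> p \<noteq> 0. \<phi> p * lap u p)"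
proof -
  let ?M = "count_space edges" and ?S = "{p \<in> V. \<phi> p \<noteq> 0}"
  define g where "g e = grad u e * \<phi> (fst e)" for e
  have g: "integrable ?M g" and gs: "integrable ?M (\<lambda>e. g (prod.swap e))"
    by (auto intro!: integrable_finite_support[OF fin] simp: g_def)
  have "form u \<phi> = (\<integral>e. - g (prod.swap e) - g e \<partial>?M)"
    unfolding form_def
    by (rule Bochner_Integration.integral_cong) (auto simp: g_def grad_def algebra_simps)
  also have "\<dots> = - (\<integral>e. g (prod.swap e) \<partial>?M) - (\<integral>e. g e \<partial>?M)"
    using g gs by simp
  also have "(\<integral>e. g (prod.swap e) \<partial>?M) = (\<integral>e. g e \<partial>?M)"
    by (rule integral_bij_count_space[OF bij_swap_edges])
  also have "(\<integral>e. g e \<partial>?M) = (\<Sum>e\<in>Sigma ?S nb. g e)"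
  proof -
    have fin': "finite (Sigma ?S nb)"
      using fin nb_finite by auto
    have sub: "{e \<in> edges. g e \<noteq> 0} \<subseteq> Sigma ?S nb"
      by (auto simp: g_def)
    show ?thesis
      using fin' sub finite_subset[OF sub fin']
      by (subst lebesgue_integral_count_space_finite_support) (auto intro!: sum.mono_neutral_left)
  qed
  also have "(\<Sum>e\<in>Sigma ?S nb. g e) = (\<Sum>p\<in>?S. \<Sum>q\<in>nb p. g (p, q))"
    using fin nb_finite by (subst sum.Sigma) auto
  also have "\<dots> = (\<Sum>p\<in>?S. \<phi> p * lap u p)"
    by (rule sum.cong) (auto simp: g_def lap_def grad_def sum_distrib_left mult.commute)
  finally show ?thesis by simp
qed

lemma cutoff_energy: "(\<lambda>n. form (\<eta> n) (\<eta> n)) \<longlonglongrightarrow> 0"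
  using cutoff_energy_tendsto_0 by (simp add: form_self grad_def)

text \<open>The inequality behind the Caccioppoli estimate, on one edge: \<open>s\<close>, \<open>t\<close> are the values of the function and \<open>a\<close>, \<open>b\<close>
  those of the cutoff at the two ends. The cross term produced by differentiating \<open>\<eta>\<^sup>2 v\<close> is absorbed
  by completing a square.\<close>

lemma caccioppoli_pointwise:
  fixes a b s t M :: real
  assumes "\<bar>s\<bar> \<le> M" "\<bar>t\<bar> \<le> M"
  shows "(a\<^sup>2 + b\<^sup>2) / 4 * (t - s)\<^sup>2 \<le> (t - s) * (b\<^sup>2 * t - a\<^sup>2 * s) + 2 * M\<^sup>2 * (b - a)\<^sup>2"
proof -
  define X where "X = (a + b) * (t - s)"
  define Y where "Y = (s + t) * (b - a)"
  have eq: "(t - s) * (b\<^sup>2 * t - a\<^sup>2 * s) = (a\<^sup>2 + b\<^sup>2) / 2 * (t - s)\<^sup>2 + X * Y / 2"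
    by (simp add: X_def Y_def power2_eq_square field_simps)
  have "0 \<le> (X / 2 + Y)\<^sup>2" by simp
  then have XY: "X * Y \<ge> - (X\<^sup>2 / 4 + Y\<^sup>2)"
    by (simp add: power2_eq_square field_simps)
  have "(a + b)\<^sup>2 \<le> 2 * (a\<^sup>2 + b\<^sup>2)"
    using zero_le_power2[of "a - b"] by (simp add: power2_eq_square algebra_simps)
  then have X: "X\<^sup>2 \<le> 2 * (a\<^sup>2 + b\<^sup>2) * (t - s)\<^sup>2"
    unfolding X_def power_mult_distrib by (intro mult_right_mono) auto
  have "\<bar>s + t\<bar> \<le> 2 * M" using assms by linarith
  then have "(s + t)\<^sup>2 \<le> (2 * M)\<^sup>2"
    by (metis abs_ge_zero power2_abs power_mono)
  then have Y: "Y\<^sup>2 \<le> 4 * M\<^sup>2 * (b - a)\<^sup>2"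
    unfolding Y_def power_mult_distrib by (intro mult_right_mono) auto
  define P Q where "P = (a\<^sup>2 + b\<^sup>2) * (t - s)\<^sup>2" and "Q = M\<^sup>2 * (b - a)\<^sup>2"
  have "P / 4 \<le> P / 2 + X * Y / 2 + 2 * Q"
    using XY X[unfolded mult.assoc, folded P_def] Y[unfolded mult.assoc, folded Q_def] by simp
  then show ?thesis
    unfolding eq by (simp add: P_def Q_def)
qed

text \<open>Test \<open>v\<close> against \<open>\<eta>\<^sup>2 v\<close>: by summation by parts the pairing is at most the contribution of \<open>S\<close>, since \<open>v * lap v\<close> is
  nonnegative elsewhere, and the error caused by the cutoff is \<open>2 M\<^sup>2\<close> times its energy, which tends
  to \<open>0\<close>. Fatou's lemma passes to the limit. The case \<open>S = {}\<close> says that \<open>v\<close> has no energy, which is the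
  Liouville property of recurrent graphs.\<close>

lemma energy_bound:
  assumes M: "\<And>p. p \<in> V \<Longrightarrow> \<bar>v p\<bar> \<le> M"
    and S: "finite S" "S \<subseteq> V"
    and sub: "\<And>p. p \<in> V - S \<Longrightarrow> v p * lap v p \<ge> 0"
  shows "finite_energy v" and "form v v \<le> 4 * (\<Sum>p\<in>S. \<bar>v p * lap v p\<bar>)"
proof -
  let ?M = "count_space edges"
  define T where "T = 2 * (\<Sum>p\<in>S. \<bar>v p * lap v p\<bar>)"
  have T0: "T \<ge> 0" by (simp add: T_def sum_nonneg)
  define w where "w n e = ((\<eta> n (fst e))\<^sup>2 + (\<eta> n (snd e))\<^sup>2) / 4 * (grad v e)\<^sup>2" for n e
  have w_le: "(\<integral>\<^sup>+e. ennreal (w n e) \<partial>?M) \<le> ennreal (T + 2 * M\<^sup>2 * form (\<eta> n) (\<eta> n))" for n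
  proof -
    define \<phi> where "\<phi> p = (\<eta> n p)\<^sup>2 * v p" for p
    have fin: "finite {p \<in> V. \<phi> p \<noteq> 0}"
      by (rule finite_subset[OF _ cutoff_finite_support[of n]]) (auto simp: \<phi>_def)
    have i1: "integrable ?M (w n)"
      by (rule integrable_finite_support[OF cutoff_finite_support[of n]]) (simp add: w_def)
    have i2: "integrable ?M (\<lambda>e. grad v e * grad \<phi> e)"
      by (rule integrable_finite_support[OF fin]) (simp add: grad_def)
    have i3: "integrable ?M (\<lambda>e. (grad (\<eta> n) e)\<^sup>2)"
      by (rule integrable_finite_support[OF cutoff_finite_support[of n]]) (simp add: grad_def)
    have "(\<integral>e. w n e \<partial>?M) \<le> (\<integral>e. grad v e * grad \<phi> e + 2 * M\<^sup>2 * (grad (\<eta> n) e)\<^sup>2 \<partial>?M)"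
    proof (rule integral_mono)
      fix e assume "e \<in> space ?M"
      then have "\<bar>v (fst e)\<bar> \<le> M" "\<bar>v (snd e)\<bar> \<le> M"
        using M edges_snd[of e] by auto
      from caccioppoli_pointwise[OF this, of "\<eta> n (fst e)" "\<eta> n (snd e)"]
      show "w n e \<le> grad v e * grad \<phi> e + 2 * M\<^sup>2 * (grad (\<eta> n) e)\<^sup>2"
        by (simp add: w_def grad_def \<phi>_def)
    qed (use i1 i2 i3 in auto)
    also have "\<dots> = form v \<phi> + 2 * M\<^sup>2 * form (\<eta> n) (\<eta> n)"
      using i2 i3 by (simp add: form_def[of v \<phi>] form_self)
    also have "form v \<phi> \<le> T"
    proof -
      let ?S = "{p \<in> V. \<phi> p \<noteq> 0}"
      have "- (\<Sum>p\<in>?S. \<phi> p * lap v p) = (\<Sum>p\<in>?S. - (\<phi> p * lap v p))"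
        by (simp add: sum_negf)
      also have "\<dots> \<le> (\<Sum>p\<in>?S. if p \<in> S then \<bar>v p * lap v p\<bar> else 0)"
      proof (rule sum_mono)
        fix p assume p: "p \<in> ?S"
        have eq: "\<phi> p * lap v p = (\<eta> n p)\<^sup>2 * (v p * lap v p)" by (simp add: \<phi>_def)
        have le1: "(\<eta> n p)\<^sup>2 \<le> 1"
          using cutoff_nonneg[of n p] cutoff_le_1[of n p] by (simp add: power_le_one)
        show "- (\<phi> p * lap v p) \<le> (if p \<in> S then \<bar>v p * lap v p\<bar> else 0)"
        proof (cases "p \<in> S")
          case True
          have "- (\<phi> p * lap v p) \<le> (\<eta> n p)\<^sup>2 * \<bar>v p * lap v p\<bar>"
            unfolding eq by (metis abs_ge_minus_self mult_minus_right mult_left_mono zero_le_power2)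
          also have "\<dots> \<le> 1 * \<bar>v p * lap v p\<bar>"
            using le1 by (intro mult_right_mono) auto
          finally show ?thesis using True by simp
        next
          case False
          then show ?thesis
            unfolding eq using sub[of p] p by simp
        qed
      qed
      also have "\<dots> = (\<Sum>p\<in>?S \<inter> S. \<bar>v p * lap v p\<bar>)"
        using fin by (simp add: sum.inter_restrict)
      also have "\<dots> \<le> (\<Sum>p\<in>S. \<bar>v p * lap v p\<bar>)"
        using S by (intro sum_mono2) auto
      finally show ?thesis
        unfolding green_finite_support[OF fin] T_def by simp
    qed
    finally have "(\<integral>e. w n e \<partial>?M) \<le> T + 2 * M\<^sup>2 * form (\<eta> n) (\<eta> n)" by simp
    moreover have "(\<integral>\<^sup>+e. ennreal (w n e) \<partial>?M) = ennreal (\<integral>e. w n e \<partial>?M)"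
      by (rule nn_integral_eq_integral[OF i1]) (simp add: w_def)
    ultimately show ?thesis by (simp add: ennreal_leI)
  qed
  have w_lim: "(\<lambda>n. ennreal (w n e)) \<longlonglongrightarrow> ennreal ((grad v e)\<^sup>2 / 2)" if "e \<in> edges" for e
  proof -
    have "(\<lambda>n. w n e) \<longlonglongrightarrow> (1\<^sup>2 + 1\<^sup>2) / 4 * (grad v e)\<^sup>2"
      unfolding w_def using that edges_snd[OF that] by (intro tendsto_intros cutoff_tendsto_1) auto
    then show ?thesis by simp
  qed
  have "(\<integral>\<^sup>+e. ennreal ((grad v e)\<^sup>2 / 2) \<partial>?M) = (\<integral>\<^sup>+e. liminf (\<lambda>n. ennreal (w n e)) \<partial>?M)"
    by (rule nn_integral_cong) (use lim_imp_Liminf[OF _ w_lim] in auto)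
  also have "\<dots> \<le> liminf (\<lambda>n. \<integral>\<^sup>+e. ennreal (w n e) \<partial>?M)"
    by (rule nn_integral_liminf) simp
  also have "\<dots> \<le> liminf (\<lambda>n. ennreal (T + 2 * M\<^sup>2 * form (\<eta> n) (\<eta> n)))"
    by (rule Liminf_mono) (use w_le in auto)
  also have "\<dots> = ennreal T"
  proof (rule lim_imp_Liminf)
    have "(\<lambda>n. T + 2 * M\<^sup>2 * form (\<eta> n) (\<eta> n)) \<longlonglongrightarrow> T + 2 * M\<^sup>2 * 0"
      by (intro tendsto_intros cutoff_energy)
    then show "(\<lambda>n. ennreal (T + 2 * M\<^sup>2 * form (\<eta> n) (\<eta> n))) \<longlonglongrightarrow> ennreal T"
      by simp
  qed simp
  finally have le: "(\<integral>\<^sup>+e. ennreal ((grad v e)\<^sup>2 / 2) \<partial>?M) \<le> ennreal T" .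
  have int: "integrable ?M (\<lambda>e. (grad v e)\<^sup>2 / 2)"
    by (rule integrableI_nonneg) (use le in \<open>auto simp: less_top[symmetric] top_unique\<close>)
  from integrable_mult_right[OF this, of 2] show "finite_energy v"
    by (simp add: finite_energy_def)
  have "(\<integral>e. (grad v e)\<^sup>2 / 2 \<partial>?M) \<le> T"
    using le T0 by (rule integral_real_bounded[rotated])
  then show "form v v \<le> 4 * (\<Sum>p\<in>S. \<bar>v p * lap v p\<bar>)"
    by (simp add: form_self T_def)
qed

lemma sum_grad_sq_le_energy:
  assumes "finite_energy v" "finite F" "F \<subseteq> edges"
  shows "(\<Sum>e\<in>F. (grad v e)\<^sup>2) \<le> form v v"
proof -
  define g where "g e = (grad v e)\<^sup>2 * indicator F e" for e
  have fin: "finite {e \<in> edges. g e \<noteq> 0}"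
    by (rule finite_subset[OF _ assms(2)]) (auto simp: g_def indicator_def split: if_splits)
  have "(\<integral>e. g e \<partial>count_space edges) = (\<Sum>e | e \<in> edges \<and> g e \<noteq> 0. g e)"
    by (rule lebesgue_integral_count_space_finite_support[OF fin])
  also have "\<dots> = (\<Sum>e\<in>F. (grad v e)\<^sup>2)"
    using assms by (intro sum.mono_neutral_cong_left) (auto simp: g_def indicator_def split: if_splits)
  finally have "(\<Sum>e\<in>F. (grad v e)\<^sup>2) = (\<integral>e. g e \<partial>count_space edges)"
    by simp
  also have "\<dots> \<le> form v v"
    unfolding form_self using assms(1)
    by (intro integral_mono integrable_count_space_finite_support[OF fin])
      (auto simp: finite_energy_def g_def indicator_def)
  finally show ?thesis .
qed

lemma path_diff_le_energy:
  assumes "finite_energy v" "(p, q) \<in> edges ^^ k"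
  shows "\<bar>v p - v q\<bar> \<le> real k * sqrt (form v v)"
  using assms(2)
proof (induction k arbitrary: q)
  case 0
  then show ?case by simp
next
  case (Suc k)
  then obtain r where r: "(p, r) \<in> edges ^^ k" "(r, q) \<in> edges" by auto
  have "\<bar>v q - v r\<bar> \<le> sqrt (form v v)"
    using sum_grad_sq_le_energy[OF assms(1), of "{(r, q)}"] r(2)
    by (simp add: grad_def real_le_rsqrt)
  then show ?case
    using Suc.IH[OF r(1)] by (simp add: algebra_simps)
qed

lemma constant_if_energy_0:
  assumes "finite_energy v" "form v v = 0" "p \<in> V" "q \<in> V"
  shows "v p = v q"
proof -
  obtain k where "(p, q) \<in> edges ^^ k"
    using connected[OF assms(3,4)] rtrancl_imp_relpow by blast
  from path_diff_le_energy[OF assms(1) this] show ?thesis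
    using assms(2) by simp
qed

text \<open>Extend the positive part of \<open>u - m\<close> on \<open>U\<close> by zero. The result is subharmonic where it is positive, so it
  has no energy and is constant; it vanishes outside \<open>U\<close>. The region \<open>U\<close> may be infinite: a bounded function
  on a recurrent graph cannot hide its maximum at infinity.\<close>

lemma maximum_principle:
  assumes M: "\<And>p. p \<in> V \<Longrightarrow> \<bar>u p\<bar> \<le> M"
    and U: "U \<subseteq> V" "U \<noteq> V"
    and sub: "\<And>p. p \<in> U \<Longrightarrow> lap u p \<ge> 0"
    and bd: "\<And>p q. p \<in> U \<Longrightarrow> q \<in> nb p \<Longrightarrow> q \<notin> U \<Longrightarrow> u q \<le> m"
    and p: "p \<in> U"
  shows "u p \<le> m"
proof -
  define v where "v q = (if q \<in> U then max 0 (u q - m) else 0)" for q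
  have v_bound: "\<bar>v q\<bar> \<le> M + \<bar>m\<bar>" if "q \<in> V" for q
    using M[OF that] by (auto simp: v_def)
  have v_sub: "v q * lap v q \<ge> 0" if q: "q \<in> V - {}" for q
  proof (cases "v q > 0")
    case False
    then have "v q = 0" by (auto simp: v_def split: if_splits)
    then show ?thesis by simp
  next
    case True
    then have qU: "q \<in> U" and vq: "v q = u q - m"
      by (auto simp: v_def max_def split: if_splits)
    have "lap u q \<le> lap v q"
      unfolding lap_def
    proof (rule sum_mono)
      fix r assume r: "r \<in> nb q"
      have "u r - m \<le> v r"
        using bd[OF qU r] by (auto simp: v_def)
      then show "u r - u q \<le> v r - v q" by (simp add: vq)
    qed
    then show ?thesis using sub[OF qU] True by simp
  qed
  have "finite_energy v" "form v v \<le> 0"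
    using energy_bound[of v "M + \<bar>m\<bar>" "{}", OF v_bound _ _ v_sub] by simp_all
  then have fe: "finite_energy v" and e0: "form v v = 0"
    using form_self_nonneg[of v] by auto
  obtain q where q: "q \<in> V" "q \<notin> U" using U by blast
  have "v p = v q"
    using constant_if_energy_0[OF fe e0] p q U by blast
  then show ?thesis
    using p q by (simp add: v_def max_def split: if_splits)
qed

lemma bounded_harmonic_le:
  assumes "\<And>p. p \<in> V \<Longrightarrow> \<bar>u p\<bar> \<le> M"
    and "\<And>p. p \<in> V - S \<Longrightarrow> lap u p \<ge> 0"
    and "\<And>p. p \<in> S \<inter> V \<Longrightarrow> u p \<le> m" and "S \<inter> V \<noteq> {}" and "p \<in> V"
  shows "u p \<le> m"
proof (cases "p \<in> S")
  case False
  show ?thesis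
    by (rule maximum_principle[of u M "V - S"]) (use assms False nb_in_V in blast)+
qed (use assms in auto)

text \<open>Apply summation by parts to \<open>\<eta> v\<close>, which has finite support, and remove the cutoff: the main term
  converges by dominated convergence, and the term with the gradient of \<open>\<eta>\<close> is at most \<open>M\<close> times the square root of the product
  of the energies of \<open>u\<close> and \<open>\<eta>\<close>.\<close>

lemma green:
  assumes u: "finite_energy u" and S: "finite S" "S \<subseteq> V" "\<And>p. p \<in> V - S \<Longrightarrow> lap u p = 0"
    and v: "finite_energy v" and M: "\<And>p. p \<in> V \<Longrightarrow> \<bar>v p\<bar> \<le> M"
  shows "form u v = - 2 * (\<Sum>p\<in>S. v p * lap u p)"
proof -
  let ?M = "count_space edges"
  define \<phi> where "\<phi> n p = \<eta> n p * v p" for n p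
  have fin: "finite {p \<in> V. \<phi> n p \<noteq> 0}" for n
    by (rule finite_subset[OF _ cutoff_finite_support[of n]]) (auto simp: \<phi>_def)
  have eq: "form u (\<phi> n) = - 2 * (\<Sum>p\<in>S. \<eta> n p * v p * lap u p)" for n
  proof -
    have "(\<Sum>p | p \<in> V \<and> \<phi> n p \<noteq> 0. \<phi> n p * lap u p) = (\<Sum>p\<in>S. \<phi> n p * lap u p)"
      using S fin[of n] by (intro sum.mono_neutral_cong) auto
    then show ?thesis
      unfolding green_finite_support[OF fin] by (simp add: \<phi>_def)
  qed
  have lim1: "(\<lambda>n. form u (\<phi> n)) \<longlonglongrightarrow> - 2 * (\<Sum>p\<in>S. 1 * v p * lap u p)"
    unfolding eq using S by (intro tendsto_intros cutoff_tendsto_1) auto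
  define A where "A n = (\<integral>e. \<eta> n (snd e) * (grad u e * grad v e) \<partial>?M)" for n
  define B where "B n = (\<integral>e. v (fst e) * grad u e * grad (\<eta> n) e \<partial>?M)" for n
  have iuv: "integrable ?M (\<lambda>e. grad u e * grad v e)"
    by (rule integrable_grad_mult[OF u v])
  have split: "form u (\<phi> n) = A n + B n" for n
  proof -
    have "form u (\<phi> n) = (\<integral>e. \<eta> n (snd e) * (grad u e * grad v e) + v (fst e) * grad u e * grad (\<eta> n) e \<partial>?M)"
      unfolding form_def by (simp add: grad_def \<phi>_def algebra_simps)
    also have "\<dots> = A n + B n"
      unfolding A_def B_def
      by (intro Bochner_Integration.integral_add integrable_finite_support[OF cutoff_finite_support[of n]])
        (auto simp: grad_def)
    finally show ?thesis .
  qed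
  have limA: "A \<longlonglongrightarrow> form u v"
    unfolding A_def[abs_def] form_def
  proof (rule integral_dominated_convergence[where w = "\<lambda>e. \<bar>grad u e * grad v e\<bar>"])
    have "(\<lambda>n. \<eta> n (snd e) * (grad u e * grad v e)) \<longlonglongrightarrow> grad u e * grad v e" if "e \<in> edges" for e
      using tendsto_mult_right[OF cutoff_tendsto_1[OF edges_snd[OF that]], of "grad u e * grad v e"] by simp
    then show "AE e in ?M. (\<lambda>n. \<eta> n (snd e) * (grad u e * grad v e)) \<longlonglongrightarrow> grad u e * grad v e"
      by (simp add: AE_count_space)
    show "AE e in ?M. norm (\<eta> n (snd e) * (grad u e * grad v e)) \<le> \<bar>grad u e * grad v e\<bar>" for n
    proof (rule AE_I2)
      fix e
      have "\<bar>\<eta> n (snd e)\<bar> * \<bar>grad u e * grad v e\<bar> \<le> 1 * \<bar>grad u e * grad v e\<bar>"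
        using cutoff_nonneg[of n "snd e"] cutoff_le_1[of n "snd e"] by (intro mult_right_mono) auto
      then show "norm (\<eta> n (snd e) * (grad u e * grad v e)) \<le> \<bar>grad u e * grad v e\<bar>"
        by (simp add: abs_mult)
    qed
  qed (use iuv in auto)
  have limB: "B \<longlonglongrightarrow> 0"
  proof -
    have "(B n)\<^sup>2 \<le> (M\<^sup>2 * form u u) * form (\<eta> n) (\<eta> n)" for n
    proof -
      have i1: "integrable ?M (\<lambda>e. M\<^sup>2 * (grad u e)\<^sup>2)"
        using u by (simp add: finite_energy_def)
      have le: "(v (fst e) * grad u e)\<^sup>2 \<le> M\<^sup>2 * (grad u e)\<^sup>2" if "e \<in> edges" for e
      proof -
        have "(v (fst e))\<^sup>2 \<le> M\<^sup>2"
          using M[of "fst e"] that by (metis abs_ge_zero mem_Sigma_iff power2_abs power_mono prod.collapse)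
        then show ?thesis
          by (simp add: power_mult_distrib mult_right_mono)
      qed
      have i2: "integrable ?M (\<lambda>e. (v (fst e) * grad u e)\<^sup>2)"
        by (rule Bochner_Integration.integrable_bound[OF i1]) (use le in \<open>auto simp: AE_count_space\<close>)
      have "(B n)\<^sup>2 \<le> (\<integral>e. (v (fst e) * grad u e)\<^sup>2 \<partial>?M) * (\<integral>e. (grad (\<eta> n) e)\<^sup>2 \<partial>?M)"
        unfolding B_def
        by (intro Cauchy_Schwarz_integral i2 integrable_finite_support[OF cutoff_finite_support[of n]])
          (auto simp: grad_def)
      also have "\<dots> \<le> (M\<^sup>2 * form u u) * form (\<eta> n) (\<eta> n)"
      proof -
        have "(\<integral>e. (v (fst e) * grad u e)\<^sup>2 \<partial>?M) \<le> (\<integral>e. M\<^sup>2 * (grad u e)\<^sup>2 \<partial>?M)"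
          using i1 i2 le by (intro integral_mono) auto
        then show ?thesis
          unfolding form_self[symmetric] using form_self_nonneg[of "\<eta> n"]
          by (intro mult_right_mono) (auto simp: form_self)
      qed
      finally show ?thesis .
    qed
    then have "\<bar>B n\<bar> \<le> sqrt ((M\<^sup>2 * form u u) * form (\<eta> n) (\<eta> n))" for n
      by (simp add: real_le_rsqrt)
    moreover have "(\<lambda>n. sqrt ((M\<^sup>2 * form u u) * form (\<eta> n) (\<eta> n))) \<longlonglongrightarrow> sqrt ((M\<^sup>2 * form u u) * 0)"
      by (intro tendsto_intros cutoff_energy)
    ultimately show ?thesis
      by (intro Lim_null_comparison[of B "\<lambda>n. sqrt ((M\<^sup>2 * form u u) * form (\<eta> n) (\<eta> n))"]) auto
  qed
  have "(\<lambda>n. form u (\<phi> n)) \<longlonglongrightarrow> form u v + 0"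
    unfolding split by (rule tendsto_add[OF limA limB])
  from LIMSEQ_unique[OF this lim1] show ?thesis by simp
qed

end

section \<open>Limits at infinity of harmonic functions\<close>

text \<open>The graph is exhausted by finite sets \<open>shell p \<le> r\<close> whose outer layers are connected in themselves by paths of
  length \<open>O(r)\<close>. The path is presented by its edge set \<open>F\<close> and by the only consequence that matters,
  a bound for differences of values by the increments along it.\<close>

locale one_ended_recurrent_graph = recurrent_graph V nb \<eta>
  for V :: "'a set" and nb :: "'a \<Rightarrow> 'a set" and \<eta> :: "nat \<Rightarrow> 'a \<Rightarrow> real" +
  fixes shell :: "'a \<Rightarrow> nat" and C :: real and r\<^sub>0 :: nat
  assumes infinite_V: "infinite V"
    and shell_finite: "finite {p \<in> V. shell p \<le> r}"
    and shell_step: "p \<in> V \<Longrightarrow> q \<in> nb p \<Longrightarrow> shell q \<le> Suc (shell p)"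
    and shell_path: "r\<^sub>0 \<le> r \<Longrightarrow> p \<in> V \<Longrightarrow> q \<in> V \<Longrightarrow> shell p = r \<Longrightarrow> shell q = r \<Longrightarrow>
      \<exists>F \<subseteq> {e \<in> Sigma V nb. shell (fst e) = r}. finite F \<and> real (card F) \<le> C * real r \<and>
        (\<forall>u :: 'a \<Rightarrow> real. \<bar>u p - u q\<bar> \<le> (\<Sum>e\<in>F. \<bar>u (snd e) - u (fst e)\<bar>))"
begin

definition at_inf :: "'a filter" where
  "at_inf = inf cofinite (principal V)"

lemma eventually_at_inf: "eventually P at_inf \<longleftrightarrow> finite {p \<in> V. \<not> P p}"
  by (simp add: at_inf_def eventually_inf_principal eventually_cofinite)

lemma eventually_at_inf_V: "eventually (\<lambda>p. p \<in> V) at_inf"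
  by (simp add: eventually_at_inf)

lemma eventually_at_inf_notin: "finite F \<Longrightarrow> eventually (\<lambda>p. p \<notin> F) at_inf"
  by (simp add: eventually_at_inf)

lemma at_inf_neq_bot [simp]: "at_inf \<noteq> bot"
  using infinite_V by (simp add: trivial_limit_def eventually_at_inf)

lemma filterlim_at_inf_if_inj:
  assumes "inj s" "range s \<subseteq> V"
  shows "filterlim s at_inf sequentially"
  unfolding filterlim_iff eventually_at_inf
proof (intro allI impI)
  fix P assume "finite {p \<in> V. \<not> P p}"
  from finite_vimageI[OF this assms(1)]
  have "finite {n. \<not> P (s n)}"
    using assms(2) by (auto elim!: rev_finite_subset)
  then show "\<forall>\<^sub>F n in sequentially. P (s n)"
    by (simp add: cofinite_eq_sequentially[symmetric] eventually_cofinite)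
qed

text \<open>Otherwise every shell from some radius on would carry energy at least \<open>\<epsilon>\<^sup>2 / (C r)\<close>, and the
  harmonic series would converge.\<close>

lemma shells_with_small_oscillation:
  assumes fe: "finite_energy u" and \<epsilon>: "\<epsilon> > 0"
  shows "\<exists>r\<ge>r\<^sub>1. \<forall>p\<in>V. \<forall>q\<in>V. shell p = r \<longrightarrow> shell q = r \<longrightarrow> \<bar>u p - u q\<bar> < \<epsilon>"
proof (rule ccontr)
  assume neg: "\<not> ?thesis"
  \<comment> \<open>The successor keeps the radius positive, so that it can be cancelled.\<close>
  define m where "m = Suc (max r\<^sub>0 r\<^sub>1)"
  define E where "E = form u u"
  have "\<exists>F. finite F \<and> F \<subseteq> {e \<in> edges. shell (fst e) = r}
      \<and> \<epsilon>\<^sup>2 * inverse (real r) \<le> C * (\<Sum>e\<in>F. (grad u e)\<^sup>2)" if r: "r \<ge> m" for r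
  proof -
    have "r\<^sub>1 \<le> r" using r by (simp add: m_def)
    with neg have "\<not> (\<forall>p\<in>V. \<forall>q\<in>V. shell p = r \<longrightarrow> shell q = r \<longrightarrow> \<bar>u p - u q\<bar> < \<epsilon>)"
      by blast
    then obtain p q where pq: "p \<in> V" "q \<in> V" "shell p = r" "shell q = r" "\<bar>u p - u q\<bar> \<ge> \<epsilon>"
      by (auto simp: not_less)
    have "r\<^sub>0 \<le> r" using r by (simp add: m_def)
    from shell_path[OF this pq(1-4)] obtain F where
      F: "F \<subseteq> {e \<in> edges. shell (fst e) = r}" "finite F" "real (card F) \<le> C * real r"
         "\<bar>u p - u q\<bar> \<le> (\<Sum>e\<in>F. \<bar>grad u e\<bar>)"
      unfolding grad_def by blast
    have "\<epsilon>\<^sup>2 \<le> (\<Sum>e\<in>F. \<bar>grad u e\<bar>)\<^sup>2"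
      using \<epsilon> pq(5) F(4) by (intro power_mono) auto
    also have "\<dots> \<le> real (card F) * (\<Sum>e\<in>F. (grad u e)\<^sup>2)"
      using sum_squared_le_sum_of_squares[of "\<lambda>e. \<bar>grad u e\<bar>" F] by (simp add: mult.commute)
    also have "\<dots> \<le> (C * real r) * (\<Sum>e\<in>F. (grad u e)\<^sup>2)"
      using F(3) by (intro mult_right_mono) (auto intro: sum_nonneg)
    finally have "\<epsilon>\<^sup>2 * inverse (real r) \<le> C * (\<Sum>e\<in>F. (grad u e)\<^sup>2)"
      using r by (simp add: m_def field_simps)
    with F(1,2) show ?thesis by (intro exI[of _ F] conjI)
  qed
  then have "\<forall>r\<in>{m..}. \<exists>F. finite F \<and> F \<subseteq> {e \<in> edges. shell (fst e) = r}
      \<and> \<epsilon>\<^sup>2 * inverse (real r) \<le> C * (\<Sum>e\<in>F. (grad u e)\<^sup>2)"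
    by simp
  from bchoice[OF this] obtain F where F_all: "\<forall>r\<in>{m..}. finite (F r) \<and> F r \<subseteq> {e \<in> edges. shell (fst e) = r}
      \<and> \<epsilon>\<^sup>2 * inverse (real r) \<le> C * (\<Sum>e\<in>F r. (grad u e)\<^sup>2)" ..
  have F: "finite (F r)" "F r \<subseteq> {e \<in> edges. shell (fst e) = r}"
      "\<epsilon>\<^sup>2 * inverse (real r) \<le> C * (\<Sum>e\<in>F r. (grad u e)\<^sup>2)" if "r \<ge> m" for r
    using bspec[OF F_all, of r] that by simp_all
  have C: "C \<ge> 0"
  proof (rule ccontr)
    assume "\<not> C \<ge> 0"
    then have "C * (\<Sum>e\<in>F m. (grad u e)\<^sup>2) \<le> 0"
      by (intro mult_nonpos_nonneg sum_nonneg) auto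
    moreover have "0 < \<epsilon>\<^sup>2 * inverse (real m)" using \<epsilon> by (simp add: m_def)
    ultimately show False using F(3)[of m] by simp
  qed
  have sum_le: "(\<Sum>r\<in>{m..n}. inverse (real r)) \<le> C * E / \<epsilon>\<^sup>2" for n
  proof -
    have "\<epsilon>\<^sup>2 * (\<Sum>r\<in>{m..n}. inverse (real r)) \<le> (\<Sum>r\<in>{m..n}. C * (\<Sum>e\<in>F r. (grad u e)\<^sup>2))"
      by (subst sum_distrib_left) (rule sum_mono, use F(3) in auto)
    also have "\<dots> = C * (\<Sum>r\<in>{m..n}. \<Sum>e\<in>F r. (grad u e)\<^sup>2)"
      by (rule sum_distrib_left[symmetric])
    finally have le: "\<epsilon>\<^sup>2 * (\<Sum>r\<in>{m..n}. inverse (real r)) \<le> C * (\<Sum>r\<in>{m..n}. \<Sum>e\<in>F r. (grad u e)\<^sup>2)" .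
    have "(\<Sum>r\<in>{m..n}. \<Sum>e\<in>F r. (grad u e)\<^sup>2) = (\<Sum>e\<in>(\<Union>r\<in>{m..n}. F r). (grad u e)\<^sup>2)"
    proof (rule sum.UNION_disjoint[symmetric])
      show "\<forall>i\<in>{m..n}. \<forall>j\<in>{m..n}. i \<noteq> j \<longrightarrow> F i \<inter> F j = {}"
      proof (intro ballI impI)
        fix i j assume ij: "i \<in> {m..n}" "j \<in> {m..n}" "i \<noteq> j"
        have "F i \<subseteq> {e \<in> edges. shell (fst e) = i}" "F j \<subseteq> {e \<in> edges. shell (fst e) = j}"
          using F(2) ij by auto
        with ij(3) show "F i \<inter> F j = {}" by fast
      qed
    qed (use F(1) in auto)
    also have "\<dots> \<le> E"
      unfolding E_def
    proof (rule sum_grad_sq_le_energy[OF fe])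
      show "(\<Union>r\<in>{m..n}. F r) \<subseteq> edges"
      proof (rule UN_least)
        fix r assume "r \<in> {m..n}"
        then have "F r \<subseteq> {e \<in> edges. shell (fst e) = r}" using F(2)[of r] by simp
        then show "F r \<subseteq> edges" by fast
      qed
    qed (use F(1) in auto)
    finally have "C * (\<Sum>r\<in>{m..n}. \<Sum>e\<in>F r. (grad u e)\<^sup>2) \<le> C * E"
      by (rule mult_left_mono[OF _ C])
    with le have "(\<Sum>r\<in>{m..n}. inverse (real r)) * \<epsilon>\<^sup>2 \<le> C * E"
      by (simp only: mult.commute[of "sum _ _"])
    then show ?thesis
      using \<epsilon> by (subst pos_le_divide_eq) auto
  qed
  have "\<forall>\<^sub>F n in sequentially. C * E / \<epsilon>\<^sup>2 + harm m < (harm n :: real)"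
    using harm_at_top unfolding filterlim_at_top_dense by (rule spec)
  from eventually_happens[OF this] obtain n where n: "C * E / \<epsilon>\<^sup>2 + harm m < (harm n :: real)"
    by auto
  have "(harm n :: real) \<le> (\<Sum>r\<in>{1..m} \<union> {m..n}. inverse (real r))"
    unfolding harm_def by (intro sum_mono2) auto
  also have "\<dots> \<le> harm m + (\<Sum>r\<in>{m..n}. inverse (real r))"
    unfolding harm_def by (subst sum_Un) (auto intro: sum_nonneg)
  also have "\<dots> \<le> harm m + C * E / \<epsilon>\<^sup>2"
    using sum_le by simp
  finally show False using n by simp
qed

lemma tendsto_at_inf_if_Cauchy:
  assumes "\<And>\<epsilon>. \<epsilon> > 0 \<Longrightarrow> \<exists>F. finite F \<and> (\<forall>p\<in>V - F. \<forall>q\<in>V - F. \<bar>u p - u q\<bar> \<le> (\<epsilon>::real))"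
  shows "\<exists>L. (u \<longlongrightarrow> L) at_inf"
proof -
  obtain s :: "nat \<Rightarrow> 'a" where s: "inj s" "range s \<subseteq> V"
    using infinite_countable_subset[OF infinite_V] by blast
  have ev: "eventually (\<lambda>n. s n \<in> V - F) sequentially" if "finite F" for F
  proof -
    have "eventually (\<lambda>p. p \<in> V - F) at_inf"
      using eventually_conj[OF eventually_at_inf_V eventually_at_inf_notin[OF that]] by simp
    then show ?thesis
      by (rule eventually_compose_filterlim[OF _ filterlim_at_inf_if_inj[OF s]])
  qed
  have "Cauchy (\<lambda>n. u (s n))"
    unfolding Cauchy_def
  proof (intro allI impI)
    fix \<epsilon> :: real assume "\<epsilon> > 0"
    then obtain F where F: "finite F" "\<forall>p\<in>V - F. \<forall>q\<in>V - F. \<bar>u p - u q\<bar> \<le> \<epsilon> / 2"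
      using assms[of "\<epsilon> / 2"] by auto
    obtain N where N: "\<And>n. n \<ge> N \<Longrightarrow> s n \<in> V - F"
      using ev[OF F(1)] unfolding eventually_sequentially by blast
    have "dist (u (s m)) (u (s n)) < \<epsilon>" if "m \<ge> N" "n \<ge> N" for m n
      using F(2)[rule_format, OF N[OF that(1)] N[OF that(2)]] \<open>\<epsilon> > 0\<close>
      by (simp add: dist_real_def)
    then show "\<exists>N. \<forall>m\<ge>N. \<forall>n\<ge>N. dist (u (s m)) (u (s n)) < \<epsilon>"
      by blast
  qed
  then obtain L where L: "(\<lambda>n. u (s n)) \<longlonglongrightarrow> L"
    using Cauchy_convergent convergent_def by blast
  have "(u \<longlongrightarrow> L) at_inf"
  proof (rule tendstoI)
    fix \<epsilon> :: real assume "\<epsilon> > 0"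
    then obtain F where F: "finite F" "\<forall>p\<in>V - F. \<forall>q\<in>V - F. \<bar>u p - u q\<bar> \<le> \<epsilon> / 2"
      using assms[of "\<epsilon> / 2"] by auto
    have "\<bar>u p - L\<bar> \<le> \<epsilon> / 2" if p: "p \<in> V - F" for p
    proof (rule tendsto_upperbound)
      show "(\<lambda>n. \<bar>u p - u (s n)\<bar>) \<longlonglongrightarrow> \<bar>u p - L\<bar>"
        by (intro tendsto_intros L)
      show "eventually (\<lambda>n. \<bar>u p - u (s n)\<bar> \<le> \<epsilon> / 2) sequentially"
        using ev[OF F(1)] by eventually_elim (use F(2) p in auto)
    qed simp
    then have "{p \<in> V. \<not> dist (u p) L < \<epsilon>} \<subseteq> F"
      using \<open>\<epsilon> > 0\<close> by (force simp: dist_real_def)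
    then show "\<forall>\<^sub>F p in at_inf. dist (u p) L < \<epsilon>"
      using F(1) by (simp add: eventually_at_inf finite_subset)
  qed
  then show ?thesis by blast
qed

text \<open>Once the oscillation on a shell beyond \<open>S\<close> is small, the maximum principle for \<open>u\<close> and \<open>- u\<close> carries it
  over to the whole region outside the shell.\<close>

lemma harmonic_converges:
  assumes M: "\<And>p. p \<in> V \<Longrightarrow> \<bar>u p\<bar> \<le> M"
    and S: "finite S" "\<And>p. p \<in> V - S \<Longrightarrow> lap u p = 0"
  shows "\<exists>L. (u \<longlongrightarrow> L) at_inf"
proof (rule tendsto_at_inf_if_Cauchy)
  fix \<epsilon> :: real assume \<epsilon>: "\<epsilon> > 0"
  have fe: "finite_energy u"
    by (rule energy_bound(1)[of u M "S \<inter> V"]) (use M S in auto)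
  obtain p\<^sub>1 where p1: "p\<^sub>1 \<in> V" using infinite_V by fastforce
  define r\<^sub>1 where "r\<^sub>1 = Max (insert (shell p\<^sub>1) (shell ` S))"
  have r1: "shell p\<^sub>1 \<le> r\<^sub>1" "\<And>p. p \<in> S \<Longrightarrow> shell p \<le> r\<^sub>1"
    using S by (auto simp: r\<^sub>1_def)
  obtain r where r: "r \<ge> r\<^sub>1"
      "\<And>p q. p \<in> V \<Longrightarrow> q \<in> V \<Longrightarrow> shell p = r \<Longrightarrow> shell q = r \<Longrightarrow> \<bar>u p - u q\<bar> < \<epsilon> / 2"
    using shells_with_small_oscillation[OF fe, of "\<epsilon> / 2" r\<^sub>1] \<epsilon> by auto
  define U where "U = {p \<in> V. r < shell p}"
  have "p\<^sub>1 \<notin> U" using r1(1) r(1) by (simp add: U_def)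
  with p1 have U: "U \<subseteq> V" "U \<noteq> V"
    by (auto simp: U_def)
  have bd: "q \<in> V \<and> shell q = r" if "p \<in> U" "q \<in> nb p" "q \<notin> U" for p q
  proof -
    have q: "q \<in> V" "p \<in> nb q"
      using that nb_in_V nb_sym by (auto simp: U_def)
    show ?thesis
      using that q shell_step[OF q] by (auto simp: U_def)
  qed
  have max: "u p \<le> m" if "\<And>q. q \<in> V \<Longrightarrow> shell q = r \<Longrightarrow> u q \<le> m" "p \<in> U" for m p
  proof (rule maximum_principle[OF M U _ _ that(2)])
    fix q assume "q \<in> U"
    then have "q \<in> V - S" using r1(2)[of q] r(1) by (auto simp: U_def)
    then show "lap u q \<ge> 0" using S(2) by simp
  qed (use bd that in auto)
  have min: "m \<le> u p" if "\<And>q. q \<in> V \<Longrightarrow> shell q = r \<Longrightarrow> m \<le> u q" "p \<in> U" for m p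
  proof -
    have lapm: "lap (\<lambda>p. - u p) q = - lap u q" for q
      by (simp add: lap_def sum_negf[symmetric])
    have "- u p \<le> - m"
    proof (rule maximum_principle[OF _ U _ _ that(2), of "\<lambda>p. - u p" M])
      fix q assume "q \<in> U"
      then have "q \<in> V - S" using r1(2)[of q] r(1) by (auto simp: U_def)
      then show "lap (\<lambda>p. - u p) q \<ge> 0" using S(2) lapm by simp
    qed (use bd that M in auto)
    then show ?thesis by simp
  qed
  have osc: "\<bar>u p - u q\<bar> \<le> \<epsilon>" if pq: "p \<in> U" "q \<in> U" for p q
  proof (cases "\<exists>a\<in>V. shell a = r")
    case True
    then obtain a where a: "a \<in> V" "shell a = r" by blast
    have near: "\<bar>u x - u a\<bar> \<le> \<epsilon> / 2" if "x \<in> U" for x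
    proof -
      have "u x \<le> u a + \<epsilon> / 2"
        by (rule max[OF _ that]) (smt (verit) r(2)[OF a(1) _ a(2)])
      moreover have "u a - \<epsilon> / 2 \<le> u x"
        by (rule min[OF _ that]) (smt (verit) r(2)[OF a(1) _ a(2)])
      ultimately show ?thesis by linarith
    qed
    show ?thesis using near[OF pq(1)] near[OF pq(2)] by linarith
  next
    case False
    \<comment> \<open>Beyond an empty shell the maximum principle bounds \<open>u\<close> by every number; \<open>- M - 1\<close> contradicts
      \<open>\<bar>u p\<bar> \<le> M\<close>, so there are no points beyond it.\<close>
    then have "u p \<le> - M - 1" using max[OF _ pq(1)] by blast
    then show ?thesis using M[of p] pq U by force
  qed
  show "\<exists>F. finite F \<and> (\<forall>p\<in>V - F. \<forall>q\<in>V - F. \<bar>u p - u q\<bar> \<le> \<epsilon>)"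
    by (rule exI[of _ "{p \<in> V. shell p \<le> r}"]) (use shell_finite osc in \<open>auto simp: U_def not_le\<close>)
qed

end

section \<open>Hitting probabilities and effective conductance\<close>

text \<open>\<open>hit A x y\<close> stands for the probability that the walk from \<open>x\<close> first enters \<open>A\<close> at \<open>y\<close>. The
  assumptions determine it on \<open>V\<close> as soon as \<open>A\<close> meets \<open>V\<close>, by the maximum principle.\<close>

locale hitting_graph = one_ended_recurrent_graph V nb \<eta> shell C r\<^sub>0
  for V :: "'a set" and nb :: "'a \<Rightarrow> 'a set" and \<eta> :: "nat \<Rightarrow> 'a \<Rightarrow> real"
    and shell :: "'a \<Rightarrow> nat" and C :: real and r\<^sub>0 :: nat +
  fixes hit :: "'a set \<Rightarrow> 'a \<Rightarrow> 'a \<Rightarrow> real"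
  assumes hit_nonneg: "0 \<le> hit A x y" and hit_le_1: "hit A x y \<le> 1"
    and hit_on: "x \<in> A \<Longrightarrow> hit A x y = of_bool (x = y)"
    and hit_mean: "x \<in> V \<Longrightarrow> x \<notin> A \<Longrightarrow> (\<Sum>z\<in>nb x. hit A z y - hit A x y) = 0"
begin

lemma hit_bounded: "\<bar>hit A x y\<bar> \<le> 1"
  using hit_nonneg[of A x y] hit_le_1[of A x y] by simp

lemma hit_harmonic: "x \<in> V \<Longrightarrow> x \<notin> A \<Longrightarrow> lap (\<lambda>x. hit A x y) x = 0"
  using hit_mean by (simp add: lap_def)

lemma hit_mono:
  assumes "B \<subseteq> A" "y \<in> B" "y \<in> V" "x \<in> V"
  shows "hit A x y \<le> hit B x y"
proof -
  have "1 * hit A x y - 1 * hit B x y \<le> 0"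
  proof (rule bounded_harmonic_le[where S = A and M = 2 and p = x and u = "\<lambda>p. 1 * hit A p y - 1 * hit B p y"])
    fix p assume "p \<in> V"
    show "\<bar>1 * hit A p y - 1 * hit B p y\<bar> \<le> 2"
      using hit_bounded[of A p y] hit_bounded[of B p y] by linarith
  next
    fix p assume "p \<in> V - A"
    then have "p \<in> V" "p \<notin> A" "p \<notin> B" using assms(1) by auto
    then show "0 \<le> lap (\<lambda>p. 1 * hit A p y - 1 * hit B p y) p"
      by (subst lap_lincomb) (auto simp: hit_harmonic)
  next
    fix p assume "p \<in> A \<inter> V"
    then show "1 * hit A p y - 1 * hit B p y \<le> 0"
      using hit_nonneg[of B p y] hit_on[of y B y] assms by (auto simp: hit_on)
  qed (use assms in auto)
  then show ?thesis by simp
qed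

lemma hit_converges:
  assumes "finite (A \<inter> V)"
  shows "\<exists>L. ((\<lambda>x. hit A x y) \<longlongrightarrow> L) at_inf"
  by (rule harmonic_converges[of _ 1 "A \<inter> V"])
    (use assms hit_bounded in \<open>auto intro!: hit_harmonic\<close>)

text \<open>Both sides are bounded, harmonic off \<open>insert z B\<close> and agree there. In terms of the walk: to meet \<open>B\<close> first
  in \<open>y\<close>, it may or may not pass through \<open>z\<close> beforehand.\<close>

lemma hit_insert:
  assumes B: "B \<noteq> {}" "B \<subseteq> V" and z: "z \<in> V" "z \<notin> B" "y \<noteq> z" and x: "x \<in> V"
  shows "hit (insert z B) x y = hit B x y - hit (insert z B) x z * hit B z y"
proof -
  define g where "g p = 1 * hit (insert z B) p y - 1 * (1 * hit B p y - hit B z y * hit (insert z B) p z)" for p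
  have lap: "lap g p = 0" if "p \<in> V - insert z B" for p
    using that unfolding g_def
    by (subst lap_lincomb, simp, subst lap_lincomb) (auto simp: hit_harmonic)
  have zero: "g p = 0" if "p \<in> insert z B" for p
    using that z(2,3) by (auto simp: g_def hit_on)
  have bound: "\<bar>g p\<bar> \<le> 3" for p
  proof -
    have "\<bar>hit B z y * hit (insert z B) p z\<bar> \<le> 1 * 1"
      unfolding abs_mult by (intro mult_mono hit_bounded) auto
    then show ?thesis
      using hit_bounded[of "insert z B" p y] hit_bounded[of B p y] unfolding g_def mult_1_left by linarith
  qed
  have "g x \<le> 0"
    by (rule bounded_harmonic_le[where S = "insert z B" and M = 3 and u = g]) (use lap zero bound z x in auto)
  moreover have "(\<lambda>p. 0 * g p - 1 * g p) x \<le> 0"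
  proof (rule bounded_harmonic_le[where S = "insert z B" and M = 3 and p = x and u = "\<lambda>p. 0 * g p - 1 * g p"])
    show "0 \<le> lap (\<lambda>p. 0 * g p - 1 * g p) p" if "p \<in> V - insert z B" for p
      using that by (subst lap_lincomb) (auto simp: lap)
  qed (use zero bound z x in auto)
  ultimately have "g x = 0" by simp
  then show ?thesis by (simp add: g_def algebra_simps)
qed

context
  fixes b :: 'a
  assumes b: "b \<in> V"
begin

text \<open>The probability of meeting \<open>z\<close> before \<open>b\<close>. It is the equilibrium potential of the condenser
  with plates \<open>z\<close> and \<open>b\<close>, and its energy is (twice) the effective conductance.\<close>

definition potential :: "'a \<Rightarrow> 'a \<Rightarrow> real" where
  "potential z x = hit {b, z} x z"

definition conductance :: "'a \<Rightarrow> real" where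
  "conductance z = form (potential z) (potential z)"

lemma potential_bounds: "0 \<le> potential z x" "potential z x \<le> 1" "\<bar>potential z x\<bar> \<le> 1"
  by (simp_all add: potential_def hit_nonneg hit_le_1 hit_bounded)

lemma potential_self: "potential z z = 1" and potential_base: "z \<noteq> b \<Longrightarrow> potential z b = 0"
  by (auto simp: potential_def hit_on)

lemma potential_harmonic: "p \<in> V - {b, z} \<Longrightarrow> lap (potential z) p = 0"
  using hit_harmonic[of p "{b, z}" z] by (simp add: potential_def[abs_def])

lemma potential_finite_energy: "z \<in> V \<Longrightarrow> finite_energy (potential z)"
  by (rule energy_bound(1)[of "potential z" 1 "{b, z}"]) (use b in \<open>auto simp: potential_harmonic potential_bounds\<close>)

text \<open>The charges of the equilibrium potential sit at \<open>z\<close> and \<open>b\<close>. Pairing with the constant \<open>1\<close> shows that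
  they cancel, and pairing with the potential itself gives their size.\<close>

lemma form_potential:
  assumes z: "z \<in> V" "z \<noteq> b" and v: "finite_energy v" "\<And>p. p \<in> V \<Longrightarrow> \<bar>v p\<bar> \<le> M"
  shows "form (potential z) v = conductance z * (v z - v b)"
proof -
  have g: "form (potential z) w = - 2 * (w b * lap (potential z) b + w z * lap (potential z) z)"
    if "finite_energy w" "\<And>p. p \<in> V \<Longrightarrow> \<bar>w p\<bar> \<le> K" for w K
    by (subst green[OF potential_finite_energy[OF z(1)], of "{b, z}" w K])
      (use that z b in \<open>auto simp: potential_harmonic\<close>)
  have "form (potential z) (\<lambda>_. 1) = - 2 * (1 * lap (potential z) b + 1 * lap (potential z) z)"
    by (rule g[of _ 1]) (auto simp: finite_energy_def grad_def)
  moreover have "form (potential z) (\<lambda>_. 1) = 0"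
    by (simp add: form_def grad_def)
  ultimately have opp: "lap (potential z) b = - lap (potential z) z" by simp
  have "conductance z = - 2 * lap (potential z) z"
    unfolding conductance_def
    by (subst g[of "potential z" 1]) (use z in \<open>auto simp: potential_finite_energy potential_bounds potential_self potential_base\<close>)
  then show ?thesis
    by (subst g[OF v]) (auto simp: opp algebra_simps)
qed

lemma conductance_pos:
  assumes "z \<in> V" "z \<noteq> b"
  shows "conductance z > 0"
proof (rule ccontr)
  assume "\<not> ?thesis"
  then have "form (potential z) (potential z) = 0"
    using form_self_nonneg[of "potential z"] by (simp add: conductance_def)
  from constant_if_energy_0[OF potential_finite_energy this assms(1) b] assms show False
    by (simp add: potential_self potential_base)
qed

text \<open>The Dirichlet principle: among all functions with the same voltage between \<open>z\<close> and \<open>b\<close>, the equilibrium potential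
  has least energy.\<close>

lemma conductance_le:
  assumes "z \<in> V" "z \<noteq> b" "finite_energy v" "\<And>p. p \<in> V \<Longrightarrow> \<bar>v p\<bar> \<le> M"
  shows "conductance z * (v z - v b)\<^sup>2 \<le> form v v"
proof -
  have "(conductance z * (v z - v b))\<^sup>2 \<le> conductance z * form v v"
    using form_Cauchy_Schwarz[OF potential_finite_energy[OF assms(1)] assms(3)]
    by (simp add: form_potential[OF assms] conductance_def[symmetric])
  then have "conductance z * (conductance z * (v z - v b)\<^sup>2) \<le> conductance z * form v v"
    by (simp add: power2_eq_square algebra_simps)
  then show ?thesis
    using conductance_pos[OF assms(1,2)] by simp
qed

lemma potential_reciprocal:
  assumes "x \<in> V" "x \<noteq> b" "z \<in> V" "z \<noteq> b"
  shows "conductance x * potential z x = conductance z * potential x z"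
proof -
  have "conductance x * potential z x = form (potential x) (potential z)"
    by (subst form_potential[of x "potential z" 1]) (use assms in \<open>auto simp: potential_finite_energy potential_bounds potential_base\<close>)
  also have "\<dots> = form (potential z) (potential x)" by (rule form_commute)
  also have "\<dots> = conductance z * potential x z"
    by (subst form_potential[of z "potential x" 1]) (use assms in \<open>auto simp: potential_finite_energy potential_bounds potential_base\<close>)
  finally show ?thesis .
qed

text \<open>Insert a cutoff of small energy with \<open>\<eta> b > 1 / 2\<close> into the Dirichlet principle; it vanishes at every
  \<open>z\<close> outside a finite set.\<close>

lemma conductance_tendsto_0: "(conductance \<longlongrightarrow> 0) at_inf"
proof (rule tendstoI)
  fix \<epsilon> :: real assume \<epsilon>: "\<epsilon> > 0"
  have "\<forall>\<^sub>F n in sequentially. \<eta> n b > 1 / 2"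
    using order_tendstoD(1)[OF cutoff_tendsto_1[OF b], of "1/2"] by simp
  moreover have "\<forall>\<^sub>F n in sequentially. form (\<eta> n) (\<eta> n) < \<epsilon> / 4"
    using order_tendstoD(2)[OF cutoff_energy, of "\<epsilon> / 4"] \<epsilon> by simp
  ultimately have "\<forall>\<^sub>F n in sequentially. \<eta> n b > 1 / 2 \<and> form (\<eta> n) (\<eta> n) < \<epsilon> / 4"
    by eventually_elim simp
  then obtain n where n: "\<eta> n b > 1 / 2" "form (\<eta> n) (\<eta> n) < \<epsilon> / 4"
    by (auto simp: eventually_sequentially)
  have "\<forall>\<^sub>F z in at_inf. z \<in> V \<and> z \<notin> insert b {p \<in> V. \<eta> n p \<noteq> 0}"
    by (intro eventually_conj eventually_at_inf_V eventually_at_inf_notin)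
      (simp add: cutoff_finite_support)
  then show "\<forall>\<^sub>F z in at_inf. dist (conductance z) 0 < \<epsilon>"
  proof eventually_elim
    case (elim z)
    have "conductance z * (\<eta> n z - \<eta> n b)\<^sup>2 \<le> form (\<eta> n) (\<eta> n)"
      by (rule conductance_le[of _ _ 1])
        (use elim cutoff_nonneg cutoff_le_1 cutoff_finite_support in
          \<open>auto intro: finite_energy_finite_support simp: abs_le_iff order_trans[of _ 0]\<close>)
    moreover have "conductance z * (1 / 4) \<le> conductance z * (\<eta> n z - \<eta> n b)\<^sup>2"
    proof (rule mult_left_mono)
      have "(1 / 2)\<^sup>2 \<le> (\<eta> n b)\<^sup>2" using n(1) by (intro power_mono) auto
      then show "1 / 4 \<le> (\<eta> n z - \<eta> n b)\<^sup>2" using elim by (simp add: power2_eq_square)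
    qed (use conductance_pos[of z] elim in simp)
    ultimately have "conductance z < \<epsilon>"
      using n(2) by linarith
    then show ?case
      using conductance_pos[of z] elim by simp
  qed
qed

lemma potential_path_diff:
  assumes "z \<in> V" "(p, q) \<in> edges ^^ k"
  shows "\<bar>potential z p - potential z q\<bar> \<le> real k * sqrt (conductance z)"
  unfolding conductance_def by (rule path_diff_le_energy[OF potential_finite_energy assms(2)]) (rule assms(1))

lemma potential_at_fixed_point_tendsto_0:
  assumes "p \<in> V"
  shows "((\<lambda>z. potential z p) \<longlongrightarrow> 0) at_inf"
proof -
  obtain k where k: "(p, b) \<in> edges ^^ k"
    using connected[OF assms b] rtrancl_imp_relpow by blast
  have lim: "((\<lambda>z. real k * sqrt (conductance z)) \<longlongrightarrow> real k * sqrt 0) at_inf"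
    by (intro tendsto_intros conductance_tendsto_0)
  have "\<forall>\<^sub>F z in at_inf. z \<in> V \<and> z \<notin> {b}"
    by (intro eventually_conj eventually_at_inf_V eventually_at_inf_notin) simp
  then have "\<forall>\<^sub>F z in at_inf. norm (potential z p) \<le> real k * sqrt (conductance z)"
  proof eventually_elim
    case (elim z)
    then show ?case using potential_path_diff[OF _ k, of z] by (simp add: potential_base)
  qed
  from Lim_null_comparison[OF this] lim show ?thesis by simp
qed

lemma potential_converges: "\<exists>L. (potential z \<longlongrightarrow> L) at_inf"
  using hit_converges[of "{b, z}" z] by (simp add: potential_def[abs_def])

text \<open>One way to meet \<open>z\<close> before \<open>b\<close> is to meet \<open>z'\<close> before \<open>b\<close> first and to go on from there.\<close>

lemma potential_chain:
  assumes "z \<in> V" "z \<noteq> b" "z' \<in> V" "z' \<noteq> b" "x \<in> V"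
  shows "potential z z' * potential z' x \<le> potential z x"
proof -
  have "(potential z z' * potential z' x) - 1 * potential z x \<le> 0"
  proof (rule bounded_harmonic_le[where S = "{b, z, z'}" and M = 2 and p = x
        and u = "\<lambda>p. potential z z' * potential z' p - 1 * potential z p"])
    fix p assume "p \<in> V"
    have "\<bar>potential z z' * potential z' p\<bar> \<le> 1 * 1"
      unfolding abs_mult by (intro mult_mono potential_bounds) auto
    then show "\<bar>potential z z' * potential z' p - 1 * potential z p\<bar> \<le> 2"
      using potential_bounds[of z p] by linarith
  next
    fix p assume "p \<in> V - {b, z, z'}"
    then show "0 \<le> lap (\<lambda>p. potential z z' * potential z' p - 1 * potential z p) p"
      by (subst lap_lincomb) (auto simp: potential_harmonic)
  next
    fix p assume "p \<in> {b, z, z'} \<inter> V"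
    moreover have "potential z z' * potential z' z \<le> 1 * 1"
      by (intro mult_mono potential_bounds) (auto intro: potential_bounds)
    ultimately show "potential z z' * potential z' p - 1 * potential z p \<le> 0"
      using assms by (auto simp: potential_self potential_base)
  qed (use assms in auto)
  then show ?thesis by simp
qed

text \<open>If the walk meets \<open>z\<close> before \<open>b\<close>, then it meets \<open>z\<close> before \<open>B\<close>, or it enters \<open>B\<close> and
  reaches \<open>z\<close> before \<open>b\<close> from there, which has probability at most \<open>\<delta>\<close>.\<close>

lemma hit_insert_ge_potential:
  assumes z: "z \<in> V" "z \<notin> B" "z \<noteq> b" and B: "B \<subseteq> V"
    and \<delta>: "\<And>p. p \<in> B \<Longrightarrow> potential z p \<le> \<delta>" "\<delta> \<ge> 0" and x: "x \<in> V"
  shows "potential z x - \<delta> \<le> hit (insert z B) x z"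
proof -
  have "1 * potential z x - 1 * hit (insert z B) x z \<le> \<delta>"
  proof (rule bounded_harmonic_le[where S = "insert b (insert z B)" and M = 2 and p = x
        and u = "\<lambda>p. 1 * potential z p - 1 * hit (insert z B) p z"])
    fix p assume "p \<in> V"
    show "\<bar>1 * potential z p - 1 * hit (insert z B) p z\<bar> \<le> 2"
      using potential_bounds[of z p] hit_bounded[of "insert z B" p z] by linarith
  next
    fix p assume "p \<in> V - insert b (insert z B)"
    then show "0 \<le> lap (\<lambda>p. 1 * potential z p - 1 * hit (insert z B) p z) p"
      by (subst lap_lincomb) (auto simp: potential_harmonic hit_harmonic)
  next
    fix p assume p: "p \<in> insert b (insert z B) \<inter> V"
    have "0 \<le> hit (insert z B) p z" by (rule hit_nonneg)
    with p show "1 * potential z p - 1 * hit (insert z B) p z \<le> \<delta>"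
      using z \<delta> by (auto simp: potential_self potential_base hit_on intro: diff_left_mono order_trans[rotated])
  qed (use b x in auto)
  then show ?thesis by simp
qed

end

end

section \<open>Effective resistance in a graph with translations\<close>

text \<open>Translation by a point of \<open>V\<close> embeds the graph into itself, in general not onto. The last
  assumption makes the translation by \<open>b\<close> harmless: up to finitely many exceptions, it moves points by a bounded graph distance.\<close>

locale translation_graph = hitting_graph V nb \<eta> shell C r\<^sub>0 hit
  for V :: "(int \<times> int) set" and nb :: "int \<times> int \<Rightarrow> (int \<times> int) set" and \<eta> :: "nat \<Rightarrow> int \<times> int \<Rightarrow> real"
    and shell :: "int \<times> int \<Rightarrow> nat" and C :: real and r\<^sub>0 :: nat
    and hit :: "(int \<times> int) set \<Rightarrow> int \<times> int \<Rightarrow> int \<times> int \<Rightarrow> real" +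
  fixes b :: "int \<times> int"
  assumes base_in_V: "b \<in> V"
    and add_in_V: "p \<in> V \<Longrightarrow> w \<in> V \<Longrightarrow> p + w \<in> V"
    and add_nb: "p \<in> V \<Longrightarrow> q \<in> nb p \<Longrightarrow> w \<in> V \<Longrightarrow> q + w \<in> nb (p + w)"
    and short_path_to_shift: "\<exists>K. finite {z \<in> V. \<not> (\<exists>k\<le>K. (z, z + b) \<in> (Sigma V nb) ^^ k)}"
begin

lemma energy_translate:
  assumes u: "finite_energy u" and w: "w \<in> V"
  shows "finite_energy (\<lambda>p. u (p + w))" and "form (\<lambda>p. u (p + w)) (\<lambda>p. u (p + w)) \<le> form u u"
proof -
  define t where "t e = (fst e + w, snd e + w)" for e :: "(int \<times> int) \<times> (int \<times> int)"
  have inj: "inj_on t edges" by (auto simp: t_def inj_on_def)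
  have sub: "t ` edges \<subseteq> edges"
  proof (rule image_subsetI)
    fix e assume "e \<in> edges"
    then have "fst e \<in> V" "snd e \<in> nb (fst e)" by auto
    then show "t e \<in> edges"
      using add_in_V[of "fst e" w] add_nb[of "fst e" "snd e" w] w by (simp add: t_def)
  qed
  have bij: "bij_betw t edges (t ` edges)" using inj by (simp add: bij_betw_def)
  have eq: "(grad (\<lambda>p. u (p + w)) e)\<^sup>2 = (grad u (t e))\<^sup>2" for e
    by (simp add: grad_def t_def)
  have i1: "integrable (count_space (t ` edges)) (\<lambda>e. (grad u e)\<^sup>2)"
    using u sub unfolding finite_energy_def abs_summable_on_def[symmetric]
    by (rule abs_summable_on_subset)
  then show "finite_energy (\<lambda>p. u (p + w))"
    unfolding finite_energy_def eq abs_summable_on_def[symmetric]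
    using abs_summable_on_reindex_bij_betw[OF bij, of "\<lambda>e. (grad u e)\<^sup>2"] by simp
  have "form (\<lambda>p. u (p + w)) (\<lambda>p. u (p + w)) = (\<integral>e. (grad u e)\<^sup>2 \<partial>count_space (t ` edges))"
    unfolding form_self eq by (rule integral_bij_count_space[OF bij])
  also have "\<dots> \<le> form u u"
    unfolding form_self infsetsum_def[symmetric]
    using u i1 sub unfolding finite_energy_def abs_summable_on_def[symmetric]
    by (intro infsetsum_mono_neutral_left) auto
  finally show "form (\<lambda>p. u (p + w)) (\<lambda>p. u (p + w)) \<le> form u u" .
qed

abbreviation "pot z \<equiv> potential b z"
abbreviation "cond z \<equiv> conductance b z"

text \<open>With \<open>R\<close> denoting effective resistances, the left-hand side is \<open>R(x + w, b + w)\<close>: the function \<open>u\<close> is the potential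
  of a unit flow between \<open>x + w\<close> and \<open>b + w\<close>, a difference of two unit flows into \<open>b\<close>, and its energy equals
  the potential difference. Pulled back along the translation, \<open>u\<close> becomes a competitor in the Dirichlet
  principle for \<open>x\<close> and \<open>b\<close>, and it loses energy because edges outside the translated copy are dropped. This is
  Rayleigh's monotonicity law.\<close>

lemma resistance_translate:
  assumes w: "w \<in> V" "w \<noteq> 0" and x: "x \<in> V" "x \<noteq> b" "x + w \<noteq> b"
  shows "1 / cond (x + w) + 1 / cond (b + w) - 2 * pot (b + w) (x + w) / cond (b + w) \<le> 1 / cond x"
proof -
  note B = base_in_V
  let ?x = "x + w" and ?z = "b + w"
  have xV: "?x \<in> V" and zV: "?z \<in> V" and zb: "?z \<noteq> b"
    using add_in_V B w x by auto
  \<comment> \<open>The charges of the two unit flows at \<open>b\<close> cancel.\<close>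
  define u where "u p = 1 / cond ?x * pot ?x p - 1 / cond ?z * pot ?z p" for p
  have cx: "cond ?x > 0" and cz: "cond ?z > 0" and c0: "cond x > 0"
    using conductance_pos[OF B] xV x zV zb by auto
  have fe: "finite_energy (pot ?x)" "finite_energy (pot ?z)"
    using potential_finite_energy[OF B] xV zV by auto
  have feu: "finite_energy u"
    unfolding u_def by (rule finite_energy_lincomb[OF fe])
  have ub: "\<bar>u p\<bar> \<le> 1 / cond ?x + 1 / cond ?z" for p
  proof -
    have "\<bar>u p\<bar> \<le> \<bar>1 / cond ?x * pot ?x p\<bar> + \<bar>1 / cond ?z * pot ?z p\<bar>"
      unfolding u_def by linarith
    also have "\<dots> \<le> 1 / cond ?x * 1 + 1 / cond ?z * 1"
      unfolding abs_mult using cx cz by (intro add_mono mult_mono potential_bounds[OF B]) auto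
    finally show ?thesis by simp
  qed
  have "form u u = 1 / cond ?x * form (pot ?x) u - 1 / cond ?z * form (pot ?z) u"
    using form_lincomb_left[OF fe feu, of "1 / cond ?x" "1 / cond ?z"] by (simp add: u_def[abs_def])
  also have "form (pot ?x) u = cond ?x * (u ?x - u b)"
    by (rule form_potential[OF B xV x(3) feu ub])
  also have "form (pot ?z) u = cond ?z * (u ?z - u b)"
    by (rule form_potential[OF B zV zb feu ub])
  finally have E: "form u u = u ?x - u ?z"
    using cx cz by simp
  have rec: "pot ?x ?z / cond ?x = pot ?z ?x / cond ?z"
    using potential_reciprocal[OF B xV x(3) zV zb] cx cz by (simp add: field_simps)
  have E': "form u u = 1 / cond ?x + 1 / cond ?z - 2 * pot ?z ?x / cond ?z"
    unfolding E unfolding u_def using rec by (simp add: potential_self[OF B])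
  have "cond x * (u ?x - u ?z)\<^sup>2 \<le> form (\<lambda>p. u (p + w)) (\<lambda>p. u (p + w))"
    using conductance_le[OF B x(1,2) energy_translate(1)[OF feu w(1)] ub] by simp
  also have "\<dots> \<le> form u u"
    by (rule energy_translate(2)[OF feu w(1)])
  finally have "form u u * (cond x * form u u) \<le> form u u * 1"
    unfolding E[symmetric] by (simp add: power2_eq_square algebra_simps)
  then have "form u u \<le> 0 \<or> cond x * form u u \<le> 1"
    by (meson mult_le_cancel_left_pos not_le)
  then have "form u u \<le> 1 / cond x"
  proof (elim disjE)
    assume "form u u \<le> 0"
    also have "0 \<le> 1 / cond x" using c0 by simp
    finally show ?thesis .
  qed (use c0 in \<open>simp add: pos_le_divide_eq mult.commute\<close>)
  then show ?thesis unfolding E' .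
qed

text \<open>If the limit were below \<open>1 / 2\<close>, the previous inequality would lower the resistance to \<open>b\<close> by at least a fixed
  \<open>\<delta> > 0\<close> at each step along \<open>b + k * w\<close>, but resistances are nonnegative.\<close>

lemma potential_limit_ge_half:
  assumes w: "w \<in> V" "w \<noteq> 0" and L: "(pot (b + w) \<longlongrightarrow> L) at_inf"
  shows "L \<ge> 1 / 2"
proof (rule ccontr)
  assume "\<not> L \<ge> 1 / 2"
  then have Lh: "L < 1 / 2" by simp
  note B = base_in_V
  define x where "x k = (fst b + int k * fst w, snd b + int k * snd w)" for k
  have x0: "x 0 = b" by (simp add: x_def)
  have xS: "x (Suc k) = x k + w" for k
    by (cases w) (auto simp: x_def algebra_simps prod_eq_iff)
  have xV: "x k \<in> V" for k
    by (induction k) (auto simp: x0 xS B w add_in_V)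
  have inj: "inj x"
    using w(2) by (auto simp: inj_def x_def prod_eq_iff)
  define R where "R k = 1 / cond (x k)" for k
  define \<delta> where "\<delta> = (1 / 2 - L) / cond (b + w)"
  have cz: "cond (b + w) > 0"
    using conductance_pos[OF B, of "b + w"] add_in_V B w by auto
  have \<delta>: "\<delta> > 0" using Lh cz by (simp add: \<delta>_def)
  have "(\<lambda>k. pot (b + w) (x k)) \<longlonglongrightarrow> L"
    using filterlim_compose[OF L filterlim_at_inf_if_inj[OF inj]] xV by auto
  from order_tendstoD(2)[OF this, of "(L + 1 / 2) / 2"] Lh
  obtain N where N: "\<And>k. k \<ge> N \<Longrightarrow> pot (b + w) (x k) < (L + 1 / 2) / 2"
    by (auto simp: eventually_sequentially)
  have xb: "x k \<noteq> b" if "k > 0" for k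
    using inj x0 that by (metis injD less_numeral_extra(3))
  have step: "R (Suc k) \<le> R k - \<delta>" if k: "k \<ge> Suc N" for k
  proof -
    have "R (Suc k) + 1 / cond (b + w) - 2 * pot (b + w) (x (Suc k)) / cond (b + w) \<le> R k"
      using resistance_translate[OF w xV[of k]] xb[of k] xb[of "Suc k"] k by (simp add: R_def xS)
    moreover have "2 * pot (b + w) (x (Suc k)) / cond (b + w) \<le> (L + 1 / 2) / cond (b + w)"
      using N[of "Suc k"] k cz by (intro divide_right_mono) auto
    moreover have "1 / cond (b + w) - (L + 1 / 2) / cond (b + w) = \<delta>"
      by (simp add: \<delta>_def diff_divide_distrib[symmetric])
    ultimately show ?thesis by linarith
  qed
  have decr: "R (Suc N + j) \<le> R (Suc N) - real j * \<delta>" for j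
  proof (induction j)
    case (Suc j)
    then show ?case using step[of "Suc N + j"] by (simp add: algebra_simps)
  qed simp
  obtain j :: nat where "real j * \<delta> > R (Suc N)"
    using ex_less_of_nat_mult[OF \<delta>] by blast
  then have "R (Suc N + j) < 0" using decr[of j] by linarith
  moreover have "R (Suc N + j) \<ge> 0"
    using conductance_pos[OF B xV[of "Suc N + j"] xb] by (simp add: R_def)
  ultimately show False by simp
qed

text \<open>The bound \<open>1 / 2\<close> is available for the translate \<open>z + b\<close>. As \<open>z\<close> is within bounded distance of it and the
  conductance tends to \<open>0\<close>, the walk from \<open>z + b\<close> meets \<open>z\<close> before \<open>b\<close> with probability at least \<open>3 / 4\<close> for far \<open>z\<close>.\<close>

lemma far_point_visible_from_infinity:
  "\<forall>\<^sub>F z in at_inf. \<forall>L. (pot z \<longlongrightarrow> L) at_inf \<longrightarrow> L \<ge> 3 / 8"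
proof -
  note B = base_in_V
  obtain K where K: "finite {z \<in> V. \<not> (\<exists>k\<le>K. (z, z + b) \<in> edges ^^ k)}"
    using short_path_to_shift by blast
  have "((\<lambda>z. real K * sqrt (cond z)) \<longlongrightarrow> real K * sqrt 0) at_inf"
    by (intro tendsto_intros conductance_tendsto_0[OF B])
  then have small: "\<forall>\<^sub>F z in at_inf. real K * sqrt (cond z) < 1 / 4"
    by (rule order_tendstoD) simp
  have "\<forall>\<^sub>F z in at_inf. z \<in> V \<and> z \<notin> {0, b} \<and> (\<exists>k\<le>K. (z, z + b) \<in> edges ^^ k)
      \<and> real K * sqrt (cond z) < 1 / 4"
    by (intro eventually_conj eventually_at_inf_V eventually_at_inf_notin small)
      (use K in \<open>auto simp: eventually_at_inf\<close>)
  then show ?thesis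
  proof (rule eventually_mono, intro allI impI)
    fix z L
    assume z: "z \<in> V \<and> z \<notin> {0, b} \<and> (\<exists>k\<le>K. (z, z + b) \<in> edges ^^ k)
      \<and> real K * sqrt (cond z) < 1 / 4"
      and L: "(pot z \<longlongrightarrow> L) at_inf"
    then obtain k where k: "k \<le> K" "(z, z + b) \<in> edges ^^ k" by blast
    have "\<bar>pot z z - pot z (z + b)\<bar> \<le> real k * sqrt (cond z)"
      by (rule potential_path_diff[OF B _ k(2)]) (use z in simp)
    also have "\<dots> \<le> real K * sqrt (cond z)"
      using k(1) form_self_nonneg[of "pot z"]
      by (intro mult_right_mono) (auto simp: conductance_def[OF B])
    also have "\<dots> < 1 / 4" using z by blast
    finally have near: "pot z (z + b) \<ge> 3 / 4"
      unfolding potential_self[OF B] by linarith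
    obtain L' where L': "(pot (b + z) \<longlongrightarrow> L') at_inf"
      using potential_converges[OF B] by blast
    have half: "L' \<ge> 1 / 2"
      by (rule potential_limit_ge_half[OF _ _ L']) (use z in auto)
    have "3 / 4 * L' \<le> L"
    proof (rule tendsto_le[OF at_inf_neq_bot L tendsto_mult_left[OF L']])
      show "\<forall>\<^sub>F x in at_inf. 3 / 4 * pot (b + z) x \<le> pot z x"
        using eventually_at_inf_V
      proof eventually_elim
        case (elim x)
        have "3 / 4 * pot (b + z) x \<le> pot z (b + z) * pot (b + z) x"
          using near by (intro mult_right_mono potential_bounds[OF B]) (simp add: add.commute)
        also have "\<dots> \<le> pot z x"
          by (rule potential_chain[OF B]) (use z elim add_in_V[OF B] in auto)
        finally show ?case .
      qed
    qed
    with half show "L \<ge> 3 / 8" by linarith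
  qed
qed

text \<open>Add to \<open>B\<close> a point \<open>z\<close> of \<open>A\<close> so far away that the walk from infinity meets it before \<open>B\<close> with probability at least
  \<open>3 / 8 - 1 / 8\<close>, and that \<open>hit B z y\<close> is at least half of its limit.\<close>

lemma hit_limit_decreases:
  assumes B: "finite B" "B \<subseteq> A \<inter> V" "y \<in> B" and A: "infinite (A \<inter> V)"
    and L: "((\<lambda>x. hit B x y) \<longlongrightarrow> L) at_inf"
  shows "\<exists>B' L'. finite B' \<and> B' \<subseteq> A \<inter> V \<and> y \<in> B' \<and> ((\<lambda>x. hit B' x y) \<longlongrightarrow> L') at_inf
           \<and> L' \<le> 7 / 8 * L"
proof -
  have L0: "L \<ge> 0"
    by (rule tendsto_lowerbound[OF L]) (simp_all add: hit_nonneg)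
  have small: "\<forall>\<^sub>F z in at_inf. \<forall>p\<in>B. pot z p \<le> 1 / 8"
  proof (rule eventually_ball_finite[OF B(1)], intro ballI)
    fix p assume "p \<in> B"
    then have "((\<lambda>z. pot z p) \<longlongrightarrow> 0) at_inf"
      using potential_at_fixed_point_tendsto_0[OF base_in_V] B by blast
    then have "\<forall>\<^sub>F z in at_inf. pot z p < 1 / 8"
      by (rule order_tendstoD) simp
    then show "\<forall>\<^sub>F z in at_inf. pot z p \<le> 1 / 8"
      by eventually_elim simp
  qed
  have large: "\<forall>\<^sub>F z in at_inf. hit B z y \<ge> L / 2"
  proof (cases "L = 0")
    case True
    then show ?thesis by (simp add: hit_nonneg)
  next
    case False
    with L0 have "L / 2 < L" by simp
    from order_tendstoD(1)[OF L this] show ?thesis by eventually_elim simp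
  qed
  have "\<forall>\<^sub>F z in at_inf. z \<in> V \<and> z \<notin> insert b B \<and> (\<forall>p\<in>B. pot z p \<le> 1 / 8) \<and> hit B z y \<ge> L / 2
      \<and> (\<forall>L. (pot z \<longlongrightarrow> L) at_inf \<longrightarrow> L \<ge> 3 / 8)"
    by (intro eventually_conj eventually_at_inf_V eventually_at_inf_notin small large
        far_point_visible_from_infinity) (use B in auto)
  then have "finite {z \<in> V. \<not> (z \<in> V \<and> z \<notin> insert b B \<and> (\<forall>p\<in>B. pot z p \<le> 1 / 8) \<and> hit B z y \<ge> L / 2
      \<and> (\<forall>L. (pot z \<longlongrightarrow> L) at_inf \<longrightarrow> L \<ge> 3 / 8))}" (is "finite ?bad")
    by (simp only: eventually_at_inf)
  then have "\<not> A \<inter> V \<subseteq> ?bad" using A finite_subset by blast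
  then obtain z where z: "z \<in> A" "z \<in> V" "z \<notin> insert b B" "\<And>p. p \<in> B \<Longrightarrow> pot z p \<le> 1 / 8"
      "hit B z y \<ge> L / 2" "\<And>L. (pot z \<longlongrightarrow> L) at_inf \<Longrightarrow> L \<ge> 3 / 8"
    by blast
  let ?B = "insert z B"
  obtain l where l: "((\<lambda>x. hit ?B x z) \<longlongrightarrow> l) at_inf"
    using hit_converges[of ?B z] B by blast
  obtain L1 where L1: "(pot z \<longlongrightarrow> L1) at_inf"
    using potential_converges[OF base_in_V] by blast
  have "L1 - 1 / 8 \<le> l"
  proof (rule tendsto_le[OF at_inf_neq_bot l tendsto_diff[OF L1 tendsto_const]])
    show "\<forall>\<^sub>F x in at_inf. pot z x - 1 / 8 \<le> hit ?B x z"
      using eventually_at_inf_V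
      by eventually_elim (rule hit_insert_ge_potential[OF base_in_V], use z B in auto)
  qed
  with z(6)[OF L1] have l4: "l \<ge> 1 / 4" by linarith
  have "((\<lambda>x. hit B x y - hit ?B x z * hit B z y) \<longlongrightarrow> L - l * hit B z y) at_inf"
    by (intro tendsto_intros L l)
  then have lim: "((\<lambda>x. hit ?B x y) \<longlongrightarrow> L - l * hit B z y) at_inf"
  proof (rule Lim_transform_eventually)
    show "\<forall>\<^sub>F x in at_inf. hit B x y - hit ?B x z * hit B z y = hit ?B x y"
      using eventually_at_inf_V
      by eventually_elim (subst hit_insert, use z B in auto)
  qed
  have "1 / 4 * (L / 2) \<le> l * hit B z y"
    using l4 z(5) L0 by (intro mult_mono) auto
  then have "L - l * hit B z y \<le> 7 / 8 * L" by simp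
  with lim z B show ?thesis
    by (intro exI[of _ ?B] exI[of _ "L - l * hit B z y"]) auto
qed

lemma hit_infinite_set_tendsto_0:
  assumes A: "infinite (A \<inter> V)" "y \<in> A \<inter> V"
  shows "((\<lambda>x. hit A x y) \<longlongrightarrow> 0) at_inf"
proof -
  have iter: "\<exists>B L. finite B \<and> B \<subseteq> A \<inter> V \<and> y \<in> B \<and> ((\<lambda>x. hit B x y) \<longlongrightarrow> L) at_inf \<and> L \<le> (7 / 8) ^ n" for n
  proof (induction n)
    case 0
    obtain L where L: "((\<lambda>x. hit {y} x y) \<longlongrightarrow> L) at_inf"
      using hit_converges[of "{y}" y] by (meson finite_Int finite.emptyI finite.insertI)
    have "L \<le> 1"
      by (rule tendsto_upperbound[OF L]) (simp_all add: hit_le_1)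
    with L A show ?case by (intro exI[of _ "{y}"] exI[of _ L]) auto
  next
    case (Suc n)
    then obtain B L where BL: "finite B" "B \<subseteq> A \<inter> V" "y \<in> B" "((\<lambda>x. hit B x y) \<longlongrightarrow> L) at_inf"
        "L \<le> (7 / 8) ^ n" by blast
    from hit_limit_decreases[OF BL(1-3) A(1) BL(4)] obtain B' L' where
      "finite B'" "B' \<subseteq> A \<inter> V" "y \<in> B'" "((\<lambda>x. hit B' x y) \<longlongrightarrow> L') at_inf" "L' \<le> 7 / 8 * L" by blast
    moreover from this(5) BL(5) have "L' \<le> (7 / 8) ^ Suc n" by simp
    ultimately show ?case by (intro exI[of _ B'] exI[of _ L']) simp
  qed
  show ?thesis
  proof (rule tendstoI)
    fix \<epsilon> :: real assume "\<epsilon> > 0"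
    then obtain n where n: "(7 / 8 :: real) ^ n < \<epsilon>"
      using real_arch_pow_inv[of \<epsilon> "7 / 8"] by auto
    obtain B L where BL: "finite B" "B \<subseteq> A \<inter> V" "y \<in> B" "((\<lambda>x. hit B x y) \<longlongrightarrow> L) at_inf" "L \<le> (7 / 8) ^ n"
      using iter[of n] by (elim exE conjE) (rule that)
    from BL(5) n have "L < \<epsilon>" by linarith
    from eventually_conj[OF eventually_at_inf_V order_tendstoD(2)[OF BL(4) this]]
    show "\<forall>\<^sub>F x in at_inf. dist (hit A x y) 0 < \<epsilon>"
    proof eventually_elim
      case (elim x)
      have "hit A x y \<le> hit B x y"
        by (rule hit_mono) (use BL A elim in auto)
      with elim show ?case using hit_nonneg[of A x y] by simp
    qed
  qed
qed

text \<open>If \<open>A\<close> meets \<open>V\<close> in an infinite set that does not contain \<open>y\<close>, then \<open>hit A x y\<close> is zero by the maximum principle.\<close>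

theorem hit_limit_exists: "\<exists>L. ((\<lambda>x. hit A x y) \<longlongrightarrow> L) at_inf"
proof (cases "finite (A \<inter> V)")
  case True
  then show ?thesis by (rule hit_converges)
next
  case inf: False
  show ?thesis
  proof (cases "y \<in> A \<inter> V")
    case True
    then show ?thesis using hit_infinite_set_tendsto_0[OF inf] by blast
  next
    case False
    have zero: "hit A x y = 0" if "x \<in> V" for x
    proof -
      have "hit A x y \<le> 0"
        by (rule bounded_harmonic_le[where S = A and M = 1 and p = x and u = "\<lambda>x. hit A x y"])
          (use inf that False in \<open>auto simp: hit_bounded hit_harmonic hit_on\<close>)
      then show ?thesis using hit_nonneg[of A x y] by simp
    qed
    have "((\<lambda>x. hit A x y) \<longlongrightarrow> 0) at_inf"
      by (rule tendsto_eventually) (use eventually_at_inf_V in \<open>eventually_elim, simp add: zero\<close>)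
    then show ?thesis by blast
  qed
qed

end

section \<open>Hitting probabilities of the simple random walk\<close>

text \<open>The law of the first \<open>n + 1\<close> positions. It is built from the front, so that conditioning on the
  first step is the defining equation.\<close>

primrec walk_pmf :: "real \<Rightarrow> real \<Rightarrow> nat \<Rightarrow> int \<times> int \<Rightarrow> (int \<times> int) list pmf" where
  "walk_pmf \<theta>\<^sub>1 \<theta>\<^sub>2 0 x = return_pmf [x]"
| "walk_pmf \<theta>\<^sub>1 \<theta>\<^sub>2 (Suc n) x = map_pmf ((#) x) (bind_pmf (srw_step \<theta>\<^sub>1 \<theta>\<^sub>2 x) (walk_pmf \<theta>\<^sub>1 \<theta>\<^sub>2 n))"

lemma pmf_walk_pmf:
  "pmf (walk_pmf \<theta>\<^sub>1 \<theta>\<^sub>2 n x) l =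
     (if length l = Suc n \<and> l ! 0 = x then \<Prod>i<n. pmf (srw_step \<theta>\<^sub>1 \<theta>\<^sub>2 (l ! i)) (l ! Suc i) else 0)"
proof (induction n arbitrary: x l)
  case 0
  then show ?case by (cases l) (auto simp: indicator_def)
next
  case (Suc n)
  let ?step = "srw_step \<theta>\<^sub>1 \<theta>\<^sub>2"
  show ?case
  proof (cases "l \<in> range ((#) x)")
    case False
    then have "pmf (walk_pmf \<theta>\<^sub>1 \<theta>\<^sub>2 (Suc n) x) l = 0"
      by (auto simp: pmf_eq_0_set_pmf)
    moreover have "\<not> (length l = Suc (Suc n) \<and> l ! 0 = x)"
      using False by (cases l) auto
    ultimately show ?thesis by (simp only: if_False)
  next
    case True
    then obtain l' where l: "l = x # l'" by auto
    have "pmf (walk_pmf \<theta>\<^sub>1 \<theta>\<^sub>2 (Suc n) x) l = pmf (bind_pmf (?step x) (walk_pmf \<theta>\<^sub>1 \<theta>\<^sub>2 n)) l'"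
      by (simp add: l pmf_map_inj')
    also have "\<dots> = (\<integral>q. pmf (walk_pmf \<theta>\<^sub>1 \<theta>\<^sub>2 n q) l' \<partial>measure_pmf (?step x))"
      by (rule pmf_bind)
    also have "\<dots> = (\<Sum>q\<in>{l' ! 0}. pmf (walk_pmf \<theta>\<^sub>1 \<theta>\<^sub>2 n q) l' * pmf (?step x) q)"
      by (rule integral_measure_pmf_real) (auto simp: Suc.IH split: if_splits)
    finally show ?thesis
      by (simp add: l Suc.IH prod.lessThan_Suc_shift mult.commute del: prod.lessThan_Suc)
  qed
qed

lemma coordinate_event_sets: "{\<omega>. \<omega> i \<in> B} \<in> sets (srw_law \<theta>\<^sub>1 \<theta>\<^sub>2 x)"
proof -
  have "(\<lambda>\<omega>. \<omega> i) \<in> (\<Pi>\<^sub>M i\<in>UNIV. count_space UNIV) \<rightarrow>\<^sub>M count_space (UNIV :: (int \<times> int) set)"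
    by (rule measurable_component_singleton) simp
  then have "(\<lambda>\<omega>. \<omega> i) -` B \<inter> space (\<Pi>\<^sub>M i\<in>UNIV. count_space (UNIV :: (int \<times> int) set))
      \<in> sets (\<Pi>\<^sub>M i\<in>UNIV. count_space UNIV)"
    by (rule measurable_sets) simp
  then show ?thesis
    by (simp add: sets_srw_law space_PiM vimage_def)
qed

lemma prefix_eq_iff:
  "map \<omega> [0..<Suc n] = l \<longleftrightarrow> length l = Suc n \<and> (\<forall>i\<le>n. \<omega> i = l ! i)"
  by (auto simp: list_eq_iff_nth_eq less_Suc_eq_le simp del: upt_Suc)

text \<open>Lists form a countable type, so it suffices to compare the masses of single lists, which are given
  by the cylinder probabilities.\<close>

lemma distr_prefix:
  "distr (srw_law \<theta>\<^sub>1 \<theta>\<^sub>2 x) (count_space UNIV) (\<lambda>\<omega>. map \<omega> [0..<Suc n]) = measure_pmf (walk_pmf \<theta>\<^sub>1 \<theta>\<^sub>2 n x)"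
  (is "?D = _")
  and measurable_prefix: "(\<lambda>\<omega>. map \<omega> [0..<Suc n]) \<in> srw_law \<theta>\<^sub>1 \<theta>\<^sub>2 x \<rightarrow>\<^sub>M count_space UNIV"
proof -
  have cyl: "{\<omega>. \<forall>i\<le>n. \<omega> i = s i} \<in> sets (srw_law \<theta>\<^sub>1 \<theta>\<^sub>2 x)" for s
  proof -
    have "{\<omega>. \<forall>i\<le>n. \<omega> i = s i} = (\<Inter>i\<in>{..n}. {\<omega>. \<omega> i \<in> {s i}})" by auto
    also have "\<dots> \<in> sets (srw_law \<theta>\<^sub>1 \<theta>\<^sub>2 x)"
      by (rule sets.finite_INT) (auto simp only: intro!: coordinate_event_sets)
    finally show ?thesis .
  qed
  have vim: "(\<lambda>\<omega>. map \<omega> [0..<Suc n]) -` {l} = (if length l = Suc n then {\<omega>. \<forall>i\<le>n. \<omega> i = l ! i} else {})" for l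
    unfolding vimage_def using prefix_eq_iff by auto
  show meas: "(\<lambda>\<omega>. map \<omega> [0..<Suc n]) \<in> srw_law \<theta>\<^sub>1 \<theta>\<^sub>2 x \<rightarrow>\<^sub>M count_space UNIV"
    by (subst measurable_count_space_eq2_countable)
      (use cyl in \<open>auto simp: vim simp del: upt_Suc intro: countableI_type\<close>)
  show "?D = measure_pmf (walk_pmf \<theta>\<^sub>1 \<theta>\<^sub>2 n x)"
  proof (rule measure_eqI_countable[of _ UNIV])
    fix l :: "(int \<times> int) list"
    have "emeasure ?D {l} = emeasure (srw_law \<theta>\<^sub>1 \<theta>\<^sub>2 x) ((\<lambda>\<omega>. map \<omega> [0..<Suc n]) -` {l})"
      by (subst emeasure_distr[OF meas]) simp_all
    also have "\<dots> = ennreal (pmf (walk_pmf \<theta>\<^sub>1 \<theta>\<^sub>2 n x) l)"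
      unfolding vim pmf_walk_pmf using emeasure_srw_law_cylinder[of \<theta>\<^sub>1 \<theta>\<^sub>2 x n "\<lambda>i. l ! i"]
      by (simp add: prod_ennreal)
    finally show "emeasure ?D {l} = emeasure (measure_pmf (walk_pmf \<theta>\<^sub>1 \<theta>\<^sub>2 n x)) {l}"
      by (simp add: emeasure_pmf_single)
  qed auto
qed

text \<open>The probability that \<open>A\<close> is entered at time \<open>n\<close>, and at the point \<open>y\<close>.\<close>

definition hit_at :: "real \<Rightarrow> real \<Rightarrow> (int \<times> int) set \<Rightarrow> int \<times> int \<Rightarrow> nat \<Rightarrow> int \<times> int \<Rightarrow> real" where
  "hit_at \<theta>\<^sub>1 \<theta>\<^sub>2 A y n x = measure (walk_pmf \<theta>\<^sub>1 \<theta>\<^sub>2 n x) {l. (\<forall>i<n. l ! i \<notin> A) \<and> l ! n \<in> A \<and> l ! n = y}"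

lemma hit_at_sums: "(\<lambda>n. hit_at \<theta>\<^sub>1 \<theta>\<^sub>2 A y n x) sums hitting_prob \<theta>\<^sub>1 \<theta>\<^sub>2 A x y"
proof -
  interpret prob_space "srw_law \<theta>\<^sub>1 \<theta>\<^sub>2 x" by (rule prob_space_srw_law)
  define E where "E n = {\<omega>. (\<forall>i<n. \<omega> i \<notin> A) \<and> \<omega> n \<in> A \<and> \<omega> n = y}" for n :: nat
  define S where "S n = {l :: (int \<times> int) list. (\<forall>i<n. l ! i \<notin> A) \<and> l ! n \<in> A \<and> l ! n = y}" for n
  have E_vim: "E n = (\<lambda>\<omega>. map \<omega> [0..<Suc n]) -` S n \<inter> space (srw_law \<theta>\<^sub>1 \<theta>\<^sub>2 x)" for n
    by (auto simp: E_def S_def nth_append simp del: upt_Suc)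
  have E_sets: "E n \<in> sets (srw_law \<theta>\<^sub>1 \<theta>\<^sub>2 x)" for n
    unfolding E_vim by (rule measurable_sets[OF measurable_prefix]) simp
  have "disjoint_family E"
    unfolding disjoint_family_on_def
  proof (intro ballI impI)
    fix m n :: nat assume "m \<noteq> n"
    then show "E m \<inter> E n = {}" by (cases m n rule: linorder_cases) (auto simp: E_def)
  qed
  then have "(\<lambda>n. prob (E n)) sums prob (\<Union>n. E n)"
    using E_sets by (intro finite_measure_UNION) auto
  moreover have "prob (E n) = hit_at \<theta>\<^sub>1 \<theta>\<^sub>2 A y n x" for n
    unfolding E_vim hit_at_def S_def[symmetric] distr_prefix[symmetric]
    by (subst measure_distr[OF measurable_prefix]) simp_all
  ultimately show ?thesis
    unfolding hitting_prob_def hitting_event_eq E_def by simp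
qed

lemma hit_at_0: "hit_at \<theta>\<^sub>1 \<theta>\<^sub>2 A y 0 x = of_bool (x \<in> A \<and> x = y)"
  by (auto simp: hit_at_def indicator_def)

lemma hit_at_Suc:
  "hit_at \<theta>\<^sub>1 \<theta>\<^sub>2 A y (Suc n) x =
     (if x \<in> A then 0 else \<integral>q. hit_at \<theta>\<^sub>1 \<theta>\<^sub>2 A y n q \<partial>measure_pmf (srw_step \<theta>\<^sub>1 \<theta>\<^sub>2 x))"
proof -
  let ?S = "{l :: (int \<times> int) list. (\<forall>i<n. l ! i \<notin> A) \<and> l ! n \<in> A \<and> l ! n = y}"
  have vim: "(#) x -` {l. (\<forall>i<Suc n. l ! i \<notin> A) \<and> l ! Suc n \<in> A \<and> l ! Suc n = y} = (if x \<in> A then {} else ?S)"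
    by (auto simp: All_less_Suc2)
  have "hit_at \<theta>\<^sub>1 \<theta>\<^sub>2 A y (Suc n) x
      = measure (bind_pmf (srw_step \<theta>\<^sub>1 \<theta>\<^sub>2 x) (walk_pmf \<theta>\<^sub>1 \<theta>\<^sub>2 n)) (if x \<in> A then {} else ?S)"
    unfolding hit_at_def walk_pmf.simps measure_map_pmf vim ..
  also have "\<dots> = (if x \<in> A then 0 else measure (bind_pmf (srw_step \<theta>\<^sub>1 \<theta>\<^sub>2 x) (walk_pmf \<theta>\<^sub>1 \<theta>\<^sub>2 n)) ?S)"
    by simp
  also have "measure (bind_pmf (srw_step \<theta>\<^sub>1 \<theta>\<^sub>2 x) (walk_pmf \<theta>\<^sub>1 \<theta>\<^sub>2 n)) ?S
      = (\<integral>q. hit_at \<theta>\<^sub>1 \<theta>\<^sub>2 A y n q \<partial>measure_pmf (srw_step \<theta>\<^sub>1 \<theta>\<^sub>2 x))"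
    unfolding hit_at_def measure_pmf_bind
    by (rule measure_pmf.measure_bind[where N = "count_space UNIV"])
      (auto simp: measure_pmf_in_subprob_algebra)
  finally show ?thesis .
qed

lemma hitting_prob_bounds: "0 \<le> hitting_prob \<theta>\<^sub>1 \<theta>\<^sub>2 A x y" "hitting_prob \<theta>\<^sub>1 \<theta>\<^sub>2 A x y \<le> 1"
  using prob_space.prob_le_1[OF prob_space_srw_law] by (simp_all add: hitting_prob_def)

lemma hitting_prob_on:
  assumes "x \<in> A"
  shows "hitting_prob \<theta>\<^sub>1 \<theta>\<^sub>2 A x y = of_bool (x = y)"
proof -
  have "hit_at \<theta>\<^sub>1 \<theta>\<^sub>2 A y n x = 0" if "n \<noteq> 0" for n
    using that assms by (cases n) (auto simp: hit_at_Suc)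
  then have "(\<lambda>n. hit_at \<theta>\<^sub>1 \<theta>\<^sub>2 A y n x) sums (\<Sum>n\<in>{0}. hit_at \<theta>\<^sub>1 \<theta>\<^sub>2 A y n x)"
    by (intro sums_finite) auto
  from sums_unique2[OF hit_at_sums this] show ?thesis
    using assms by (simp add: hit_at_0)
qed

text \<open>Sum the one-step recursion for the hitting probability at time \<open>Suc n\<close> over all \<open>n\<close>.\<close>

lemma hitting_prob_mean:
  assumes "x \<notin> A"
  shows "(\<Sum>q\<in>wedge_neighbours \<theta>\<^sub>1 \<theta>\<^sub>2 x. hitting_prob \<theta>\<^sub>1 \<theta>\<^sub>2 A q y - hitting_prob \<theta>\<^sub>1 \<theta>\<^sub>2 A x y) = 0"
proof (cases "wedge_neighbours \<theta>\<^sub>1 \<theta>\<^sub>2 x = {}")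
  case False
  let ?N = "wedge_neighbours \<theta>\<^sub>1 \<theta>\<^sub>2 x" and ?H = "\<lambda>x. hitting_prob \<theta>\<^sub>1 \<theta>\<^sub>2 A x y"
  have Suc: "hit_at \<theta>\<^sub>1 \<theta>\<^sub>2 A y (Suc n) x = (\<Sum>q\<in>?N. hit_at \<theta>\<^sub>1 \<theta>\<^sub>2 A y n q) / card ?N" for n
    using assms False by (simp add: hit_at_Suc srw_step_def integral_pmf_of_set)
  have "(\<lambda>n. hit_at \<theta>\<^sub>1 \<theta>\<^sub>2 A y (Suc n) x) sums ?H x"
    using hit_at_sums[of \<theta>\<^sub>1 \<theta>\<^sub>2 A y x] assms by (subst sums_Suc_iff) (simp add: hit_at_0)
  moreover have "(\<lambda>n. hit_at \<theta>\<^sub>1 \<theta>\<^sub>2 A y (Suc n) x) sums ((\<Sum>q\<in>?N. ?H q) / card ?N)"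
    unfolding Suc by (intro sums_divide sums_sum hit_at_sums)
  ultimately have "?H x = (\<Sum>q\<in>?N. ?H q) / card ?N"
    by (rule sums_unique2)
  then show ?thesis
    using False by (simp add: sum_subtractf field_simps card_gt_0_iff)
qed simp

section \<open>Angles, lattice norms and logarithmic cutoffs\<close>

lemma le_arctan_iff:
  assumes "- pi / 2 \<le> \<theta>" "\<theta> \<le> pi / 2" "x > 0"
  shows "\<theta> \<le> arctan (y / x) \<longleftrightarrow> sin \<theta> * x \<le> cos \<theta> * y"
proof -
  consider "\<theta> = - (pi / 2)" | "\<theta> = pi / 2" | "- (pi / 2) < \<theta>" "\<theta> < pi / 2"
    using assms by fastforce
  then show ?thesis
  proof cases
    case 1
    then show ?thesis using arctan_lbound[of "y / x"] assms by simp
  next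
    case 2
    then have "sin \<theta> = 1" "cos \<theta> = 0" by (simp_all only: sin_pi_half cos_pi_half)
    moreover have "\<not> \<theta> \<le> arctan (y / x)" using 2 arctan_ubound[of "y / x"] by linarith
    ultimately show ?thesis using assms by simp
  next
    case 3
    then have c: "cos \<theta> > 0" by (intro cos_gt_zero_pi) auto
    have "\<theta> \<le> arctan (y / x) \<longleftrightarrow> arctan (tan \<theta>) \<le> arctan (y / x)"
      using 3 by (simp add: arctan_tan)
    also have "\<dots> \<longleftrightarrow> tan \<theta> \<le> y / x"
      by (rule arctan_le_iff)
    also have "\<dots> \<longleftrightarrow> sin \<theta> * x \<le> cos \<theta> * y"
      using c assms(3) by (simp add: tan_def field_simps)
    finally show ?thesis .
  qed
qed

lemma arctan_le_iff_sin_cos: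
  assumes "- pi / 2 \<le> \<theta>" "\<theta> \<le> pi / 2" "x > 0"
  shows "arctan (y / x) \<le> \<theta> \<longleftrightarrow> cos \<theta> * y \<le> sin \<theta> * x"
  using le_arctan_iff[of "- \<theta>" x "- y"] assms by (simp add: arctan_minus)

definition l1 :: "int \<times> int \<Rightarrow> nat" where
  "l1 p = nat (\<bar>fst p\<bar> + \<bar>snd p\<bar>)"

definition shell :: "int \<times> int \<Rightarrow> nat" where
  "shell p = nat (max \<bar>fst p\<bar> \<bar>snd p\<bar>)"

text \<open>A discrete version of \<open>1 - ln \<bar>p\<bar> / ln n\<close>, truncated at zero. Harmonic numbers replace the logarithm because their increments
  are exact; the shift to \<open>Suc n\<close> avoids the denominator \<open>harm 0 = 0\<close>.\<close>

definition cutoff :: "nat \<Rightarrow> int \<times> int \<Rightarrow> real" where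
  "cutoff n p = max 0 (1 - harm (l1 p) / harm (Suc n))"

definition multiple :: "nat \<Rightarrow> int \<times> int \<Rightarrow> int \<times> int" where
  "multiple k p = (int k * fst p, int k * snd p)"

lemma multiple_0: "multiple 0 p = 0" and multiple_Suc: "multiple (Suc k) p = multiple k p + p"
  by (simp_all add: multiple_def prod_eq_iff algebra_simps)

lemma adjacent_commute: "adjacent p q \<longleftrightarrow> adjacent q p"
  by (simp add: adjacent_def abs_minus_commute)

lemma adjacent_add_iff: "adjacent (p + w) (q + w) \<longleftrightarrow> adjacent p q"
  by (simp add: adjacent_def)

lemma adjacent_cases:
  assumes "adjacent p q"
  obtains "q = p + (1, 0)" | "q = p + (-1, 0)" | "q = p + (0, 1)" | "q = p + (0, -1)"
proof -
  have "\<bar>fst p - fst q\<bar> + \<bar>snd p - snd q\<bar> = 1" using assms by (simp add: adjacent_def)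
  then have "fst q = fst p + 1 \<and> snd q = snd p \<or> fst q = fst p - 1 \<and> snd q = snd p
      \<or> fst q = fst p \<and> snd q = snd p + 1 \<or> fst q = fst p \<and> snd q = snd p - 1"
    by linarith
  then show ?thesis using that by (auto simp: prod_eq_iff)
qed

lemma int_l1: "int (l1 p) = \<bar>fst p\<bar> + \<bar>snd p\<bar>"
  by (simp add: l1_def)

lemma l1_adjacent:
  assumes "adjacent p q"
  shows "l1 q = Suc (l1 p) \<or> l1 p = Suc (l1 q)"
proof -
  have "int (l1 q) = int (l1 p) + 1 \<or> int (l1 p) = int (l1 q) + 1"
    using assms
  proof (cases rule: adjacent_cases)
    case 1
    then show ?thesis unfolding int_l1 by simp arith
  next
    case 2
    then show ?thesis unfolding int_l1 by simp arith
  next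
    case 3
    then show ?thesis unfolding int_l1 by simp arith
  next
    case 4
    then show ?thesis unfolding int_l1 by simp arith
  qed
  then show ?thesis by linarith
qed

lemma shell_adjacent: "adjacent p q \<Longrightarrow> shell q \<le> Suc (shell p)"
  by (erule adjacent_cases) (auto simp: shell_def)

lemma finite_box: "finite {p :: int \<times> int. \<bar>fst p\<bar> \<le> k \<and> \<bar>snd p\<bar> \<le> k}"
  by (rule finite_subset[of _ "{-k..k} \<times> {-k..k}"]) auto

lemma finite_l1: "finite {p. l1 p \<le> n}"
  by (rule finite_subset[OF _ finite_box[of "int n"]]) (auto simp: l1_def)

lemma finite_shell: "finite {p. shell p \<le> n}"
  by (rule finite_subset[OF _ finite_box[of "int n"]]) (auto simp: shell_def)

lemma card_l1_sphere: "card {p. l1 p = r} \<le> 4 * r + 2"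
proof -
  define f where "f = (\<lambda>(x, s). (x, s * (int r - \<bar>x\<bar>)))"
  have "{p. l1 p = r} \<subseteq> f ` ({- int r..int r} \<times> {1, -1})"
  proof
    fix p assume "p \<in> {p. l1 p = r}"
    then have r: "\<bar>fst p\<bar> + \<bar>snd p\<bar> = int r" by (auto simp: l1_def)
    then have "p = f (fst p, if snd p \<ge> 0 then 1 else -1)"
      by (cases p) (auto simp: f_def)
    then show "p \<in> f ` ({- int r..int r} \<times> {1, -1})"
      using r by (intro image_eqI[of _ _ "(fst p, if snd p \<ge> 0 then 1 else -1)"]) auto
  qed
  then have "card {p. l1 p = r} \<le> card ({- int r..int r} \<times> {1, -1 :: int})"
    by (intro surj_card_le) auto
  then show ?thesis by (simp add: card_cartesian_product)
qed


lemma cutoff_bounds: "0 \<le> cutoff n p" "cutoff n p \<le> 1"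
  by (simp_all add: cutoff_def harm_nonneg)

lemma cutoff_eq_0: "Suc n \<le> l1 p \<Longrightarrow> cutoff n p = 0"
  using harm_mono[of "Suc n" "l1 p", where 'a = real] harm_pos[of "Suc n", where 'a = real]
  by (simp add: cutoff_def)

lemma harm_Suc_at_top: "filterlim (\<lambda>n. harm (Suc n) :: real) at_top sequentially"
  using filterlim_compose[OF harm_at_top filterlim_Suc] .

lemma cutoff_lim: "(\<lambda>n. cutoff n p) \<longlonglongrightarrow> 1"
proof -
  have "(\<lambda>n. harm (l1 p) / harm (Suc n) :: real) \<longlonglongrightarrow> 0"
    by (rule tendsto_divide_0[OF tendsto_const filterlim_at_top_imp_at_infinity[OF harm_Suc_at_top]])
  then have "(\<lambda>n. max 0 (1 - harm (l1 p) / harm (Suc n) :: real)) \<longlonglongrightarrow> max 0 (1 - 0)"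
    by (intro tendsto_intros)
  then show ?thesis by (simp add: cutoff_def)
qed

text \<open>Along an edge the \<open>l1\<close> norm changes by one, so a harmonic number changes by the reciprocal of the larger norm.\<close>

lemma cutoff_edge:
  assumes "adjacent p q"
  shows "\<bar>cutoff n q - cutoff n p\<bar> \<le> 1 / (max 1 (real (l1 p)) * harm (Suc n))"
proof -
  have H: "(harm (Suc n) :: real) > 0" by (rule harm_pos) simp
  have "\<bar>harm (l1 p) - harm (l1 q) :: real\<bar> \<le> 1 / max 1 (real (l1 p))"
    using l1_adjacent[OF assms]
  proof
    assume "l1 q = Suc (l1 p)"
    then have "\<bar>harm (l1 p) - harm (l1 q) :: real\<bar> = 1 / real (Suc (l1 p))"
      by (simp add: harm_Suc inverse_eq_divide)
    also have "\<dots> \<le> 1 / max 1 (real (l1 p))"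
      by (intro divide_left_mono) auto
    finally show ?thesis .
  next
    assume "l1 p = Suc (l1 q)"
    then show ?thesis by (simp add: harm_Suc inverse_eq_divide max_def)
  qed
  then have "\<bar>harm (l1 p) - harm (l1 q)\<bar> / harm (Suc n) \<le> (1 / max 1 (real (l1 p))) / harm (Suc n)"
    by (rule divide_right_mono[OF _ less_imp_le[OF H]])
  moreover have "\<bar>cutoff n q - cutoff n p\<bar> \<le> \<bar>harm (l1 p) / harm (Suc n) - harm (l1 q) / harm (Suc n)\<bar>"
    unfolding cutoff_def by linarith
  moreover have "\<bar>harm (l1 p) / harm (Suc n) - harm (l1 q) / harm (Suc n)\<bar>
      = \<bar>harm (l1 p) - harm (l1 q)\<bar> / (harm (Suc n) :: real)"
    using H by (simp add: diff_divide_distrib[symmetric])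
  ultimately show ?thesis by (simp only: divide_divide_eq_left)
qed

section \<open>Square arcs\<close>

text \<open>The half square \<open>max x \<bar>y\<bar> = r\<close>, \<open>x \<ge> 0\<close>, traversed counterclockwise from \<open>(0, - r)\<close> at \<open>t = - 2 r\<close> to \<open>(0, r)\<close>
  at \<open>t = 2 r\<close>.\<close>

definition square_arc :: "int \<Rightarrow> int \<Rightarrow> int \<times> int" where
  "square_arc r t = (if t < - r then (2 * r + t, - r) else if t \<le> r then (r, t) else (2 * r - t, r))"

lemma square_arc_adjacent: "0 < r \<Longrightarrow> - 2 * r \<le> t \<Longrightarrow> t < 2 * r \<Longrightarrow> adjacent (square_arc r t) (square_arc r (t + 1))"
  by (auto simp: square_arc_def adjacent_def)

lemma square_arc_inj: "0 < r \<Longrightarrow> inj_on (square_arc r) {- 2 * r..2 * r}"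
  by (auto simp: inj_on_def square_arc_def split: if_splits)

lemma shell_square_arc: "0 < r \<Longrightarrow> - 2 * r \<le> t \<Longrightarrow> t \<le> 2 * r \<Longrightarrow> shell (square_arc r t) = nat r"
  by (auto simp: square_arc_def shell_def)

lemma square_arc_surj:
  assumes "fst p \<ge> 0" "shell p = r"
  shows "\<exists>t \<in> {- 2 * int r..2 * int r}. p = square_arc (int r) t"
proof -
  obtain x y where p: "p = (x, y)" by fastforce
  have *: "x \<ge> 0" "max x \<bar>y\<bar> = int r" using assms by (auto simp: p shell_def)
  then consider "x = int r" "\<bar>y\<bar> \<le> int r" | "y = int r" "x < int r" | "y = - int r" "x < int r"
    by linarith
  then show ?thesis
  proof cases
    case 1
    then show ?thesis using * by (intro bexI[of _ y]) (auto simp: p square_arc_def)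
  next
    case 2
    then show ?thesis using * by (intro bexI[of _ "2 * int r - x"]) (auto simp: p square_arc_def)
  next
    case 3
    then show ?thesis using * by (intro bexI[of _ "x - 2 * int r"]) (auto simp: p square_arc_def)
  qed
qed

text \<open>The sign of the cross product expresses that the angle is nondecreasing along the arc.\<close>

lemma square_arc_cross_nonneg:
  assumes "0 < r" "- 2 * r \<le> t" "t \<le> s" "s \<le> 2 * r"
  shows "0 \<le> fst (square_arc r t) * snd (square_arc r s) - snd (square_arc r t) * fst (square_arc r s)"
proof -
  consider "t < - r" "s < - r" | "t < - r" "- r \<le> s" "s \<le> r" | "t < - r" "r < s"
    | "- r \<le> t" "t \<le> r" "s \<le> r" | "- r \<le> t" "t \<le> r" "r < s" | "r < t"
    using assms by linarith
  then show ?thesis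
  proof cases
    case 1
    have "0 \<le> r * (s - t)" using assms by simp
    also have "r * (s - t) = fst (square_arc r t) * snd (square_arc r s) - snd (square_arc r t) * fst (square_arc r s)"
      using 1 by (simp add: square_arc_def algebra_simps)
    finally show ?thesis .
  next
    case 2
    have "(2 * r + t) * (- s) \<le> (2 * r + t) * r"
      using 2 assms by (intro mult_left_mono) auto
    also have "\<dots> \<le> r * r"
      using 2 assms by (intro mult_right_mono) auto
    finally have "(2 * r + t) * (- s) \<le> r * r" .
    then show ?thesis using 2 by (simp add: square_arc_def algebra_simps)
  next
    case 3
    have "0 \<le> r * (2 * r + t) + r * (2 * r - s)" using 3 assms by simp
    then show ?thesis using 3 assms by (simp add: square_arc_def algebra_simps)
  next
    case 4
    have "0 \<le> r * (s - t)" using assms by simp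
    then show ?thesis using 4 assms by (simp add: square_arc_def algebra_simps)
  next
    case 5
    have "(2 * r - s) * t \<le> (2 * r - s) * r"
      using 5 assms by (intro mult_left_mono) auto
    also have "\<dots> \<le> r * r"
      using 5 assms by (intro mult_right_mono) auto
    finally have "(2 * r - s) * t \<le> r * r" .
    then show ?thesis using 5 by (simp add: square_arc_def algebra_simps)
  next
    case 6
    have "0 \<le> r * (s - t)" using assms by simp
    then show ?thesis using 6 assms by (simp add: square_arc_def algebra_simps)
  qed
qed

section \<open>The wedge as a cone and its infinite component\<close>

locale wedge_angles =
  fixes \<theta>\<^sub>1 \<theta>\<^sub>2 :: real
  assumes angles: "- pi / 2 \<le> \<theta>\<^sub>1" "\<theta>\<^sub>1 < \<theta>\<^sub>2" "\<theta>\<^sub>2 \<le> pi / 2"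
begin

abbreviation "W \<equiv> wedge \<theta>\<^sub>1 \<theta>\<^sub>2"
abbreviation "nb \<equiv> wedge_neighbours \<theta>\<^sub>1 \<theta>\<^sub>2"

text \<open>The wedge is \<open>{p. lower p \<ge> 0 \<and> upper p \<ge> 0}\<close>: up to the factor \<open>\<bar>p\<bar>\<close>, these are the sines of the angles between \<open>p\<close> and
  the two boundary rays. In contrast to the description by slopes, this makes no exception
  at \<open>x = 0\<close>.\<close>

definition lower :: "int \<times> int \<Rightarrow> real" where
  "lower p = cos \<theta>\<^sub>1 * snd p - sin \<theta>\<^sub>1 * fst p"

definition upper :: "int \<times> int \<Rightarrow> real" where
  "upper p = sin \<theta>\<^sub>2 * fst p - cos \<theta>\<^sub>2 * snd p"

lemma cos_nonneg: "cos \<theta>\<^sub>1 \<ge> 0" "cos \<theta>\<^sub>2 \<ge> 0"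
  using angles by (auto intro!: cos_ge_zero)

lemma cos_1_eq_0_iff: "cos \<theta>\<^sub>1 = 0 \<longleftrightarrow> \<theta>\<^sub>1 = - (pi / 2)"
proof
  show "\<theta>\<^sub>1 = - (pi / 2)" if "cos \<theta>\<^sub>1 = 0"
    using cos_gt_zero_pi[of \<theta>\<^sub>1] angles that by fastforce
qed simp

lemma cos_2_eq_0_iff: "cos \<theta>\<^sub>2 = 0 \<longleftrightarrow> \<theta>\<^sub>2 = pi / 2"
proof
  show "\<theta>\<^sub>2 = pi / 2" if "cos \<theta>\<^sub>2 = 0"
    using cos_gt_zero_pi[of \<theta>\<^sub>2] angles that by fastforce
qed (simp only: cos_pi_half)

lemma sin_if_cos_0: "cos \<theta>\<^sub>1 = 0 \<Longrightarrow> sin \<theta>\<^sub>1 = - 1" "cos \<theta>\<^sub>2 = 0 \<Longrightarrow> sin \<theta>\<^sub>2 = 1"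
  unfolding cos_1_eq_0_iff cos_2_eq_0_iff by (simp_all only: sin_minus sin_pi_half)

text \<open>Either the wedge is the half plane, where both functionals coincide with the first coordinate, or
  they are independent and determine the point.\<close>

lemma half_plane_or_salient: "(cos \<theta>\<^sub>1 = 0 \<and> cos \<theta>\<^sub>2 = 0) \<or> sin (\<theta>\<^sub>2 - \<theta>\<^sub>1) > 0"
proof (cases "\<theta>\<^sub>2 - \<theta>\<^sub>1 < pi")
  case True
  then show ?thesis using angles by (intro disjI2 sin_gt_zero) auto
next
  case False
  then have "\<theta>\<^sub>1 = - (pi / 2)" "\<theta>\<^sub>2 = pi / 2" using angles by auto
  then show ?thesis by (intro disjI1) (simp only: cos_minus cos_pi_half simp_thms)
qed

lemma fst_eq: "sin (\<theta>\<^sub>2 - \<theta>\<^sub>1) * real_of_int (fst p) = cos \<theta>\<^sub>2 * lower p + cos \<theta>\<^sub>1 * upper p"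
  by (simp add: sin_diff lower_def upper_def algebra_simps)

lemma snd_eq: "sin (\<theta>\<^sub>2 - \<theta>\<^sub>1) * real_of_int (snd p) = sin \<theta>\<^sub>2 * lower p + sin \<theta>\<^sub>1 * upper p"
  by (simp add: sin_diff lower_def upper_def algebra_simps)

text \<open>For a negative first coordinate the functionals cannot both be nonnegative, since a combination of
  them with nonnegative coefficients is a multiple of the first coordinate.\<close>

lemma wedge_iff: "p \<in> W \<longleftrightarrow> lower p \<ge> 0 \<and> upper p \<ge> 0"
proof -
  obtain x y where p: "p = (x, y)" by fastforce
  consider "x > 0" | "x < 0" | "x = 0" "y = 0" | "x = 0" "y > 0" | "x = 0" "y < 0" by linarith
  then show ?thesis
  proof cases
    case 1
    then show ?thesis
      using le_arctan_iff[of \<theta>\<^sub>1 x y] arctan_le_iff_sin_cos[of \<theta>\<^sub>2 x y] angles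
      by (auto simp: p wedge_def slope_angle_def lower_def upper_def)
  next
    case 2
    have "\<not> (lower p \<ge> 0 \<and> upper p \<ge> 0)"
      using half_plane_or_salient
    proof
      assume "cos \<theta>\<^sub>1 = 0 \<and> cos \<theta>\<^sub>2 = 0"
      then show ?thesis using 2 by (simp add: p lower_def sin_if_cos_0)
    next
      assume s: "sin (\<theta>\<^sub>2 - \<theta>\<^sub>1) > 0"
      have "sin (\<theta>\<^sub>2 - \<theta>\<^sub>1) * real_of_int (fst p) < 0"
        using s 2 by (simp add: p mult_pos_neg)
      then show ?thesis
        unfolding fst_eq using cos_nonneg by (smt (verit) mult_nonneg_nonneg)
    qed
    then show ?thesis using 2 by (auto simp: p wedge_def)
  next
    case 3
    then show ?thesis by (simp add: p wedge_def lower_def upper_def)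
  next
    case 4
    then have "p \<in> W \<longleftrightarrow> cos \<theta>\<^sub>2 = 0"
      using angles by (auto simp: p wedge_def slope_angle_def cos_2_eq_0_iff)
    moreover have "lower p \<ge> 0 \<and> upper p \<ge> 0 \<longleftrightarrow> cos \<theta>\<^sub>2 = 0"
      using 4 cos_nonneg by (auto simp: p lower_def upper_def mult_le_0_iff)
    ultimately show ?thesis by simp
  next
    case 5
    then have "p \<in> W \<longleftrightarrow> cos \<theta>\<^sub>1 = 0"
      using angles by (auto simp: p wedge_def slope_angle_def cos_1_eq_0_iff)
    moreover have "lower p \<ge> 0 \<and> upper p \<ge> 0 \<longleftrightarrow> cos \<theta>\<^sub>1 = 0"
      using 5 cos_nonneg by (auto simp: p lower_def upper_def zero_le_mult_iff mult_le_0_iff)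
    ultimately show ?thesis by simp
  qed
qed

lemma fst_nonneg: "p \<in> W \<Longrightarrow> fst p \<ge> 0"
  by (auto simp: wedge_def)

lemma lower_add: "lower (p + q) = lower p + lower q" and upper_add: "upper (p + q) = upper p + upper q"
  by (simp_all add: lower_def upper_def algebra_simps)

lemma lower_multiple: "lower (multiple k p) = real k * lower p"
  and upper_multiple: "upper (multiple k p) = real k * upper p"
  by (simp_all add: lower_def upper_def multiple_def algebra_simps)

lemma abs_lower_le: "\<bar>lower p\<bar> \<le> real (l1 p)" and abs_upper_le: "\<bar>upper p\<bar> \<le> real (l1 p)"
proof -
  have *: "\<bar>a * x - b * y\<bar> \<le> \<bar>x\<bar> + \<bar>y\<bar>" if "\<bar>a\<bar> \<le> 1" "\<bar>b\<bar> \<le> 1" for a b x y :: real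
  proof -
    have "\<bar>a * x\<bar> \<le> 1 * \<bar>x\<bar>"
      unfolding abs_mult by (rule mult_right_mono) (use that in simp_all)
    moreover have "\<bar>b * y\<bar> \<le> 1 * \<bar>y\<bar>"
      unfolding abs_mult by (rule mult_right_mono) (use that in simp_all)
    ultimately show ?thesis by linarith
  qed
  show "\<bar>lower p\<bar> \<le> real (l1 p)" "\<bar>upper p\<bar> \<le> real (l1 p)"
    using *[of "cos \<theta>\<^sub>1" "sin \<theta>\<^sub>1" "snd p" "fst p"] *[of "sin \<theta>\<^sub>2" "cos \<theta>\<^sub>2" "fst p" "snd p"]
    by (simp_all add: lower_def upper_def l1_def)
qed

lemma add_in_W: "p \<in> W \<Longrightarrow> q \<in> W \<Longrightarrow> p + q \<in> W"
  by (auto simp: wedge_iff lower_add upper_add)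

definition wedge_edges :: "((int \<times> int) \<times> (int \<times> int)) set" where
  "wedge_edges = Sigma W nb"

lemma wedge_edges_iff: "(p, q) \<in> wedge_edges \<longleftrightarrow> p \<in> W \<and> q \<in> W \<and> adjacent p q"
  by (auto simp: wedge_edges_def wedge_neighbours_def)

lemma wedge_edges_translate: "(p, q) \<in> wedge_edges \<Longrightarrow> w \<in> W \<Longrightarrow> (p + w, q + w) \<in> wedge_edges"
  by (simp add: wedge_edges_iff add_in_W adjacent_add_iff)

lemma wedge_edges_relpow_translate: "(p, q) \<in> wedge_edges ^^ k \<Longrightarrow> w \<in> W \<Longrightarrow> (p + w, q + w) \<in> wedge_edges ^^ k"
proof (induction k arbitrary: q)
  case (Suc k)
  then obtain q' where q': "(p, q') \<in> wedge_edges ^^ k" "(q', q) \<in> wedge_edges" by auto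
  show ?case
    by (rule relpow_Suc_I[OF Suc.IH[OF q'(1) Suc.prems(2)] wedge_edges_translate[OF q'(2) Suc.prems(2)]])
qed simp

lemma wedge_edges_relpow_sym: "(p, q) \<in> wedge_edges ^^ k \<Longrightarrow> (q, p) \<in> wedge_edges ^^ k"
proof (induction k arbitrary: q)
  case (Suc k)
  then obtain q' where q': "(p, q') \<in> wedge_edges ^^ k" "(q', q) \<in> wedge_edges" by auto
  then have "(q, q') \<in> wedge_edges" by (simp add: wedge_edges_iff adjacent_commute)
  from relpow_Suc_I2[OF this Suc.IH[OF q'(1)]] show ?case .
qed simp

text \<open>A single step changes either functional by at most one, so a walk of \<open>k\<close> steps that starts at depth \<open>k\<close>
  cannot leave the wedge.\<close>

lemma staircase:
  assumes "l1 (q - p) = k" "lower p \<ge> real k" "upper p \<ge> real k"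
  shows "(p, q) \<in> wedge_edges ^^ k"
  using assms
proof (induction k arbitrary: p)
  case 0
  then have "p = q" by (auto simp: l1_def prod_eq_iff)
  then show ?case by simp
next
  case (Suc k)
  obtain e where e: "l1 e = 1" "l1 (q - (p + e)) = k"
  proof -
    consider "fst q > fst p" | "fst q < fst p" | "fst q = fst p" "snd q > snd p" | "fst q = fst p" "snd q < snd p"
      using Suc.prems(1) by (cases "fst q" "fst p" rule: linorder_cases;
        cases "snd q" "snd p" rule: linorder_cases) (auto simp: l1_def)
    then show ?thesis
    proof cases
      case 1
      with Suc.prems(1) show ?thesis by (intro that[of "(1, 0)"]) (auto simp: l1_def)
    next
      case 2
      with Suc.prems(1) show ?thesis by (intro that[of "(-1, 0)"]) (auto simp: l1_def)
    next
      case 3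
      with Suc.prems(1) show ?thesis by (intro that[of "(0, 1)"]) (auto simp: l1_def)
    next
      case 4
      with Suc.prems(1) show ?thesis by (intro that[of "(0, -1)"]) (auto simp: l1_def)
    qed
  qed
  have low: "lower (p + e) \<ge> real k" "upper (p + e) \<ge> real k"
    using Suc.prems abs_lower_le[of e] abs_upper_le[of e] e(1) by (auto simp: lower_add upper_add)
  have "(p, p + e) \<in> wedge_edges"
    using Suc.prems low e(1) by (auto simp: wedge_edges_iff wedge_iff adjacent_def l1_def)
  from relpow_Suc_I2[OF this Suc.IH[OF e(2) low]] show ?case .
qed

lemma straight:
  assumes "l1 e = 1" "\<And>j. j \<le> J \<Longrightarrow> z + multiple j e \<in> W"
  shows "(z, z + multiple J e) \<in> wedge_edges ^^ J"
  using assms(2)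
proof (induction J)
  case 0
  then show ?case by (simp add: multiple_0)
next
  case (Suc J)
  have "(z + multiple J e, z + multiple (Suc J) e) \<in> wedge_edges"
    using Suc.prems[of J] Suc.prems[of "Suc J"] assms(1)
    by (auto simp: wedge_edges_iff adjacent_def multiple_Suc l1_def)
  with Suc show ?case by (auto intro: relpow_Suc_I)
qed

text \<open>A far point of a wedge is close to at most one of its two sides, and one of the four lattice directions leads away
  from that side at speed at least \<open>1 / 2\<close>, because sine and cosine are not both smaller. The exceptional
  points are those with both functionals small. In a half plane the direction \<open>(1, 0)\<close> serves every point.\<close>

lemma inward_direction:
  fixes D :: nat
  shows "\<exists>J. finite {z \<in> W. \<not> (\<exists>e. l1 e = 1 \<and> (\<forall>j\<le>J. z + multiple j e \<in> W) \<and>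
            lower (z + multiple J e) \<ge> D \<and> upper (z + multiple J e) \<ge> D)}"
  using half_plane_or_salient
proof
  assume "cos \<theta>\<^sub>1 = 0 \<and> cos \<theta>\<^sub>2 = 0"
  then have eq: "lower p = fst p" "upper p = fst p" for p
    by (simp_all add: lower_def upper_def sin_if_cos_0)
  have "\<exists>e. l1 e = 1 \<and> (\<forall>j\<le>D. z + multiple j e \<in> W) \<and>
            lower (z + multiple D e) \<ge> D \<and> upper (z + multiple D e) \<ge> D" if "z \<in> W" for z
    using that by (intro exI[of _ "(1, 0)"]) (auto simp: wedge_iff eq l1_def multiple_def)
  then have "{z \<in> W. \<not> (\<exists>e. l1 e = 1 \<and> (\<forall>j\<le>D. z + multiple j e \<in> W) \<and>
            lower (z + multiple D e) \<ge> D \<and> upper (z + multiple D e) \<ge> D)} = {}"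
    by blast
  then have "finite {z \<in> W. \<not> (\<exists>e. l1 e = 1 \<and> (\<forall>j\<le>D. z + multiple j e \<in> W) \<and>
            lower (z + multiple D e) \<ge> D \<and> upper (z + multiple D e) \<ge> D)}"
    by (simp only: finite.emptyI)
  then show ?thesis by (rule exI)
next
  assume \<sigma>: "sin (\<theta>\<^sub>2 - \<theta>\<^sub>1) > 0"
  \<comment> \<open>At speed \<open>1 / 2\<close> this many steps gain depth \<open>D\<close>; the other functional loses at most \<open>J\<close> meanwhile.\<close>
  define J where "J = 2 * D"
  define X where "X = real (D + J)"
  define k where "k = \<lceil>2 * X / sin (\<theta>\<^sub>2 - \<theta>\<^sub>1)\<rceil>"
  have X0: "X \<ge> 0" by (simp add: X_def)
  have unit: "\<bar>lower e\<bar> \<le> 1" "\<bar>upper e\<bar> \<le> 1" if "l1 e = 1" for e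
    using abs_lower_le[of e] abs_upper_le[of e] that by simp_all
  have half: "1 / 2 \<le> cos t \<or> 1 / 2 \<le> sin t \<or> 1 / 2 \<le> - sin t" if "cos t \<ge> 0" for t :: real
  proof (rule ccontr)
    assume "\<not> ?thesis"
    then have "cos t < 1 / 2" "\<bar>sin t\<bar> < 1 / 2" by linarith+
    then have "(cos t)\<^sup>2 < (1 / 2)\<^sup>2" "\<bar>sin t\<bar>\<^sup>2 < (1 / 2)\<^sup>2"
      using that by (intro power_strict_mono; simp)+
    then show False using sin_cos_squared_add[of t] by (simp add: power2_eq_square)
  qed
  have e1: "\<exists>e. l1 e = 1 \<and> lower e \<ge> 1 / 2"
    using half[OF cos_nonneg(1)]
  proof (elim disjE)
    assume "1 / 2 \<le> cos \<theta>\<^sub>1"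
    then show ?thesis by (intro exI[of _ "(0, 1)"]) (simp add: l1_def lower_def)
  next
    assume "1 / 2 \<le> sin \<theta>\<^sub>1"
    then show ?thesis by (intro exI[of _ "(-1, 0)"]) (simp add: l1_def lower_def)
  next
    assume "1 / 2 \<le> - sin \<theta>\<^sub>1"
    then show ?thesis by (intro exI[of _ "(1, 0)"]) (simp add: l1_def lower_def)
  qed
  have e2: "\<exists>e. l1 e = 1 \<and> upper e \<ge> 1 / 2"
    using half[OF cos_nonneg(2)]
  proof (elim disjE)
    assume "1 / 2 \<le> cos \<theta>\<^sub>2"
    then show ?thesis by (intro exI[of _ "(0, -1)"]) (simp add: l1_def upper_def)
  next
    assume "1 / 2 \<le> sin \<theta>\<^sub>2"
    then show ?thesis by (intro exI[of _ "(1, 0)"]) (simp add: l1_def upper_def)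
  next
    assume "1 / 2 \<le> - sin \<theta>\<^sub>2"
    then show ?thesis by (intro exI[of _ "(-1, 0)"]) (simp add: l1_def upper_def)
  qed
  let ?good = "\<lambda>z. \<exists>e. l1 e = 1 \<and> (\<forall>j\<le>J. z + multiple j e \<in> W) \<and>
            lower (z + multiple J e) \<ge> D \<and> upper (z + multiple J e) \<ge> D"
  have far: "?good z" if z: "z \<in> W" and large: "upper z > X \<or> lower z > X" for z
    using large
  proof
    assume up: "upper z > X"
    obtain e where e: "l1 e = 1" "lower e \<ge> 1 / 2" using e1 by blast
    have lo: "lower (z + multiple j e) \<ge> real j / 2" for j
      using mult_left_mono[OF e(2), of "real j"] z by (simp add: lower_add lower_multiple wedge_iff)
    have hi: "upper (z + multiple j e) \<ge> D" if "j \<le> J" for j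
    proof -
      have "\<bar>real j * upper e\<bar> \<le> real j * 1"
        unfolding abs_mult using unit(2)[OF e(1)] by (intro mult_mono) auto
      then have "real j * upper e \<ge> - real J" using that by linarith
      then show ?thesis using up by (simp add: upper_add upper_multiple X_def)
    qed
    have "z + multiple j e \<in> W" if "j \<le> J" for j
      using lo[of j] hi[OF that] unfolding wedge_iff by (auto intro: order_trans[rotated])
    with lo[of J] hi[of J] e(1) show ?thesis by (intro exI[of _ e]) (auto simp: J_def)
  next
    assume up: "lower z > X"
    obtain e where e: "l1 e = 1" "upper e \<ge> 1 / 2" using e2 by blast
    have lo: "upper (z + multiple j e) \<ge> real j / 2" for j
      using mult_left_mono[OF e(2), of "real j"] z by (simp add: upper_add upper_multiple wedge_iff)
    have hi: "lower (z + multiple j e) \<ge> D" if "j \<le> J" for j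
    proof -
      have "\<bar>real j * lower e\<bar> \<le> real j * 1"
        unfolding abs_mult using unit(1)[OF e(1)] by (intro mult_mono) auto
      then have "real j * lower e \<ge> - real J" using that by linarith
      then show ?thesis using up by (simp add: lower_add lower_multiple X_def)
    qed
    have "z + multiple j e \<in> W" if "j \<le> J" for j
      using lo[of j] hi[OF that] unfolding wedge_iff by (auto intro: order_trans[rotated])
    with lo[of J] hi[of J] e(1) show ?thesis by (intro exI[of _ e]) (auto simp: J_def)
  qed
  have "{z \<in> W. \<not> ?good z} \<subseteq> {p. \<bar>fst p\<bar> \<le> k \<and> \<bar>snd p\<bar> \<le> k}"
  proof
    fix z assume z: "z \<in> {z \<in> W. \<not> ?good z}"
    then have zW: "z \<in> W" and "\<not> ?good z" by simp_all
    from far[OF zW] this(2) have "\<not> (upper z > X \<or> lower z > X)" by blast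
    with zW have b: "0 \<le> lower z" "0 \<le> upper z" "lower z \<le> X" "upper z \<le> X"
      by (simp_all add: wedge_iff)
    have lin: "\<bar>a * lower z + c * upper z\<bar> \<le> 2 * X" if "\<bar>a\<bar> \<le> 1" "\<bar>c\<bar> \<le> 1" for a c :: real
    proof -
      have "\<bar>a * lower z\<bar> \<le> 1 * X"
        unfolding abs_mult by (rule mult_mono) (use that b in simp_all)
      moreover have "\<bar>c * upper z\<bar> \<le> 1 * X"
        unfolding abs_mult by (rule mult_mono) (use that b in simp_all)
      ultimately show ?thesis by linarith
    qed
    have bound: "\<bar>m\<bar> \<le> k" if "\<bar>sin (\<theta>\<^sub>2 - \<theta>\<^sub>1) * real_of_int m\<bar> \<le> 2 * X" for m
    proof -
      have "real_of_int \<bar>m\<bar> \<le> 2 * X / sin (\<theta>\<^sub>2 - \<theta>\<^sub>1)"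
        using that \<sigma> by (simp add: abs_mult field_simps)
      then show ?thesis unfolding k_def by linarith
    qed
    show "z \<in> {p. \<bar>fst p\<bar> \<le> k \<and> \<bar>snd p\<bar> \<le> k}"
      using bound[of "fst z"] bound[of "snd z"] lin unfolding fst_eq snd_eq by simp
  qed
  then have "finite {z \<in> W. \<not> ?good z}" by (rule finite_subset) (rule finite_box)
  then show ?thesis by (rule exI)
qed

text \<open>Go inward until the depth exceeds the length of \<open>c\<close>, move there by \<open>c\<close> along a staircase, and return along the
  translate of the first part.\<close>

lemma short_path_to_translate:
  assumes c: "c \<in> W"
  shows "\<exists>K. finite {z \<in> W. \<not> (\<exists>k\<le>K. (z, z + c) \<in> wedge_edges ^^ k)}"
proof -
  define D where "D = l1 c"
  obtain J where J: "finite {z \<in> W. \<not> (\<exists>e. l1 e = 1 \<and> (\<forall>j\<le>J. z + multiple j e \<in> W) \<and>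
            lower (z + multiple J e) \<ge> D \<and> upper (z + multiple J e) \<ge> D)}"
    using inward_direction[of D] by blast
  have "(z, z + c) \<in> wedge_edges ^^ (J + (D + J))"
    if e: "l1 e = 1" "\<And>j. j \<le> J \<Longrightarrow> z + multiple j e \<in> W"
      "lower (z + multiple J e) \<ge> D" "upper (z + multiple J e) \<ge> D" for z e
  proof -
    let ?z = "z + multiple J e"
    have 1: "(z, ?z) \<in> wedge_edges ^^ J"
      by (rule straight[OF e(1,2)])
    have 2: "(?z, ?z + c) \<in> wedge_edges ^^ D"
      by (rule staircase) (use e in \<open>auto simp: D_def\<close>)
    have 3: "(?z + c, z + c) \<in> wedge_edges ^^ J"
      by (rule wedge_edges_relpow_translate[OF wedge_edges_relpow_sym[OF 1] c])
    show ?thesis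
      unfolding relpow_add using 1 2 3 by blast
  qed
  then have "{z \<in> W. \<not> (\<exists>k\<le>J + (D + J). (z, z + c) \<in> wedge_edges ^^ k)} \<subseteq> {z \<in> W. \<not> (\<exists>e. l1 e = 1 \<and> (\<forall>j\<le>J. z + multiple j e \<in> W) \<and>
            lower (z + multiple J e) \<ge> D \<and> upper (z + multiple J e) \<ge> D)}"
    by blast
  from finite_subset[OF this J] show ?thesis by (rule exI)
qed

lemma deep_point_exists: "\<exists>c. lower c \<ge> 1 \<and> upper c \<ge> 1"
proof -
  define t where "t = (\<theta>\<^sub>1 + \<theta>\<^sub>2) / 2"
  define \<mu> where "\<mu> = sin ((\<theta>\<^sub>2 - \<theta>\<^sub>1) / 2)"
  have \<mu>: "\<mu> > 0" unfolding \<mu>_def by (rule sin_gt_zero) (use angles in auto)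
  define T where "T = 3 / \<mu>"
  \<comment> \<open>Rounding a point of the bisector costs at most \<open>2\<close> in each functional, so depth \<open>3\<close> before rounding suffices.\<close>
  define c where "c = (\<lfloor>T * cos t\<rfloor>, \<lfloor>T * sin t\<rfloor>)"
  define f g where "f = T * cos t - fst c" and "g = T * sin t - snd c"
  have fg: "0 \<le> f" "f \<le> 1" "0 \<le> g" "g \<le> 1"
    unfolding f_def g_def c_def fst_conv snd_conv by linarith+
  have small: "\<bar>a * f\<bar> \<le> 1" "\<bar>a * g\<bar> \<le> 1" if "\<bar>a\<bar> \<le> 1" for a
    unfolding abs_mult using that fg by (auto intro!: mult_le_one)
  have fstc: "real_of_int (fst c) = T * cos t - f" and sndc: "real_of_int (snd c) = T * sin t - g"
    by (simp_all add: f_def g_def)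
  have mid: "t - \<theta>\<^sub>1 = (\<theta>\<^sub>2 - \<theta>\<^sub>1) / 2" "\<theta>\<^sub>2 - t = (\<theta>\<^sub>2 - \<theta>\<^sub>1) / 2"
    by (simp_all add: t_def field_simps)
  have s: "sin t * cos \<theta>\<^sub>1 - cos t * sin \<theta>\<^sub>1 = \<mu>" "sin \<theta>\<^sub>2 * cos t - cos \<theta>\<^sub>2 * sin t = \<mu>"
    by (simp_all only: \<mu>_def sin_diff[symmetric] mid)
  have T: "T * \<mu> = 3" using \<mu> by (simp add: T_def)
  have "lower c = T * (sin t * cos \<theta>\<^sub>1 - cos t * sin \<theta>\<^sub>1) - cos \<theta>\<^sub>1 * g + sin \<theta>\<^sub>1 * f"
    unfolding lower_def fstc sndc by (simp add: algebra_simps)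
  moreover have "upper c = T * (sin \<theta>\<^sub>2 * cos t - cos \<theta>\<^sub>2 * sin t) - sin \<theta>\<^sub>2 * f + cos \<theta>\<^sub>2 * g"
    unfolding upper_def fstc sndc by (simp add: algebra_simps)
  ultimately show ?thesis
    unfolding s T using small[of "cos \<theta>\<^sub>1"] small[of "sin \<theta>\<^sub>1"] small[of "cos \<theta>\<^sub>2"] small[of "sin \<theta>\<^sub>2"]
    by (intro exI[of _ c]) (simp add: abs_le_iff)
qed

definition deep :: "int \<times> int" where
  "deep = (SOME c. lower c \<ge> 1 \<and> upper c \<ge> 1)"

lemma deep: "lower deep \<ge> 1" "upper deep \<ge> 1"
  using someI_ex[OF deep_point_exists] by (simp_all add: deep_def)

lemma deep_multiple_in_W: "multiple k deep \<in> W"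
  using deep by (simp add: wedge_iff lower_multiple upper_multiple)

lemma deep_in_W: "deep \<in> W"
  using deep by (simp add: wedge_iff)

text \<open>The infinite component of the wedge. Any two points of this set are connected, since far translates of them in the direction
  \<open>deep\<close> are joined by a staircase; this makes it unnecessary to single out a component by its cardinality.\<close>

definition V :: "(int \<times> int) set" where
  "V = {z \<in> W. (z, z + deep) \<in> wedge_edges\<^sup>*}"

lemma V_subset: "V \<subseteq> W"
  by (auto simp: V_def)

lemma wedge_edges_rtrancl_translate: "(p, q) \<in> wedge_edges\<^sup>* \<Longrightarrow> w \<in> W \<Longrightarrow> (p + w, q + w) \<in> wedge_edges\<^sup>*"
  by (metis wedge_edges_relpow_translate relpow_imp_rtrancl rtrancl_imp_relpow)

lemma V_closed: "p \<in> V \<Longrightarrow> (p, q) \<in> wedge_edges \<Longrightarrow> q \<in> V"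
proof -
  assume p: "p \<in> V" and pq: "(p, q) \<in> wedge_edges"
  have "(q, p) \<in> wedge_edges" using pq by (simp add: wedge_edges_iff adjacent_commute)
  moreover have "(p, p + deep) \<in> wedge_edges\<^sup>*" using p by (simp add: V_def)
  moreover have "(p + deep, q + deep) \<in> wedge_edges" by (rule wedge_edges_translate[OF pq deep_in_W])
  ultimately have "(q, q + deep) \<in> wedge_edges\<^sup>*"
    by (meson converse_rtrancl_into_rtrancl rtrancl_into_rtrancl)
  then show "q \<in> V" using pq by (simp add: V_def wedge_edges_iff)
qed

lemma V_add: "p \<in> V \<Longrightarrow> w \<in> W \<Longrightarrow> p + w \<in> V"
  using wedge_edges_rtrancl_translate[of p "p + deep" w] add_in_W by (auto simp: V_def algebra_simps)

lemma V_cofinite: "finite (W - V)"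
proof -
  obtain K where K: "finite {z \<in> W. \<not> (\<exists>k\<le>K. (z, z + deep) \<in> wedge_edges ^^ k)}"
    using short_path_to_translate[OF deep_in_W] by blast
  show ?thesis
    by (rule finite_subset[OF _ K]) (auto simp: V_def dest: relpow_imp_rtrancl)
qed

lemma infinite_V: "infinite V"
proof
  assume "finite V"
  with V_cofinite have "finite (V \<union> (W - V))" by blast
  then have "finite W" by (rule finite_subset[rotated]) blast
  moreover have "range (\<lambda>k. multiple k deep) \<subseteq> W" using deep_multiple_in_W by blast
  moreover have "inj (\<lambda>k. multiple k deep)"
    using deep by (auto simp: inj_def multiple_def lower_def)
  ultimately show False
    using finite_subset range_inj_infinite by blast
qed

lemma wedge_edges_connected_V:
  assumes p: "p \<in> V" and q: "q \<in> V"
  shows "(p, q) \<in> wedge_edges\<^sup>*"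
proof -
  have shift: "(z, z + multiple k deep) \<in> wedge_edges\<^sup>*" if "z \<in> V" for z k
  proof (induction k)
    case 0
    then show ?case by (simp add: multiple_0)
  next
    case (Suc k)
    have "(z + multiple k deep, z + deep + multiple k deep) \<in> wedge_edges\<^sup>*"
      using that by (intro wedge_edges_rtrancl_translate deep_multiple_in_W) (simp add: V_def)
    with Suc show ?case
      by (simp add: multiple_Suc algebra_simps)
  qed
  define k where "k = l1 (q - p)"
  have pW: "lower p \<ge> 0" "upper p \<ge> 0" using p by (auto simp: V_def wedge_iff)
  have "(p + multiple k deep, q + multiple k deep) \<in> wedge_edges ^^ k"
  proof (rule staircase)
    show "l1 (q + multiple k deep - (p + multiple k deep)) = k" by (simp add: k_def)
    show "real k \<le> lower (p + multiple k deep)" "real k \<le> upper (p + multiple k deep)"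
      using mult_left_mono[OF deep(1), of "real k"] mult_left_mono[OF deep(2), of "real k"] pW
      by (simp_all add: lower_add upper_add lower_multiple upper_multiple)
  qed
  then have "(p + multiple k deep, q + multiple k deep) \<in> wedge_edges\<^sup>*" by (rule relpow_imp_rtrancl)
  moreover have "(q + multiple k deep, q) \<in> wedge_edges\<^sup>*"
    using shift[OF q, of k] by (meson wedge_edges_relpow_sym relpow_imp_rtrancl rtrancl_imp_relpow)
  ultimately show ?thesis using shift[OF p, of k] by (meson rtrancl_trans)
qed

lemma relpow_in_V: "(p, q) \<in> wedge_edges ^^ k \<Longrightarrow> p \<in> V \<Longrightarrow> (p, q) \<in> (Sigma V nb) ^^ k \<and> q \<in> V"
proof (induction k arbitrary: q)
  case (Suc k)
  then obtain q' where q': "(p, q') \<in> wedge_edges ^^ k" "(q', q) \<in> wedge_edges" by auto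
  with Suc have "(p, q') \<in> (Sigma V nb) ^^ k" "q' \<in> V" by auto
  with q'(2) show ?case using V_closed by (auto simp: wedge_edges_def intro: relpow_Suc_I)
qed simp

text \<open>The angle is monotone along the arc, so the part of it inside the wedge is contiguous. Algebraically, the
  cross product expresses the functional at \<open>s\<close> by its value at the ends; only the ends of the arc on
  the vertical axis, where the factor \<open>x\<close> degenerates, need a separate argument.\<close>

lemma square_arc_between:
  assumes r: "0 < r" and t: "- 2 * r \<le> t" "t \<le> s" "s \<le> t'" "t' \<le> 2 * r"
    and W: "square_arc r t \<in> W" "square_arc r t' \<in> W"
  shows "square_arc r s \<in> W"
proof -
  let ?p = "square_arc r t" and ?q = "square_arc r s" and ?p' = "square_arc r t'"
  have fst_nonneg: "fst ?p \<ge> 0" "fst ?p' \<ge> 0" "fst ?q \<ge> 0"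
    using r t by (auto simp: square_arc_def)
  have lower: "lower ?q \<ge> 0"
  proof (cases "fst ?p = 0")
    case True
    then consider "t = - 2 * r" | "t = 2 * r" using r t by (auto simp: square_arc_def split: if_splits)
    then show ?thesis
    proof cases
      case 1
      then have "cos \<theta>\<^sub>1 * r \<le> 0"
        using W(1) r by (simp add: wedge_iff lower_def square_arc_def)
      then have "cos \<theta>\<^sub>1 = 0" using r cos_nonneg by (simp add: mult_le_0_iff)
      then have "lower ?q = fst ?q" by (simp add: lower_def sin_if_cos_0)
      then show ?thesis using fst_nonneg by simp
    next
      case 2
      then have "s = t" using t by simp
      then show ?thesis using W by (simp add: wedge_iff)
    qed
  next
    case False
    have cross: "0 \<le> fst ?p * snd ?q - snd ?p * fst ?q"
      by (rule square_arc_cross_nonneg) (use r t in auto)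
    have "0 \<le> fst ?q * lower ?p + cos \<theta>\<^sub>1 * real_of_int (fst ?p * snd ?q - snd ?p * fst ?q)"
      using cross W(1) cos_nonneg fst_nonneg by (auto simp: wedge_iff simp del: of_int_diff of_int_mult)
    also have "\<dots> = fst ?p * lower ?q"
      by (simp add: lower_def algebra_simps)
    finally show ?thesis using False fst_nonneg by (simp add: zero_le_mult_iff)
  qed
  have upper: "upper ?q \<ge> 0"
  proof (cases "fst ?p' = 0")
    case True
    then consider "t' = 2 * r" | "t' = - 2 * r" using r t by (auto simp: square_arc_def split: if_splits)
    then show ?thesis
    proof cases
      case 1
      then have "cos \<theta>\<^sub>2 * r \<le> 0"
        using W(2) r by (simp add: wedge_iff upper_def square_arc_def)
      then have "cos \<theta>\<^sub>2 = 0" using r cos_nonneg by (simp add: mult_le_0_iff)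
      then have "upper ?q = fst ?q" by (simp add: upper_def sin_if_cos_0)
      then show ?thesis using fst_nonneg by simp
    next
      case 2
      then have "s = t'" using t by simp
      then show ?thesis using W by (simp add: wedge_iff)
    qed
  next
    case False
    have cross: "0 \<le> fst ?q * snd ?p' - snd ?q * fst ?p'"
      by (rule square_arc_cross_nonneg) (use r t in auto)
    have "0 \<le> fst ?q * upper ?p' + cos \<theta>\<^sub>2 * real_of_int (fst ?q * snd ?p' - snd ?q * fst ?p')"
      using cross W(2) cos_nonneg fst_nonneg by (auto simp: wedge_iff simp del: of_int_diff of_int_mult)
    also have "\<dots> = fst ?p' * upper ?q"
      by (simp add: upper_def algebra_simps)
    finally show ?thesis using False fst_nonneg by (simp add: zero_le_mult_iff)
  qed
  show ?thesis using lower upper by (simp add: wedge_iff)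
qed

lemma square_arc_path:
  assumes r: "0 < r" and t: "- 2 * int r \<le> t" "t \<le> t'" "t' \<le> 2 * int r"
    and V: "square_arc r t \<in> V" "square_arc r t' \<in> V"
  shows "\<exists>F \<subseteq> {e \<in> Sigma V nb. shell (fst e) = r}. finite F \<and> real (card F) \<le> 4 * real r \<and>
        (\<forall>u :: int \<times> int \<Rightarrow> real. \<bar>u (square_arc r t) - u (square_arc r t')\<bar> \<le> (\<Sum>e\<in>F. \<bar>u (snd e) - u (fst e)\<bar>))"
proof -
  define g where "g s = (square_arc r s, square_arc r (s + 1))" for s
  have inW: "square_arc r s \<in> W" if "t \<le> s" "s \<le> t'" for s
    using square_arc_between[of r t s t'] r t V V_subset that by auto
  have inR: "g s \<in> wedge_edges" if "t \<le> s" "s < t'" for s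
    using inW[of s] inW[of "s + 1"] square_arc_adjacent[of r s] r t that by (simp add: g_def wedge_edges_iff)
  have inV: "square_arc r s \<in> V" if "t \<le> s" "s \<le> t'" for s
    using that
  proof (induction s rule: int_ge_induct)
    case base
    then show ?case using V by simp
  next
    case (step s)
    then show ?case using V_closed[OF _ inR[of s, unfolded g_def]] by simp
  qed
  have inj: "inj_on g {t..<t'}"
    using square_arc_inj[of "int r"] r t by (auto simp: g_def inj_on_def)
  have sub: "g ` {t..<t'} \<subseteq> {e \<in> Sigma V nb. shell (fst e) = r}"
  proof
    fix e assume "e \<in> g ` {t..<t'}"
    then obtain s where s: "t \<le> s" "s < t'" "e = g s" by auto
    then show "e \<in> {e \<in> Sigma V nb. shell (fst e) = r}"
      using inV[of s] inR[of s] shell_square_arc[of r s] r t by (auto simp: g_def wedge_edges_def)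
  qed
  have tele: "\<bar>u (square_arc r t) - u (square_arc r s)\<bar> \<le> (\<Sum>i\<in>{t..<s}. \<bar>u (square_arc r (i + 1)) - u (square_arc r i)\<bar>)"
    if "t \<le> s" for u :: "int \<times> int \<Rightarrow> real" and s
    using that
  proof (induction s rule: int_ge_induct)
    case base
    then show ?case by simp
  next
    case (step s)
    have "{t..<s + 1} = insert s {t..<s}" using step.hyps by auto
    then show ?case using step.IH by simp
  qed
  have "\<bar>u (square_arc r t) - u (square_arc r t')\<bar> \<le> (\<Sum>e\<in>g ` {t..<t'}. \<bar>u (snd e) - u (fst e)\<bar>)" for u :: "int \<times> int \<Rightarrow> real"
    using tele[OF t(2), of u] by (subst sum.reindex[OF inj]) (simp add: g_def)
  moreover have "real (card (g ` {t..<t'})) \<le> 4 * real r"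
    using t by (subst card_image[OF inj]) simp
  ultimately show ?thesis
    using sub by (intro exI[of _ "g ` {t..<t'}"]) auto
qed

lemma shell_path_V:
  assumes r: "1 \<le> r" and pq: "p \<in> V" "q \<in> V" "shell p = r" "shell q = r"
  shows "\<exists>F \<subseteq> {e \<in> Sigma V nb. shell (fst e) = r}. finite F \<and> real (card F) \<le> 4 * real r \<and>
        (\<forall>u :: int \<times> int \<Rightarrow> real. \<bar>u p - u q\<bar> \<le> (\<Sum>e\<in>F. \<bar>u (snd e) - u (fst e)\<bar>))"
proof -
  obtain t where t: "t \<in> {- 2 * int r..2 * int r}" "p = square_arc r t"
    using square_arc_surj[of p r] pq fst_nonneg V_subset by blast
  obtain t' where t': "t' \<in> {- 2 * int r..2 * int r}" "q = square_arc r t'"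
    using square_arc_surj[of q r] pq fst_nonneg V_subset by blast
  have comm: "\<bar>u q - u p\<bar> = \<bar>u p - u q\<bar>" for u :: "int \<times> int \<Rightarrow> real"
    by (rule abs_minus_commute)
  show ?thesis
  proof (cases "t \<le> t'")
    case True
    then show ?thesis using square_arc_path[of r t t'] r t t' pq by simp
  next
    case False
    then show ?thesis using square_arc_path[of r t' t] r t t' pq comm by simp
  qed
qed

lemma card_nb_le: "card (nb p) \<le> 4"
proof -
  have "nb p \<subseteq> {p + (1, 0), p + (-1, 0), p + (0, 1), p + (0, -1)}"
  proof
    fix q assume "q \<in> nb p"
    then have "adjacent p q" by (simp add: wedge_neighbours_def)
    then show "q \<in> {p + (1, 0), p + (-1, 0), p + (0, 1), p + (0, -1)}"
      by (cases p; cases q) (auto simp: adjacent_def)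
  qed
  from card_mono[OF _ this] have "card (nb p) \<le> card {p + (1, 0), p + (-1, 0), p + (0, 1), p + (0, -1)}"
    by simp
  also have "\<dots> \<le> 4"
    by (rule order_trans[OF card_insert_le_m1]) (auto simp: card_insert_if)
  finally show ?thesis .
qed

end

section \<open>Convergence of the hitting probabilities in a wedge\<close>

context wedge_angles
begin

text \<open>There are at most \<open>4 r + 2\<close> points with norm \<open>r\<close>, each with at most four edges, and the squared gradient there is at most
  \<open>1 / (r * harm (Suc n))\<^sup>2\<close>. This is where dimension two is used: the sum over \<open>r\<close> is a harmonic
  number, of smaller order than its square.\<close>

lemma cutoff_energy_le:
  "(\<integral>e. (cutoff n (snd e) - cutoff n (fst e))\<^sup>2 \<partial>count_space (Sigma V nb))
     \<le> 24 * (1 + harm (Suc n)) / (harm (Suc n))\<^sup>2"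
proof -
  define N where "N = Suc n"
  define H where "H = (harm N :: real)"
  have H: "H > 0" unfolding H_def N_def by (rule harm_pos) simp
  define g where "g e = (cutoff n (snd e) - cutoff n (fst e))\<^sup>2" for e
  define P where "P = {p \<in> V. l1 p \<le> N}"
  have finP: "finite P" unfolding P_def by (rule finite_subset[OF _ finite_l1[of N]]) auto
  have finE: "finite (Sigma P nb)" using finP by auto
  have adj: "adjacent p q" if "q \<in> nb p" for p q using that by (simp add: wedge_neighbours_def)
  have supp: "{e \<in> Sigma V nb. g e \<noteq> 0} \<subseteq> Sigma P nb"
  proof
    fix e assume "e \<in> {e \<in> Sigma V nb. g e \<noteq> 0}"
    then obtain p q where e: "e = (p, q)" "p \<in> V" "q \<in> nb p" "g (p, q) \<noteq> 0" by auto
    have "l1 p \<le> N"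
    proof (rule ccontr)
      assume "\<not> l1 p \<le> N"
      then have "Suc n \<le> l1 p" "Suc n \<le> l1 q"
        using l1_adjacent[OF adj[OF e(3)]] by (auto simp: N_def)
      then show False using e(4) by (simp add: g_def cutoff_eq_0)
    qed
    then show "e \<in> Sigma P nb" using e by (simp add: P_def)
  qed
  have "(\<integral>e. g e \<partial>count_space (Sigma V nb)) = (\<Sum>e\<in>Sigma P nb. g e)"
  proof -
    have "(\<integral>e. g e \<partial>count_space (Sigma V nb)) = (\<Sum>e | e \<in> Sigma V nb \<and> g e \<noteq> 0. g e)"
      by (rule lebesgue_integral_count_space_finite_support[OF finite_subset[OF supp finE]])
    also have "\<dots> = (\<Sum>e\<in>Sigma P nb. g e)"
      using supp finE by (intro sum.mono_neutral_left) (auto simp: P_def)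
    finally show ?thesis .
  qed
  also have "\<dots> = (\<Sum>p\<in>P. \<Sum>q\<in>nb p. g (p, q))"
    using finP by (subst sum.Sigma) auto
  also have "\<dots> \<le> (\<Sum>p\<in>P. 4 * (1 / (max 1 (real (l1 p)) * H))\<^sup>2)"
  proof (rule sum_mono)
    fix p assume "p \<in> P"
    have "(\<Sum>q\<in>nb p. g (p, q)) \<le> real (card (nb p)) * (1 / (max 1 (real (l1 p)) * H))\<^sup>2"
    proof (rule sum_bounded_above)
      fix q assume "q \<in> nb p"
      from cutoff_edge[OF adj[OF this], of n]
      have "\<bar>cutoff n q - cutoff n p\<bar>\<^sup>2 \<le> (1 / (max 1 (real (l1 p)) * H))\<^sup>2"
        unfolding H_def N_def by (rule power_mono) simp
      then show "g (p, q) \<le> (1 / (max 1 (real (l1 p)) * H))\<^sup>2"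
        by (simp add: g_def)
    qed
    also have "\<dots> \<le> 4 * (1 / (max 1 (real (l1 p)) * H))\<^sup>2"
      using card_nb_le[of p] by (intro mult_right_mono) auto
    finally show "(\<Sum>q\<in>nb p. g (p, q)) \<le> 4 * (1 / (max 1 (real (l1 p)) * H))\<^sup>2" .
  qed
  also have "\<dots> = (\<Sum>r\<in>{..N}. \<Sum>p\<in>{p \<in> P. l1 p = r}. 4 * (1 / (max 1 (real (l1 p)) * H))\<^sup>2)"
    by (rule sum.group[symmetric]) (use finP in \<open>auto simp: P_def\<close>)
  also have "\<dots> \<le> (\<Sum>r\<in>{..N}. 24 / (max 1 (real r) * H\<^sup>2))"
  proof (rule sum_mono)
    fix r assume "r \<in> {..N}"
    let ?m = "max 1 (real r)"
    have "finite {p. l1 p = r}"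
      by (rule finite_subset[OF _ finite_l1[of r]]) auto
    then have "card {p \<in> P. l1 p = r} \<le> card {p. l1 p = r}"
      by (rule card_mono) auto
    also have "\<dots> \<le> 4 * r + 2" by (rule card_l1_sphere)
    finally have "real (card {p \<in> P. l1 p = r}) \<le> real (4 * r + 2)"
      by (rule of_nat_mono)
    also have "\<dots> \<le> 6 * ?m" by (cases r) auto
    finally have card: "real (card {p \<in> P. l1 p = r}) \<le> 6 * ?m" .
    have "(\<Sum>p\<in>{p \<in> P. l1 p = r}. 4 * (1 / (max 1 (real (l1 p)) * H))\<^sup>2)
        = real (card {p \<in> P. l1 p = r}) * (4 * (1 / (?m * H))\<^sup>2)"
      by simp
    also have "\<dots> \<le> (6 * ?m) * (4 * (1 / (?m * H))\<^sup>2)"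
      by (rule mult_right_mono[OF card]) simp
    also have "\<dots> = 24 / (?m * H\<^sup>2)"
      using H by (simp add: power2_eq_square field_simps)
    finally show "(\<Sum>p\<in>{p \<in> P. l1 p = r}. 4 * (1 / (max 1 (real (l1 p)) * H))\<^sup>2) \<le> 24 / (?m * H\<^sup>2)" .
  qed
  also have "\<dots> = (24 / H\<^sup>2) * (\<Sum>r\<in>{..N}. 1 / max 1 (real r))"
    by (subst sum_distrib_left) (rule sum.cong, simp_all add: mult.commute)
  also have "(\<Sum>r\<in>{..N}. 1 / max 1 (real r)) = 1 + H"
  proof -
    have "{..N} = insert 0 {1..N}" by auto
    then have "(\<Sum>r\<in>{..N}. 1 / max 1 (real r)) = 1 + (\<Sum>r\<in>{1..N}. 1 / max 1 (real r))" by simp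
    also have "(\<Sum>r\<in>{1..N}. 1 / max 1 (real r)) = H"
      unfolding H_def harm_def by (rule sum.cong) (auto simp: inverse_eq_divide max_def)
    finally show ?thesis .
  qed
  finally show ?thesis by (simp add: g_def H_def N_def)
qed

lemma cutoff_energy_lim:
  "(\<lambda>n. \<integral>e. (cutoff n (snd e) - cutoff n (fst e))\<^sup>2 \<partial>count_space (Sigma V nb)) \<longlonglongrightarrow> 0"
proof (rule tendsto_sandwich[OF _ _ tendsto_const])
  have inv: "(\<lambda>n. inverse (harm (Suc n)) :: real) \<longlonglongrightarrow> 0"
    by (rule tendsto_inverse_0_at_top[OF harm_Suc_at_top])
  have "(\<lambda>n. 24 * (inverse (harm (Suc n)) * inverse (harm (Suc n)) + inverse (harm (Suc n))) :: real) \<longlonglongrightarrow> 24 * (0 * 0 + 0)"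
    by (intro tendsto_intros inv)
  moreover have "24 * (inverse h * inverse h + inverse h) = 24 * (1 + h) / h\<^sup>2" if "h > 0" for h :: real
    using that by (simp add: field_simps power2_eq_square)
  ultimately show "(\<lambda>n. 24 * (1 + harm (Suc n)) / (harm (Suc n))\<^sup>2 :: real) \<longlonglongrightarrow> 0"
    by (simp add: harm_pos)
  show "\<forall>\<^sub>F n in sequentially.
      (\<integral>e. (cutoff n (snd e) - cutoff n (fst e))\<^sup>2 \<partial>count_space (Sigma V nb)) \<le> 24 * (1 + harm (Suc n)) / (harm (Suc n))\<^sup>2"
    by (intro always_eventually allI cutoff_energy_le)
qed (simp add: always_eventually)

lemma V_nonempty: obtains b where "b \<in> V"
  using infinite_imp_nonempty[OF infinite_V] by blast

lemma translation_graph_V: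
  assumes b: "b \<in> V"
  shows "translation_graph V nb cutoff shell 4 1 (hitting_prob \<theta>\<^sub>1 \<theta>\<^sub>2) b"
proof unfold_locales
  fix p q assume pq: "p \<in> V" "q \<in> nb p"
  then have wedge_edges: "(p, q) \<in> wedge_edges" using V_subset by (auto simp: wedge_edges_def)
  then have W: "p \<in> W" "q \<in> W" "adjacent p q" by (auto simp: wedge_edges_iff)
  show "p \<in> nb q" using W by (simp add: wedge_neighbours_def adjacent_commute)
  show "shell q \<le> Suc (shell p)" using W(3) by (rule shell_adjacent)
  fix w assume "w \<in> V"
  then show "q + w \<in> nb (p + w)"
    using W V_subset by (auto simp: wedge_neighbours_def adjacent_add_iff add_in_W)
next
  fix p assume "p \<in> V"
  then show "nb p \<subseteq> V"
    using V_closed[of p] V_subset unfolding wedge_edges_def by blast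
next
  fix p q assume "p \<in> V" "q \<in> V"
  then show "(p, q) \<in> (Sigma V nb)\<^sup>*"
    using wedge_edges_connected_V relpow_in_V by (meson relpow_imp_rtrancl rtrancl_imp_relpow)
next
  fix n show "finite {p \<in> V. cutoff n p \<noteq> 0}"
    by (rule finite_subset[OF _ finite_l1[of "Suc n"]]) (use cutoff_eq_0 nat_le_linear in blast)
next
  fix r show "finite {p \<in> V. shell p \<le> r}"
    by (rule finite_subset[OF _ finite_shell[of r]]) auto
next
  obtain K where K: "finite {z \<in> W. \<not> (\<exists>k\<le>K. (z, z + b) \<in> wedge_edges ^^ k)}"
    using short_path_to_translate b V_subset by blast
  have "{z \<in> V. \<not> (\<exists>k\<le>K. (z, z + b) \<in> Sigma V nb ^^ k)} \<subseteq> {z \<in> W. \<not> (\<exists>k\<le>K. (z, z + b) \<in> wedge_edges ^^ k)}"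
    using relpow_in_V V_subset by blast
  from finite_subset[OF this K] show "\<exists>K. finite {z \<in> V. \<not> (\<exists>k\<le>K. (z, z + b) \<in> Sigma V nb ^^ k)}"
    by (rule exI)
qed (use b V_add V_subset infinite_V shell_path_V in
    \<open>auto simp: cutoff_bounds cutoff_lim cutoff_energy_lim hitting_prob_bounds hitting_prob_on hitting_prob_mean\<close>)

text \<open>Balls are finite and \<open>V\<close> misses only finitely many points of the wedge, so convergence along \<open>V\<close>
  off finite sets implies convergence as the norm tends to infinity.\<close>

lemma wedge_at_infinity_le: "wedge_at_infinity \<theta>\<^sub>1 \<theta>\<^sub>2 \<le> inf cofinite (principal V)"
proof (rule filter_leI)
  fix P assume "eventually P (inf cofinite (principal V))"
  then have "finite {p. \<not> (p \<in> V \<longrightarrow> P p)}"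
    by (simp add: eventually_inf_principal eventually_cofinite)
  with V_cofinite have fin: "finite ({p. \<not> (p \<in> V \<longrightarrow> P p)} \<union> (W - V))" (is "finite ?B") by blast
  define r where "r = Max (insert 0 (euclid_norm ` ?B)) + 1"
  have "euclid_norm p < r" if "p \<in> ?B" for p
  proof -
    have "euclid_norm p \<le> Max (insert 0 (euclid_norm ` ?B))"
      using that fin by (intro Max_ge) auto
    then show ?thesis by (simp add: r_def)
  qed
  then have "P p" if "p \<in> W" "euclid_norm p \<ge> r" for p
    using that by (cases "p \<in> ?B") fastforce+
  then show "eventually P (wedge_at_infinity \<theta>\<^sub>1 \<theta>\<^sub>2)"
    unfolding wedge_at_infinity_def eventually_inf_principal eventually_filtercomap
      eventually_at_top_linorder by blast
qed

lemma hitting_prob_converges: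
  "\<exists>L. ((\<lambda>x. hitting_prob \<theta>\<^sub>1 \<theta>\<^sub>2 A x y) \<longlongrightarrow> L) (wedge_at_infinity \<theta>\<^sub>1 \<theta>\<^sub>2)"
proof -
  obtain b where "b \<in> V" by (rule V_nonempty)
  then interpret translation_graph V nb cutoff shell 4 1 "hitting_prob \<theta>\<^sub>1 \<theta>\<^sub>2" b
    by (rule translation_graph_V)
  show ?thesis
    using hit_limit_exists[of A y] tendsto_mono[OF wedge_at_infinity_le]
    unfolding at_inf_def by blast
qed

end

theorem theorem3:
  fixes \<theta>\<^sub>1 \<theta>\<^sub>2 :: real and A :: "(int \<times> int) set" and y :: "int \<times> int"
  assumes "- pi / 2 \<le> \<theta>\<^sub>1" and "\<theta>\<^sub>1 < \<theta>\<^sub>2" and "\<theta>\<^sub>2 \<le> pi / 2"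
    and "A \<subseteq> wedge \<theta>\<^sub>1 \<theta>\<^sub>2"
  shows "((\<lambda>x. hitting_prob \<theta>\<^sub>1 \<theta>\<^sub>2 A x y) \<longlongrightarrow> harmonic_measure_infinity \<theta>\<^sub>1 \<theta>\<^sub>2 A y)
           (wedge_at_infinity \<theta>\<^sub>1 \<theta>\<^sub>2)"
proof -
  interpret wedge_angles \<theta>\<^sub>1 \<theta>\<^sub>2 by unfold_locales (use assms in auto)
  obtain L where L: "((\<lambda>x. hitting_prob \<theta>\<^sub>1 \<theta>\<^sub>2 A x y) \<longlongrightarrow> L) (wedge_at_infinity \<theta>\<^sub>1 \<theta>\<^sub>2)"
    using hitting_prob_converges by blast
  have "harmonic_measure_infinity \<theta>\<^sub>1 \<theta>\<^sub>2 A y = L"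
    unfolding harmonic_measure_infinity_def
    by (rule tendsto_Lim[OF wedge_at_infinity_neq_bot[OF assms(1-3)] L])
  with L show ?thesis by simp
qed

end
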